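(* Let $A$ be a ring, let $T_1$ be a partial silting $A$-module with respect to a projective presentation $\sigma$, let $T=T_1\oplus M_A$ be its Bongartz completion to a silting module, and let $f:A\to B$ be the ring epimorphism associated with $T_1$. Then there is an isomorphism of rings between $B$ and $\mathrm{End}_A(T)/I$, where $I$ is the two-sided ideal given by the endomorphisms of $T$ factoring through an object in $\mathrm{Add}(T_1)$. Furthermore, the ideal $I$ is idempotent.
   Context: Rings are unital and modules are right modules; $\mathrm{Mod}(A)$ is the category of all $A$-modules. $\mathrm{Add}(M)$ is the class of all modules isomorphic to direct summands of direct sums of copies of $M$; $\mathrm{Gen}(M)$ is the class of all epimorphic images of modules in $\mathrm{Add}(M)$. For a morphism $\sigma:P\to Q$ between projective $A$-modules put $\mathcal{D}_\sigma:=\{X\in \mathrm{Mod}(A)\mid \mathrm{Hom}_A(\sigma,X)\text{ is surjective}\}$. An $A$-module $T_1$ is partial silting with respect to a projective presentation $\sigma$ of $T_1$ (i.e. $P\xrightarrow{\sigma}Q\to T_1\to 0$ exact with $P,Q$ projective) if $\mathcal{D}_\sigma$ is a torsion class and $T_1\in\mathcal{D}_\sigma$. A module $T$ is silting if $\mathrm{Gen}(T)=\mathcal{D}_{\sigma'}$ for some projective presentation $\sigma'$ of $T$. Bongartz completion: let $I_0=\mathrm{Hom}_A(P,A)$ and let $\phi_A:A\to M_A$ be the pushout of $\sigma^{(I_0)}:P^{(I_0)}\to Q^{(I_0)}$ along the canonical map $P^{(I_0)}\to A$. This gives an exact sequence $A\xrightarrow{\phi_A}M_A\to T_1^{(I_0)}\to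 0$ with $\phi_A$ a left $\mathcal{D}_\sigma$-approximation (i.e. $M_A\in\mathcal{D}_\sigma$ and every map from $A$ to a module in $\mathcal{D}_\sigma$ factors through $\phi_A$), and $T:=T_1\oplus M_A$ is a silting module with $\mathrm{Gen}(T)=\mathcal{D}_\sigma$. Associated ring epimorphism: equivalence classes of ring epimorphisms $f:A\to B$ correspond bijectively to bireflective subcategories of $\mathrm{Mod}(A)$ (full subcategories closed under products, coproducts, kernels and cokernels), by assigning to $f$ the essential image $\mathcal{X}_B$ of the restriction functor $f_*:\mathrm{Mod}(B)\to \mathrm{Mod}(A)$. The full subcategory $\mathcal{Y}=\{X\in \mathrm{Mod}(A)\mid X\in\mathcal{D}_\sigma,\ \mathrm{Hom}_A(T_1,X)=0\}$ is bireflective, and the ring epimorphism associated with $T_1$ is the $f:A\to B$ (unique up to equivalence) with $\mathcal{X}_B=\mathcal{Y}$. *)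

theory Defs
  imports "HOL-Algebra.Module" "HOL-Algebra.QuotRing" "HOL-Algebra.Ideal_Product" "HOL-Library.Equipollence"
begin

section \<open>Right modules\<close>

text \<open>
  \<^locale>\<open>module\<close> of HOL-Algebra is restricted to commutative rings, but its record type can be
  reused: for a right module, \<open>a \<odot>\<^bsub>M\<^esub> x\<close> is read as \<open>x \<cdot> a\<close>, whence the order of the factors in
  \<open>smult_assoc\<close>. The fields \<^const>\<open>mult\<close> and \<^const>\<open>one\<close>, which the record inherits from rings, carry
  no meaning here; \<open>mk_module\<close> leaves them unspecified.
\<close>

locale right_module = R?: ring R + M?: abelian_group M
  for R :: "('a, 'm) ring_scheme" (structure) and M :: "('a, 'x) module" (structure) +
  assumes smult_closed [simp, intro]:
      "\<lbrakk>a \<in> carrier R; x \<in> carrier M\<rbrakk> \<Longrightarrow> a \<odot>\<^bsub>M\<^esub> x \<in> carrier M"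
    and smult_l_distr:
      "\<lbrakk>a \<in> carrier R; b \<in> carrier R; x \<in> carrier M\<rbrakk> \<Longrightarrow>
        (a \<oplus>\<^bsub>R\<^esub> b) \<odot>\<^bsub>M\<^esub> x = a \<odot>\<^bsub>M\<^esub> x \<oplus>\<^bsub>M\<^esub> b \<odot>\<^bsub>M\<^esub> x"
    and smult_r_distr:
      "\<lbrakk>a \<in> carrier R; x \<in> carrier M; y \<in> carrier M\<rbrakk> \<Longrightarrow>
        a \<odot>\<^bsub>M\<^esub> (x \<oplus>\<^bsub>M\<^esub> y) = a \<odot>\<^bsub>M\<^esub> x \<oplus>\<^bsub>M\<^esub> a \<odot>\<^bsub>M\<^esub> y"
    and smult_assoc:
      "\<lbrakk>a \<in> carrier R; b \<in> carrier R; x \<in> carrier M\<rbrakk> \<Longrightarrow>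
        (a \<otimes>\<^bsub>R\<^esub> b) \<odot>\<^bsub>M\<^esub> x = b \<odot>\<^bsub>M\<^esub> (a \<odot>\<^bsub>M\<^esub> x)"
    and smult_one [simp]:
      "x \<in> carrier M \<Longrightarrow> \<one>\<^bsub>R\<^esub> \<odot>\<^bsub>M\<^esub> x = x"

definition mk_module ::
    "'x set \<Rightarrow> 'x \<Rightarrow> ('x \<Rightarrow> 'x \<Rightarrow> 'x) \<Rightarrow> ('a \<Rightarrow> 'x \<Rightarrow> 'x) \<Rightarrow> ('a, 'x) module" where
  "mk_module C z pl sm =
     \<lparr>carrier = C, mult = undefined, one = undefined, zero = z, add = pl, smult = sm\<rparr>"

text \<open>
  Homomorphisms are extensional functions, so that equal maps on the carrier are equal and
  \<open>mod_hom A M N\<close> can serve as the Hom set itself.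
\<close>

definition mod_hom ::
    "('a, 'm) ring_scheme \<Rightarrow> ('a, 'x) module \<Rightarrow> ('a, 'y) module \<Rightarrow> ('x \<Rightarrow> 'y) set" where
  "mod_hom A M N = {h \<in> carrier M \<rightarrow>\<^sub>E carrier N.
     (\<forall>x\<in>carrier M. \<forall>y\<in>carrier M. h (x \<oplus>\<^bsub>M\<^esub> y) = h x \<oplus>\<^bsub>N\<^esub> h y) \<and>
     (\<forall>a\<in>carrier A. \<forall>x\<in>carrier M. h (a \<odot>\<^bsub>M\<^esub> x) = a \<odot>\<^bsub>N\<^esub> h x)}"

definition mod_isomorphic ::
    "('a, 'm) ring_scheme \<Rightarrow> ('a, 'x) module \<Rightarrow> ('a, 'y) module \<Rightarrow> bool" where
  "mod_isomorphic A M N \<longleftrightarrow> (\<exists>h\<in>mod_hom A M N. bij_betw h (carrier M) (carrier N))"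

definition regular_module :: "('a, 'm) ring_scheme \<Rightarrow> ('a, 'a) module" where
  "regular_module A =
     mk_module (carrier A) \<zero>\<^bsub>A\<^esub> (\<lambda>x y. x \<oplus>\<^bsub>A\<^esub> y) (\<lambda>a x. x \<otimes>\<^bsub>A\<^esub> a)"

definition restrict_scalars :: "('a \<Rightarrow> 'b) \<Rightarrow> ('b, 'x) module \<Rightarrow> ('a, 'x) module" where
  "restrict_scalars f N =
     mk_module (carrier N) \<zero>\<^bsub>N\<^esub> (\<lambda>x y. x \<oplus>\<^bsub>N\<^esub> y) (\<lambda>a x. f a \<odot>\<^bsub>N\<^esub> x)"

definition quotient_module :: "('a, 'x) module \<Rightarrow> 'x set \<Rightarrow> ('a, 'x set) module" where
  "quotient_module M K =
     mk_module (a_rcosets\<^bsub>M\<^esub> K) K (set_add M) (\<lambda>a X. K <+>\<^bsub>M\<^esub> (\<lambda>x. a \<odot>\<^bsub>M\<^esub> x) ` X)"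

definition direct_sum ::
    "('a, 'x) module \<Rightarrow> ('a, 'y) module \<Rightarrow> ('a, 'x \<times> 'y) module" where
  "direct_sum M N = mk_module (carrier M \<times> carrier N) (\<zero>\<^bsub>M\<^esub>, \<zero>\<^bsub>N\<^esub>)
     (\<lambda>(x, y) (x', y'). (x \<oplus>\<^bsub>M\<^esub> x', y \<oplus>\<^bsub>N\<^esub> y'))
     (\<lambda>a (x, y). (a \<odot>\<^bsub>M\<^esub> x, a \<odot>\<^bsub>N\<^esub> y))"

definition coproduct :: "'i set \<Rightarrow> ('i \<Rightarrow> ('a, 'x) module) \<Rightarrow> ('a, 'i \<Rightarrow> 'x) module" where
  "coproduct I X = mk_module
     {x \<in> \<Pi>\<^sub>E i\<in>I. carrier (X i). finite {i \<in> I. x i \<noteq> \<zero>\<^bsub>X i\<^esub>}}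
     (\<lambda>i\<in>I. \<zero>\<^bsub>X i\<^esub>)
     (\<lambda>x y. \<lambda>i\<in>I. x i \<oplus>\<^bsub>X i\<^esub> y i)
     (\<lambda>a x. \<lambda>i\<in>I. a \<odot>\<^bsub>X i\<^esub> x i)"

abbreviation copower :: "'i set \<Rightarrow> ('a, 'x) module \<Rightarrow> ('a, 'i \<Rightarrow> 'x) module" where
  "copower I M \<equiv> coproduct I (\<lambda>_. M)"

text \<open>The pushout of \<open>W \<leftarrow>h U \<rightarrow>g V\<close>, as the cokernel of \<open>(h, -g) : U \<rightarrow> W \<oplus> V\<close>.\<close>

definition pushout ::
    "('a, 'w) module \<Rightarrow> ('a, 'u) module \<Rightarrow> ('a, 'v) module \<Rightarrow> ('u \<Rightarrow> 'w) \<Rightarrow> ('u \<Rightarrow> 'v)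
      \<Rightarrow> ('a, ('w \<times> 'v) set) module" where
  "pushout W U V h g =
     quotient_module (direct_sum W V) ((\<lambda>u. (h u, \<ominus>\<^bsub>V\<^esub> g u)) ` carrier U)"


section \<open>Module categories\<close>

text \<open>
  HOL has no type of all modules of arbitrary size. \<open>Mod(A)\<close> is rendered as the class of all right
  \<open>A\<close>-modules whose carrier is a subset of a type \<open>'u\<close>. This type plays the role of a universe: it
  is a free type variable, thus arbitrary, subject to being large enough (infinite, and containing
  copies of the carriers in play). The modules over \<open>'u\<close> are then, up to isomorphism, all modules of
  cardinality at most that of \<open>'u\<close>, and these are closed under submodules, quotients, extensions
  and coproducts of at most \<open>'u\<close> many summands. A condition quantifying over the true \<open>Mod(A)\<close>
  implies the corresponding condition for \<open>'u\<close>.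
\<close>

definition Mod_class :: "('a, 'm) ring_scheme \<Rightarrow> ('a, 'u) module set" where
  "Mod_class A = {X. right_module A X}"

definition projective ::
    "'u itself \<Rightarrow> ('a, 'm) ring_scheme \<Rightarrow> ('a, 'x) module \<Rightarrow> bool" where
  "projective U A P \<longleftrightarrow> right_module A P \<and>
     (\<forall>N \<in> (Mod_class A :: ('a, 'u) module set). \<forall>N' \<in> (Mod_class A :: ('a, 'u) module set).
        \<forall>g \<in> mod_hom A N N'. g ` carrier N = carrier N' \<longrightarrow>
          (\<forall>h \<in> mod_hom A P N'. \<exists>k \<in> mod_hom A P N. compose (carrier P) g k = h))"

text \<open>
  Closure under coproducts is stated up to isomorphism, since the coproduct itself does not live
  over \<open>'u\<close>. Index sets in \<open>'u\<close> suffice: the nonzero summands of a coproduct of cardinality at most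
  that of \<open>'u\<close> are indexed by such a set.
\<close>

definition torsion_class ::
    "('a, 'm) ring_scheme \<Rightarrow> ('a, 'u) module set \<Rightarrow> bool" where
  "torsion_class A \<C> \<longleftrightarrow> \<C> \<subseteq> Mod_class A \<and>
     (\<forall>X \<in> \<C>. \<forall>Y \<in> Mod_class A. \<forall>g \<in> mod_hom A X Y. g ` carrier X = carrier Y \<longrightarrow> Y \<in> \<C>) \<and>
     (\<forall>X \<in> \<C>. \<forall>Z \<in> \<C>. \<forall>Y \<in> Mod_class A. \<forall>f \<in> mod_hom A X Y. \<forall>g \<in> mod_hom A Y Z.
        inj_on f (carrier X) \<and> f ` carrier X = {y \<in> carrier Y. g y = \<zero>\<^bsub>Z\<^esub>} \<and>
        g ` carrier Y = carrier Z \<longrightarrow> Y \<in> \<C>) \<and>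
     (\<forall>(I :: 'u set) X. \<forall>Y \<in> Mod_class A. (\<forall>i\<in>I. X i \<in> \<C>) \<and>
        mod_isomorphic A Y (coproduct I X) \<longrightarrow> Y \<in> \<C>)"

definition Add_class ::
    "('a, 'm) ring_scheme \<Rightarrow> ('a, 'x) module \<Rightarrow> ('a, 'u) module set" where
  "Add_class A M = {N \<in> Mod_class A. \<exists>(J :: 'u set). \<exists>N' \<in> (Mod_class A :: ('a, 'u) module set).
     mod_isomorphic A (direct_sum N N') (copower J M)}"


section \<open>Partial silting modules and the Bongartz completion\<close>

definition projective_presentation ::
    "'u itself \<Rightarrow> ('a, 'm) ring_scheme \<Rightarrow> ('a, 'p) module \<Rightarrow> ('a, 'q) module \<Rightarrow> ('p \<Rightarrow> 'q)
      \<Rightarrow> ('a, 't) module \<Rightarrow> bool" where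
  "projective_presentation U A P Q \<sigma> T\<^sub>1 \<longleftrightarrow>
     projective U A P \<and> projective U A Q \<and> right_module A T\<^sub>1 \<and> \<sigma> \<in> mod_hom A P Q \<and>
     (\<exists>p \<in> mod_hom A Q T\<^sub>1. p ` carrier Q = carrier T\<^sub>1 \<and>
        \<sigma> ` carrier P = {q \<in> carrier Q. p q = \<zero>\<^bsub>T\<^sub>1\<^esub>})"

definition D_class ::
    "('a, 'm) ring_scheme \<Rightarrow> ('a, 'p) module \<Rightarrow> ('a, 'q) module \<Rightarrow> ('p \<Rightarrow> 'q)
      \<Rightarrow> ('a, 'x) module set" where
  "D_class A P Q \<sigma> = {X \<in> Mod_class A.
     (\<lambda>h. compose (carrier P) h \<sigma>) ` mod_hom A Q X = mod_hom A P X}"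

definition partial_silting ::
    "'u itself \<Rightarrow> ('a, 'm) ring_scheme \<Rightarrow> ('a, 'p) module \<Rightarrow> ('a, 'q) module \<Rightarrow> ('p \<Rightarrow> 'q)
      \<Rightarrow> ('a, 't) module \<Rightarrow> bool" where
  "partial_silting U A P Q \<sigma> T\<^sub>1 \<longleftrightarrow>
     projective_presentation U A P Q \<sigma> T\<^sub>1 \<and>
     torsion_class A (D_class A P Q \<sigma> :: ('a, 'u) module set) \<and>
     T\<^sub>1 \<in> D_class A P Q \<sigma>"

text \<open>
  The index set is \<open>I\<^sub>0 = Hom\<^sub>A(P, A)\<close>, and the canonical map \<open>P\<^sup>(\<^sup>I\<^sup>0\<^sup>) \<rightarrow> A\<close> sends
  a finitely supported family \<open>x\<close> to the sum of all \<open>s (x s)\<close>.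
\<close>

definition bongartz_M ::
    "('a, 'm) ring_scheme \<Rightarrow> ('a, 'p) module \<Rightarrow> ('a, 'q) module \<Rightarrow> ('p \<Rightarrow> 'q)
      \<Rightarrow> ('a, ('a \<times> (('p \<Rightarrow> 'a) \<Rightarrow> 'q)) set) module" where
  "bongartz_M A P Q \<sigma> =
     (let I\<^sub>0 = mod_hom A P (regular_module A);
          can = (\<lambda>x. \<Oplus>\<^bsub>A\<^esub>s\<in>{s \<in> I\<^sub>0. x s \<noteq> \<zero>\<^bsub>P\<^esub>}. s (x s));
          \<sigma>I = (\<lambda>x. \<lambda>s\<in>I\<^sub>0. \<sigma> (x s))
      in pushout (regular_module A) (copower I\<^sub>0 P) (copower I\<^sub>0 Q) can \<sigma>I)"

definition bongartz_completion ::
    "('a, 'm) ring_scheme \<Rightarrow> ('a, 'p) module \<Rightarrow> ('a, 'q) module \<Rightarrow> ('p \<Rightarrow> 'q)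
      \<Rightarrow> ('a, 't) module \<Rightarrow> ('a, 't \<times> ('a \<times> (('p \<Rightarrow> 'a) \<Rightarrow> 'q)) set) module" where
  "bongartz_completion A P Q \<sigma> T\<^sub>1 = direct_sum T\<^sub>1 (bongartz_M A P Q \<sigma>)"


section \<open>The associated ring epimorphism\<close>

definition ring_epimorphism ::
    "'u itself \<Rightarrow> ('a, 'm) ring_scheme \<Rightarrow> ('b, 'n) ring_scheme \<Rightarrow> ('a \<Rightarrow> 'b) \<Rightarrow> bool" where
  "ring_epimorphism U A B f \<longleftrightarrow> ring A \<and> ring B \<and> f \<in> ring_hom A B \<and>
     (\<forall>C :: 'u ring. ring C \<longrightarrow> (\<forall>g \<in> ring_hom B C. \<forall>h \<in> ring_hom B C.
        (\<forall>a\<in>carrier A. g (f a) = h (f a)) \<longrightarrow> (\<forall>b\<in>carrier B. g b = h b)))"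

definition essential_image ::
    "('a, 'm) ring_scheme \<Rightarrow> ('b, 'n) ring_scheme \<Rightarrow> ('a \<Rightarrow> 'b) \<Rightarrow> ('a, 'u) module set" where
  "essential_image A B f = {X \<in> Mod_class A. \<exists>N \<in> (Mod_class B :: ('b, 'u) module set).
     mod_isomorphic A X (restrict_scalars f N)}"

definition Y_class ::
    "('a, 'm) ring_scheme \<Rightarrow> ('a, 'p) module \<Rightarrow> ('a, 'q) module \<Rightarrow> ('p \<Rightarrow> 'q)
      \<Rightarrow> ('a, 't) module \<Rightarrow> ('a, 'u) module set" where
  "Y_class A P Q \<sigma> T\<^sub>1 =
     {X \<in> D_class A P Q \<sigma>. mod_hom A T\<^sub>1 X = {\<lambda>x\<in>carrier T\<^sub>1. \<zero>\<^bsub>X\<^esub>}}"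

definition associated_epimorphism ::
    "'u itself \<Rightarrow> ('a, 'm) ring_scheme \<Rightarrow> ('a, 'p) module \<Rightarrow> ('a, 'q) module \<Rightarrow> ('p \<Rightarrow> 'q)
      \<Rightarrow> ('a, 't) module \<Rightarrow> ('b, 'n) ring_scheme \<Rightarrow> ('a \<Rightarrow> 'b) \<Rightarrow> bool" where
  "associated_epimorphism U A P Q \<sigma> T\<^sub>1 B f \<longleftrightarrow>
     ring_epimorphism U A B f \<and>
     essential_image A B f = (Y_class A P Q \<sigma> T\<^sub>1 :: ('a, 'u) module set)"


section \<open>Endomorphism rings\<close>

definition End_ring :: "('a, 'm) ring_scheme \<Rightarrow> ('a, 'x) module \<Rightarrow> ('x \<Rightarrow> 'x) ring" where
  "End_ring A M =
     \<lparr>carrier = mod_hom A M M,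
      mult = (\<lambda>g h. compose (carrier M) g h),
      one = (\<lambda>x\<in>carrier M. x),
      zero = (\<lambda>x\<in>carrier M. \<zero>\<^bsub>M\<^esub>),
      add = (\<lambda>g h. \<lambda>x\<in>carrier M. g x \<oplus>\<^bsub>M\<^esub> h x)\<rparr>"

definition factoring_ideal ::
    "'u itself \<Rightarrow> ('a, 'm) ring_scheme \<Rightarrow> ('a, 'x) module \<Rightarrow> ('a, 't) module
      \<Rightarrow> ('x \<Rightarrow> 'x) set" where
  "factoring_ideal U A T T\<^sub>1 = {g \<in> mod_hom A T T.
     \<exists>N \<in> (Add_class A T\<^sub>1 :: ('a, 'u) module set).
       \<exists>h \<in> mod_hom A T N. \<exists>k \<in> mod_hom A N T. g = compose (carrier T) k h}"

end

theory Submission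
  imports Defs "HOL-Algebra.Weak_Morphisms"
begin

text \<open>
Write \<open>T = T\<^sub>1 \<oplus> M\<close>, let \<open>\<phi> : A \<rightarrow> M\<close> be the pushout map and put \<open>\<tau> = (0, \<phi> 1) \<in> T\<close>. For a module
\<open>X\<close> let \<open>trace X\<close> be the submodule generated by the images of all maps \<open>T\<^sub>1 \<rightarrow> X\<close>. Two facts make
\<open>\<tau>\<close> behave like a free generator of \<open>T\<close> up to \<open>T\<^sub>1\<close>. Since \<open>T \<in> D\<^sub>\<sigma>\<close> and \<open>\<phi>\<close> is a left
\<open>D\<^sub>\<sigma>\<close>-approximation, every element of \<open>T\<close> is the value at \<open>\<tau>\<close> of an endomorphism of \<open>T\<close>
(\<open>M_approximation\<close>). Since the cokernel of \<open>\<phi>\<close> is a coproduct of copies of \<open>T\<^sub>1\<close>, a map from \<open>T\<close> to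
a module \<open>X\<close> with \<open>Hom(T\<^sub>1, X) = 0\<close> is determined by its value at \<open>\<tau>\<close> (\<open>linear_map_T_eqI\<close>).

The isomorphism. As \<open>B\<close> lies in \<open>Y\<close>, there is a unique \<open>A\<close>-linear \<open>\<rho> : T \<rightarrow> B\<close> with \<open>\<rho> \<tau> = 1\<close>, and
\<open>\<Theta> g = \<rho> (g \<tau>)\<close> is a ring homomorphism \<open>End(T) \<rightarrow> B\<close>, because \<open>\<rho> \<circ> g\<close> and the left multiple
\<open>\<Theta> g \<cdot> \<rho>\<close> agree at \<open>\<tau>\<close>. The quotient \<open>T / trace T\<close> lies in \<open>Y\<close> (\<open>extends_quotient\<close>,
\<open>hom_T1_trace_quotient\<close>), so it is a \<open>B\<close>-module and \<open>1 \<mapsto> \<tau>\<close> extends to \<open>B \<rightarrow> T / trace T\<close>. Comparing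
with \<open>\<rho>\<close> shows that the kernel of \<open>\<rho>\<close> is \<open>trace T\<close>. The composite \<open>B \<rightarrow> T / trace T \<rightarrow> B\<close> is
\<open>A\<close>-linear and fixes \<open>1\<close>; restriction along a ring epimorphism is full (\<open>ring_epimorphism_full\<close>), so
it is the identity, and \<open>\<rho>\<close> and \<open>\<Theta>\<close> are surjective (\<open>T_to_B\<close>). Hence \<open>B\<close> is \<open>End(T)\<close> modulo the
ideal \<open>K\<close> of all \<open>g\<close> with \<open>g \<tau> \<in> trace T\<close>.

The ideal. Let \<open>I\<close> be the set of maps factoring through \<open>Add(T\<^sub>1)\<close>. The chain
\<open>I \<subseteq> K \<subseteq> I \<cdot> I \<subseteq> I\<close> gives both \<open>K = I\<close> and idempotency, and only its middle inclusion is hard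
(\<open>trace_valued_in_F_square\<close>). Maps \<open>T \<rightarrow> T\<^sub>1 \<rightarrow> T\<close> are products of two elements of \<open>I\<close>, as \<open>T\<^sub>1\<close> is a
summand of \<open>T\<close>; subtracting such maps from \<open>g \<in> K\<close> leaves a map of the form \<open>u \<circ> \<kappa>\<close> on \<open>M\<close>, where
\<open>\<kappa> : M \<rightarrow> T\<^sub>1\<^sup>(\<^sup>I\<^sup>0\<^sup>)\<close> is the cokernel of \<open>\<phi>\<close>. If \<open>I\<^sub>0\<close> is finite this is again a sum of maps through
\<open>T\<^sub>1\<close>. If \<open>I\<^sub>0 = Hom(P, A)\<close> is infinite, its group structure makes the summands of \<open>M\<close> redundant:
for \<open>s = r + d\<close> in \<open>I\<^sub>0\<close> the difference of the component \<open>s\<close> and the components \<open>r\<close> and \<open>d\<close> lifts to a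
map \<open>T\<^sub>1 \<rightarrow> M\<close> (\<open>lift_difference\<close>). There are as many such \<open>s\<close> as elements of \<open>I\<^sub>0\<close>, with \<open>r\<close> and \<open>d\<close>
always outside the chosen set (\<open>large_set_avoiding_shift\<close>), so the copies of \<open>T\<^sub>1\<close> can be moved
onto liftable components, and \<open>u \<circ> \<kappa>\<close> becomes a product of two maps through \<open>\<kappa>\<close>
(\<open>F_square_\<kappa>_infinite\<close>).
\<close>

section \<open>Linear maps and constructions of modules\<close>

lemma (in abelian_group) minus_eq_zero_iff:
  assumes "x \<in> carrier G" "y \<in> carrier G"
  shows "x \<ominus> y = \<zero> \<longleftrightarrow> x = y"
proof
  assume "x \<ominus> y = \<zero>"
  then have "\<ominus> (\<ominus> y) = x" using assms by (intro minus_equality) (auto simp: a_minus_def)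
  then show "x = y" using assms by simp
qed (use assms in \<open>simp add: a_minus_def r_neg\<close>)

text \<open>
Homomorphisms without the extensionality of \<^const>\<open>mod_hom\<close>, so that sums and composites are plain
\<open>\<lambda>\<close>-terms.
\<close>

definition linear_map ::
    "('a, 'm) ring_scheme \<Rightarrow> ('a, 'x) module \<Rightarrow> ('a, 'y) module \<Rightarrow> ('x \<Rightarrow> 'y) \<Rightarrow> bool" where
  "linear_map A M N h \<longleftrightarrow> h \<in> carrier M \<rightarrow> carrier N \<and>
     (\<forall>x\<in>carrier M. \<forall>y\<in>carrier M. h (x \<oplus>\<^bsub>M\<^esub> y) = h x \<oplus>\<^bsub>N\<^esub> h y) \<and>
     (\<forall>a\<in>carrier A. \<forall>x\<in>carrier M. h (a \<odot>\<^bsub>M\<^esub> x) = a \<odot>\<^bsub>N\<^esub> h x)"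

lemma linear_mapI:
  assumes "\<And>x. x \<in> carrier M \<Longrightarrow> h x \<in> carrier N"
    and "\<And>x y. x \<in> carrier M \<Longrightarrow> y \<in> carrier M \<Longrightarrow> h (x \<oplus>\<^bsub>M\<^esub> y) = h x \<oplus>\<^bsub>N\<^esub> h y"
    and "\<And>a x. a \<in> carrier A \<Longrightarrow> x \<in> carrier M \<Longrightarrow> h (a \<odot>\<^bsub>M\<^esub> x) = a \<odot>\<^bsub>N\<^esub> h x"
  shows "linear_map A M N h"
  using assms by (auto simp: linear_map_def)

lemma linear_map_closed: "linear_map A M N h \<Longrightarrow> x \<in> carrier M \<Longrightarrow> h x \<in> carrier N"
  by (auto simp: linear_map_def)

lemma linear_map_add:
  "linear_map A M N h \<Longrightarrow> x \<in> carrier M \<Longrightarrow> y \<in> carrier M \<Longrightarrow> h (x \<oplus>\<^bsub>M\<^esub> y) = h x \<oplus>\<^bsub>N\<^esub> h y"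
  by (auto simp: linear_map_def)

lemma linear_map_smult:
  "linear_map A M N h \<Longrightarrow> a \<in> carrier A \<Longrightarrow> x \<in> carrier M \<Longrightarrow> h (a \<odot>\<^bsub>M\<^esub> x) = a \<odot>\<^bsub>N\<^esub> h x"
  by (auto simp: linear_map_def)

lemma mod_hom_iff: "h \<in> mod_hom A M N \<longleftrightarrow> linear_map A M N h \<and> h \<in> extensional (carrier M)"
  by (auto simp: mod_hom_def linear_map_def PiE_def)

lemma linear_map_cong:
  assumes M: "right_module A M" and h: "linear_map A M N h"
    and eq: "\<And>x. x \<in> carrier M \<Longrightarrow> k x = h x"
  shows "linear_map A M N k"
proof -
  interpret right_module A M by fact
  show ?thesis using h eq by (auto simp: linear_map_def)
qed

lemma restrict_in_mod_hom:
  "right_module A M \<Longrightarrow> linear_map A M N h \<Longrightarrow> restrict h (carrier M) \<in> mod_hom A M N"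
  by (auto simp: mod_hom_iff intro: linear_map_cong)

lemma linear_map_comp:
  "linear_map A L M h \<Longrightarrow> linear_map A M N k \<Longrightarrow> linear_map A L N (\<lambda>x. k (h x))"
  by (auto simp: linear_map_def Pi_iff)

lemma linear_map_id: "linear_map A M M (\<lambda>x. x)"
  by (auto simp: linear_map_def)

lemma linear_map_zero:
  assumes "right_module A M" "right_module A N" "linear_map A M N h"
  shows "h \<zero>\<^bsub>M\<^esub> = \<zero>\<^bsub>N\<^esub>"
proof -
  interpret M: right_module A M by fact
  interpret N: right_module A N by fact
  have "h \<zero>\<^bsub>M\<^esub> \<oplus>\<^bsub>N\<^esub> h \<zero>\<^bsub>M\<^esub> = h \<zero>\<^bsub>M\<^esub>"
    using linear_map_add[OF assms(3), of "\<zero>\<^bsub>M\<^esub>" "\<zero>\<^bsub>M\<^esub>"] by simp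
  then show ?thesis
    using linear_map_closed[OF assms(3), of "\<zero>\<^bsub>M\<^esub>"] by (simp add: N.add.l_cancel_one)
qed

lemma linear_map_minus:
  assumes "right_module A M" "right_module A N" "linear_map A M N h" "x \<in> carrier M"
  shows "h (\<ominus>\<^bsub>M\<^esub> x) = \<ominus>\<^bsub>N\<^esub> h x"
proof -
  interpret M: right_module A M by fact
  interpret N: right_module A N by fact
  have "h (\<ominus>\<^bsub>M\<^esub> x) \<oplus>\<^bsub>N\<^esub> h x = \<zero>\<^bsub>N\<^esub>"
    using linear_map_add[OF assms(3), of "\<ominus>\<^bsub>M\<^esub> x" x] linear_map_zero[OF assms(1-3)] assms(4)
    by (simp add: M.M.l_neg)
  then show ?thesis
    using linear_map_closed[OF assms(3)] assms(4) by (metis M.M.a_inv_closed N.M.minus_equality)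
qed

context right_module
begin

lemma smult_zero: "a \<in> carrier R \<Longrightarrow> a \<odot>\<^bsub>M\<^esub> \<zero>\<^bsub>M\<^esub> = \<zero>\<^bsub>M\<^esub>"
  using smult_r_distr[of a "\<zero>\<^bsub>M\<^esub>" "\<zero>\<^bsub>M\<^esub>"] by (simp add: M.add.l_cancel_one)

lemma zero_smult: "x \<in> carrier M \<Longrightarrow> \<zero>\<^bsub>R\<^esub> \<odot>\<^bsub>M\<^esub> x = \<zero>\<^bsub>M\<^esub>"
  using smult_l_distr[of "\<zero>\<^bsub>R\<^esub>" "\<zero>\<^bsub>R\<^esub>" x] by (simp add: M.add.l_cancel_one)

lemma smult_minus: "a \<in> carrier R \<Longrightarrow> x \<in> carrier M \<Longrightarrow> a \<odot>\<^bsub>M\<^esub> (\<ominus>\<^bsub>M\<^esub> x) = \<ominus>\<^bsub>M\<^esub> (a \<odot>\<^bsub>M\<^esub> x)"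
  using smult_r_distr[of a "\<ominus>\<^bsub>M\<^esub> x" x] smult_zero[of a]
  by (simp add: M.l_neg M.minus_equality)

lemma minus_one_smult: "x \<in> carrier M \<Longrightarrow> (\<ominus>\<^bsub>R\<^esub> \<one>\<^bsub>R\<^esub>) \<odot>\<^bsub>M\<^esub> x = \<ominus>\<^bsub>M\<^esub> x"
  using smult_l_distr[of "\<ominus>\<^bsub>R\<^esub> \<one>\<^bsub>R\<^esub>" "\<one>\<^bsub>R\<^esub>" x] zero_smult[of x]
  by (simp add: R.l_neg M.minus_equality)

end

lemma linear_map_const_zero:
  assumes "right_module A N" shows "linear_map A M N (\<lambda>x. \<zero>\<^bsub>N\<^esub>)"
proof -
  interpret right_module A N by fact
  show ?thesis by (rule linear_mapI) (auto simp: smult_zero)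
qed

lemma linear_map_plus:
  assumes "right_module A N" "linear_map A M N h" "linear_map A M N k"
  shows "linear_map A M N (\<lambda>x. h x \<oplus>\<^bsub>N\<^esub> k x)"
proof -
  interpret right_module A N by fact
  show ?thesis
    using assms(2,3) by (intro linear_mapI)
      (auto simp: linear_map_closed linear_map_add linear_map_smult smult_r_distr M.add.m_ac
        intro!: M.a_closed)
qed

lemma linear_map_uminus:
  assumes "right_module A N" "linear_map A M N h"
  shows "linear_map A M N (\<lambda>x. \<ominus>\<^bsub>N\<^esub> h x)"
proof -
  interpret right_module A N by fact
  show ?thesis
    using assms(2) by (intro linear_mapI)
      (auto simp: linear_map_closed linear_map_add linear_map_smult smult_minus M.minus_add)
qed

lemma linear_map_diff:
  assumes "right_module A N" "linear_map A M N h" "linear_map A M N k"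
  shows "linear_map A M N (\<lambda>x. h x \<ominus>\<^bsub>N\<^esub> k x)"
  unfolding a_minus_def using assms by (intro linear_map_plus linear_map_uminus)

lemma linear_map_inv_into:
  assumes "right_module A M" "linear_map A M N h" "bij_betw h (carrier M) (carrier N)"
  shows "linear_map A N M (inv_into (carrier M) h)"
proof -
  interpret right_module A M by fact
  let ?i = "inv_into (carrier M) h"
  have i: "?i y \<in> carrier M" "h (?i y) = y" if "y \<in> carrier N" for y
    using that assms(3) by (auto simp: bij_betw_def f_inv_into_f intro: inv_into_into)
  have j: "?i (h x) = x" if "x \<in> carrier M" for x
    using that assms(3) by (auto simp: bij_betw_def)
  show ?thesis
  proof (rule linear_mapI)
    fix x y assume "x \<in> carrier N" "y \<in> carrier N"
    then show "?i (x \<oplus>\<^bsub>N\<^esub> y) = ?i x \<oplus>\<^bsub>M\<^esub> ?i y"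
      using j[of "?i x \<oplus>\<^bsub>M\<^esub> ?i y"] i linear_map_add[OF assms(2)] by simp
  next
    fix a x assume "a \<in> carrier A" "x \<in> carrier N"
    then show "?i (a \<odot>\<^bsub>N\<^esub> x) = a \<odot>\<^bsub>M\<^esub> ?i x"
      using j[of "a \<odot>\<^bsub>M\<^esub> ?i x"] i linear_map_smult[OF assms(2)] by simp
  qed (use i in auto)
qed

lemma mod_isomorphic_iff:
  "right_module A M \<Longrightarrow> mod_isomorphic A M N \<longleftrightarrow>
    (\<exists>h. linear_map A M N h \<and> bij_betw h (carrier M) (carrier N))"
  unfolding mod_isomorphic_def
proof safe
  fix h assume "right_module A M" "linear_map A M N h" "bij_betw h (carrier M) (carrier N)"
  then show "\<exists>h\<in>mod_hom A M N. bij_betw h (carrier M) (carrier N)"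
    by (intro bexI[of _ "restrict h (carrier M)"] restrict_in_mod_hom)
      (auto simp: bij_betw_def inj_on_def)
qed (auto simp: mod_hom_iff)

text \<open>
Choosing preimages under \<open>g\<close> is harmless because \<open>h\<close> is constant on the fibres of \<open>g\<close>. The lemma
serves for maps out of quotients and for maps out of the cokernel of \<open>\<sigma>\<close> alike.
\<close>

lemma linear_map_factor:
  assumes X: "right_module A X" and Z: "right_module A Z" and W: "right_module A W"
    and g: "linear_map A X Z g" "g ` carrier X = carrier Z"
    and h: "linear_map A X W h" "\<And>x. x \<in> carrier X \<Longrightarrow> g x = \<zero>\<^bsub>Z\<^esub> \<Longrightarrow> h x = \<zero>\<^bsub>W\<^esub>"
  obtains k where "linear_map A Z W k" "\<And>x. x \<in> carrier X \<Longrightarrow> k (g x) = h x"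
proof -
  interpret X: right_module A X by fact
  interpret Z: right_module A Z by fact
  interpret W: right_module A W by fact
  note gc = linear_map_closed[OF g(1)] and hc = linear_map_closed[OF h(1)]
  let ?k = "\<lambda>z. h (inv_into (carrier X) g z)"
  have eq: "h x = h y" if "x \<in> carrier X" "y \<in> carrier X" "g x = g y" for x y
  proof -
    have "g (x \<ominus>\<^bsub>X\<^esub> y) = \<zero>\<^bsub>Z\<^esub>"
      using that gc unfolding a_minus_def
      by (simp add: linear_map_add[OF g(1)] linear_map_minus[OF X Z g(1)] Z.M.r_neg)
    then have "h (x \<ominus>\<^bsub>X\<^esub> y) = \<zero>\<^bsub>W\<^esub>" using h(2) that by simp
    then have "h x \<ominus>\<^bsub>W\<^esub> h y = \<zero>\<^bsub>W\<^esub>"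
      using that by (simp add: a_minus_def linear_map_add[OF h(1)] linear_map_minus[OF X W h(1)])
    then show ?thesis
      using W.M.minus_eq_zero_iff[of "h x" "h y"] that hc by blast
  qed
  have k: "?k (g x) = h x" if "x \<in> carrier X" for x
    using that by (rule_tac eq[OF inv_into_into]) (simp_all add: f_inv_into_f)
  have "linear_map A Z W ?k"
  proof (rule linear_mapI)
    fix z assume "z \<in> carrier Z"
    then show "?k z \<in> carrier W" using hc g(2) by (simp add: inv_into_into)
  next
    fix z z' assume "z \<in> carrier Z" "z' \<in> carrier Z"
    then obtain x x' where "x \<in> carrier X" "x' \<in> carrier X" "z = g x" "z' = g x'"
      using g(2) by blast
    then show "?k (z \<oplus>\<^bsub>Z\<^esub> z') = ?k z \<oplus>\<^bsub>W\<^esub> ?k z'"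
      using k[of "x \<oplus>\<^bsub>X\<^esub> x'"] k by (simp add: linear_map_add[OF g(1)] linear_map_add[OF h(1)])
  next
    fix a z assume "a \<in> carrier A" "z \<in> carrier Z"
    moreover then obtain x where "x \<in> carrier X" "z = g x" using g(2) by blast
    ultimately show "?k (a \<odot>\<^bsub>Z\<^esub> z) = a \<odot>\<^bsub>W\<^esub> ?k z"
      using k[of "a \<odot>\<^bsub>X\<^esub> x"] k by (simp add: linear_map_smult[OF g(1)] linear_map_smult[OF h(1)])
  qed
  with k show ?thesis using that by blast
qed

lemma mk_module_simps [simp]:
  "carrier (mk_module C z p s) = C" "\<zero>\<^bsub>mk_module C z p s\<^esub> = z"
  "x \<oplus>\<^bsub>mk_module C z p s\<^esub> y = p x y" "a \<odot>\<^bsub>mk_module C z p s\<^esub> x = s a x"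
  by (simp_all add: mk_module_def)

lemma right_moduleI:
  assumes "ring A" "abelian_group M"
    and "\<And>a x. a \<in> carrier A \<Longrightarrow> x \<in> carrier M \<Longrightarrow> a \<odot>\<^bsub>M\<^esub> x \<in> carrier M"
    and "\<And>a b x. a \<in> carrier A \<Longrightarrow> b \<in> carrier A \<Longrightarrow> x \<in> carrier M \<Longrightarrow>
        (a \<oplus>\<^bsub>A\<^esub> b) \<odot>\<^bsub>M\<^esub> x = a \<odot>\<^bsub>M\<^esub> x \<oplus>\<^bsub>M\<^esub> b \<odot>\<^bsub>M\<^esub> x"
    and "\<And>a x y. a \<in> carrier A \<Longrightarrow> x \<in> carrier M \<Longrightarrow> y \<in> carrier M \<Longrightarrow>
        a \<odot>\<^bsub>M\<^esub> (x \<oplus>\<^bsub>M\<^esub> y) = a \<odot>\<^bsub>M\<^esub> x \<oplus>\<^bsub>M\<^esub> a \<odot>\<^bsub>M\<^esub> y"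
    and "\<And>a b x. a \<in> carrier A \<Longrightarrow> b \<in> carrier A \<Longrightarrow> x \<in> carrier M \<Longrightarrow>
        (a \<otimes>\<^bsub>A\<^esub> b) \<odot>\<^bsub>M\<^esub> x = b \<odot>\<^bsub>M\<^esub> (a \<odot>\<^bsub>M\<^esub> x)"
    and "\<And>x. x \<in> carrier M \<Longrightarrow> \<one>\<^bsub>A\<^esub> \<odot>\<^bsub>M\<^esub> x = x"
  shows "right_module A M"
  using assms by (simp add: right_module_def right_module_axioms_def)

text \<open>
Copies of a module and its quotients are both surjective images with compatible operations, so the
module axioms are transported once and for all.
\<close>

lemma right_module_image:
  assumes "right_module A M"
    and surj: "h ` carrier M = carrier N"
    and add: "\<And>x y. x \<in> carrier M \<Longrightarrow> y \<in> carrier M \<Longrightarrow> h (x \<oplus>\<^bsub>M\<^esub> y) = h x \<oplus>\<^bsub>N\<^esub> h y"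
    and sm: "\<And>a x. a \<in> carrier A \<Longrightarrow> x \<in> carrier M \<Longrightarrow> h (a \<odot>\<^bsub>M\<^esub> x) = a \<odot>\<^bsub>N\<^esub> h x"
    and zero: "h \<zero>\<^bsub>M\<^esub> = \<zero>\<^bsub>N\<^esub>"
  shows "right_module A N"
proof -
  interpret right_module A M by fact
  have rep: "\<exists>x\<in>carrier M. y = h x" if "y \<in> carrier N" for y
    using that surj by blast
  have hc: "h x \<in> carrier N" if "x \<in> carrier M" for x
    using that surj by blast
  show ?thesis
  proof (rule right_moduleI)
    show "abelian_group N"
    proof (rule abelian_groupI)
      show "\<zero>\<^bsub>N\<^esub> \<in> carrier N" using hc[of "\<zero>\<^bsub>M\<^esub>"] zero by simp
    next
      fix x y assume "x \<in> carrier N" "y \<in> carrier N"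
      then obtain x' y' where "x' \<in> carrier M" "y' \<in> carrier M" "x = h x'" "y = h y'"
        using rep by metis
      then show "x \<oplus>\<^bsub>N\<^esub> y \<in> carrier N" "x \<oplus>\<^bsub>N\<^esub> y = y \<oplus>\<^bsub>N\<^esub> x"
        by (simp_all flip: add add: hc M.a_comm)
    next
      fix x y z assume "x \<in> carrier N" "y \<in> carrier N" "z \<in> carrier N"
      then obtain x' y' z' where "x' \<in> carrier M" "y' \<in> carrier M" "z' \<in> carrier M"
        "x = h x'" "y = h y'" "z = h z'"
        using rep by metis
      then show "x \<oplus>\<^bsub>N\<^esub> y \<oplus>\<^bsub>N\<^esub> z = x \<oplus>\<^bsub>N\<^esub> (y \<oplus>\<^bsub>N\<^esub> z)"
        by (simp flip: add add: hc M.a_assoc)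
    next
      fix x assume "x \<in> carrier N"
      then obtain x' where x': "x' \<in> carrier M" "x = h x'" using rep by metis
      then show "\<zero>\<^bsub>N\<^esub> \<oplus>\<^bsub>N\<^esub> x = x"
        by (simp flip: add zero)
      have "h (\<ominus>\<^bsub>M\<^esub> x') \<oplus>\<^bsub>N\<^esub> x = \<zero>\<^bsub>N\<^esub>"
        using x' by (simp flip: add zero add: M.l_neg)
      then show "\<exists>y\<in>carrier N. y \<oplus>\<^bsub>N\<^esub> x = \<zero>\<^bsub>N\<^esub>" using x' hc by blast
    qed
  next
    show "ring A" by (rule R.ring_axioms)
  next
    fix a x assume a: "a \<in> carrier A" and "x \<in> carrier N"
    then obtain x' where x': "x' \<in> carrier M" "x = h x'" using rep by metis
    show "a \<odot>\<^bsub>N\<^esub> x \<in> carrier N" using x' a by (simp flip: sm add: hc)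
  next
    fix a b x assume ab: "a \<in> carrier A" "b \<in> carrier A" and "x \<in> carrier N"
    then obtain x' where x': "x' \<in> carrier M" "x = h x'" using rep by metis
    then show "(a \<oplus>\<^bsub>A\<^esub> b) \<odot>\<^bsub>N\<^esub> x = a \<odot>\<^bsub>N\<^esub> x \<oplus>\<^bsub>N\<^esub> b \<odot>\<^bsub>N\<^esub> x"
      and "(a \<otimes>\<^bsub>A\<^esub> b) \<odot>\<^bsub>N\<^esub> x = b \<odot>\<^bsub>N\<^esub> (a \<odot>\<^bsub>N\<^esub> x)"
      using ab by (simp_all flip: sm add add: smult_l_distr smult_assoc)
  next
    fix a x y assume a: "a \<in> carrier A" and "x \<in> carrier N" "y \<in> carrier N"
    then obtain x' y' where "x' \<in> carrier M" "y' \<in> carrier M" "x = h x'" "y = h y'"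
      using rep by metis
    then show "a \<odot>\<^bsub>N\<^esub> (x \<oplus>\<^bsub>N\<^esub> y) = a \<odot>\<^bsub>N\<^esub> x \<oplus>\<^bsub>N\<^esub> a \<odot>\<^bsub>N\<^esub> y"
      using a by (simp flip: sm add add: smult_r_distr)
  next
    fix x assume "x \<in> carrier N"
    then obtain x' where x': "x' \<in> carrier M" "x = h x'" using rep by metis
    then show "\<one>\<^bsub>A\<^esub> \<odot>\<^bsub>N\<^esub> x = x" by (simp flip: sm)
  qed
qed

text \<open>
The passage from a module over any type to the universe \<open>'u\<close>, over which projectivity, torsion
classes and \<open>Add\<close> are defined.
\<close>

lemma small_copy:
  assumes X: "right_module A X" and "carrier X \<lesssim> (UNIV :: 'u set)"
  obtains Y :: "('a, 'u) module" and h
  where "right_module A Y" "linear_map A X Y h" "bij_betw h (carrier X) (carrier Y)"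
proof -
  obtain j :: "_ \<Rightarrow> 'u" where j: "inj_on j (carrier X)"
    using assms(2) by (auto simp: lepoll_def)
  interpret right_module A X by fact
  let ?i = "inv_into (carrier X) j"
  define Y :: "('a, 'u) module" where
    "Y = mk_module (j ` carrier X) (j \<zero>\<^bsub>X\<^esub>) (\<lambda>u v. j (?i u \<oplus>\<^bsub>X\<^esub> ?i v)) (\<lambda>a u. j (a \<odot>\<^bsub>X\<^esub> ?i u))"
  have "right_module A Y"
    by (rule right_module_image[OF X, of j]) (auto simp: Y_def j)
  moreover have "linear_map A X Y j"
    by (rule linear_mapI) (auto simp: Y_def j)
  moreover have "bij_betw j (carrier X) (carrier Y)"
    using j by (simp add: Y_def bij_betw_def)
  ultimately show ?thesis using that by blast
qed

definition right_submodule ::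
    "('a, 'm) ring_scheme \<Rightarrow> ('a, 'x) module \<Rightarrow> 'x set \<Rightarrow> bool" where
  "right_submodule A M S \<longleftrightarrow> S \<subseteq> carrier M \<and> \<zero>\<^bsub>M\<^esub> \<in> S \<and> (\<forall>x\<in>S. \<forall>y\<in>S. x \<oplus>\<^bsub>M\<^esub> y \<in> S) \<and>
     (\<forall>a\<in>carrier A. \<forall>x\<in>S. a \<odot>\<^bsub>M\<^esub> x \<in> S)"

lemma right_submodule_add:
  "right_submodule A M S \<Longrightarrow> x \<in> S \<Longrightarrow> y \<in> S \<Longrightarrow> x \<oplus>\<^bsub>M\<^esub> y \<in> S"
  by (simp add: right_submodule_def)

lemma right_submodule_uminus:
  assumes "right_module A M" "right_submodule A M S" "x \<in> S"
  shows "\<ominus>\<^bsub>M\<^esub> x \<in> S"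
proof -
  interpret right_module A M by fact
  show ?thesis
    using assms(2,3) minus_one_smult[of x]
    by (metis right_submodule_def R.add.inv_closed R.one_closed subsetD)
qed

lemma right_module_submodule:
  assumes "right_module A M" "right_submodule A M S"
  shows "right_module A (M\<lparr>carrier := S\<rparr>)"
proof -
  interpret right_module A M by fact
  have S: "S \<subseteq> carrier M" using assms(2) by (simp add: right_submodule_def)
  show ?thesis
  proof (rule right_moduleI)
    show "abelian_group (M\<lparr>carrier := S\<rparr>)"
    proof (rule abelian_groupI)
      fix x assume "x \<in> carrier (M\<lparr>carrier := S\<rparr>)"
      then show "\<exists>y\<in>carrier (M\<lparr>carrier := S\<rparr>). y \<oplus>\<^bsub>M\<lparr>carrier := S\<rparr>\<^esub> x = \<zero>\<^bsub>M\<lparr>carrier := S\<rparr>\<^esub>"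
        using right_submodule_uminus[OF assms, of x] S M.l_neg[of x] by auto
    qed (use assms(2) S in \<open>auto simp: right_submodule_def M.a_ac subset_iff\<close>)
  qed (use assms(2) S in \<open>auto simp: right_submodule_def R.ring_axioms smult_l_distr smult_r_distr
        smult_assoc subset_iff\<close>)
qed

lemma linear_map_submodule:
  "linear_map A X Y h \<Longrightarrow> h ` carrier X \<subseteq> S \<Longrightarrow> linear_map A X (Y\<lparr>carrier := S\<rparr>) h"
  by (auto simp: linear_map_def)

lemma linear_map_from_submodule:
  "linear_map A X (Y\<lparr>carrier := S\<rparr>) h \<Longrightarrow> S \<subseteq> carrier Y \<Longrightarrow> linear_map A X Y h"
  by (auto simp: linear_map_def)

lemma right_submodule_image:
  assumes "right_module A M" "right_module A N" "linear_map A M N h"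
  shows "right_submodule A N (h ` carrier M)"
proof -
  interpret M: right_module A M by fact
  show ?thesis
    unfolding right_submodule_def
  proof (intro conjI ballI)
    show "h ` carrier M \<subseteq> carrier N" using linear_map_closed[OF assms(3)] by auto
    show "\<zero>\<^bsub>N\<^esub> \<in> h ` carrier M"
      using linear_map_zero[OF assms] by (metis M.M.zero_closed image_eqI)
  next
    fix x y assume "x \<in> h ` carrier M" "y \<in> h ` carrier M"
    then show "x \<oplus>\<^bsub>N\<^esub> y \<in> h ` carrier M"
      by (auto simp flip: linear_map_add[OF assms(3)])
  next
    fix a x assume "a \<in> carrier A" "x \<in> h ` carrier M"
    then show "a \<odot>\<^bsub>N\<^esub> x \<in> h ` carrier M"
      by (auto simp flip: linear_map_smult[OF assms(3)])
  qed
qed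

lemma quotient_module:
  assumes M: "right_module A M" and K: "right_submodule A M K"
  shows quotient_module_right_module: "right_module A (quotient_module M K)" (is "right_module A ?Q")
    and quotient_module_proj: "linear_map A M (quotient_module M K) (\<lambda>x. K +>\<^bsub>M\<^esub> x)"
    and quotient_module_surj: "(\<lambda>x. K +>\<^bsub>M\<^esub> x) ` carrier M = carrier (quotient_module M K)"
    and quotient_module_eq_zero:
      "x \<in> carrier M \<Longrightarrow> K +>\<^bsub>M\<^esub> x = \<zero>\<^bsub>quotient_module M K\<^esub> \<longleftrightarrow> x \<in> K"
proof -
  interpret right_module A M by fact
  have KM: "K \<subseteq> carrier M" using K by (simp add: right_submodule_def)
  interpret K: additive_subgroup K M
    by unfold_locales
      (use K right_submodule_uminus[OF assms] in \<open>auto simp: right_submodule_def a_inv_def\<close>)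
  interpret K: abelian_subgroup K M
    by (rule abelian_subgroupI3) (rule K.additive_subgroup_axioms M.abelian_group_axioms)+
  let ?p = "\<lambda>x. K +>\<^bsub>M\<^esub> x"
  have surj: "?p ` carrier M = carrier ?Q"
    by (auto simp: quotient_module_def A_RCOSETS_def')
  have zero: "?p \<zero>\<^bsub>M\<^esub> = \<zero>\<^bsub>?Q\<^esub>"
    using KM by (simp add: quotient_module_def)
  have add: "?p (x \<oplus>\<^bsub>M\<^esub> y) = ?p x \<oplus>\<^bsub>?Q\<^esub> ?p y" if "x \<in> carrier M" "y \<in> carrier M" for x y
    using that by (simp add: quotient_module_def K.a_rcos_sum)
  have sm: "?p (a \<odot>\<^bsub>M\<^esub> x) = a \<odot>\<^bsub>?Q\<^esub> ?p x" if a: "a \<in> carrier A" and x: "x \<in> carrier M" for a x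
  proof -
    have sub: "(\<lambda>z. a \<odot>\<^bsub>M\<^esub> z) ` (K +>\<^bsub>M\<^esub> x) \<subseteq> K +>\<^bsub>M\<^esub> (a \<odot>\<^bsub>M\<^esub> x)"
      using a x KM K by (force simp: a_r_coset_def' smult_r_distr right_submodule_def)
    have mem: "a \<odot>\<^bsub>M\<^esub> x \<in> (\<lambda>z. a \<odot>\<^bsub>M\<^esub> z) ` (K +>\<^bsub>M\<^esub> x)"
      using x K.a_rcos_self by blast
    have "K +>\<^bsub>M\<^esub> (a \<odot>\<^bsub>M\<^esub> x) \<subseteq> K <+>\<^bsub>M\<^esub> (\<lambda>z. a \<odot>\<^bsub>M\<^esub> z) ` (K +>\<^bsub>M\<^esub> x)"
      using mem by (fastforce simp: a_r_coset_def' set_add_def')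
    moreover have "K <+>\<^bsub>M\<^esub> (\<lambda>z. a \<odot>\<^bsub>M\<^esub> z) ` (K +>\<^bsub>M\<^esub> x) \<subseteq> K <+>\<^bsub>M\<^esub> (K +>\<^bsub>M\<^esub> (a \<odot>\<^bsub>M\<^esub> x))"
      using sub by (fastforce simp: set_add_def')
    moreover have "K <+>\<^bsub>M\<^esub> (K +>\<^bsub>M\<^esub> (a \<odot>\<^bsub>M\<^esub> x)) = K +>\<^bsub>M\<^esub> (a \<odot>\<^bsub>M\<^esub> x)"
      using K.rcosets_add_eq[of "K +>\<^bsub>M\<^esub> (a \<odot>\<^bsub>M\<^esub> x)"] a x KM M.a_rcosetsI by simp
    ultimately have "K <+>\<^bsub>M\<^esub> (\<lambda>z. a \<odot>\<^bsub>M\<^esub> z) ` (K +>\<^bsub>M\<^esub> x) = K +>\<^bsub>M\<^esub> (a \<odot>\<^bsub>M\<^esub> x)"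
      by blast
    then show ?thesis by (simp add: quotient_module_def)
  qed
  show 1: "right_module A ?Q" by (rule right_module_image[OF M surj add sm zero])
  show "linear_map A M ?Q ?p" using surj by (intro linear_mapI add sm) auto
  show "?p ` carrier M = carrier ?Q" by (rule surj)
  show "K +>\<^bsub>M\<^esub> x = \<zero>\<^bsub>?Q\<^esub> \<longleftrightarrow> x \<in> K" if "x \<in> carrier M"
  proof
    assume "K +>\<^bsub>M\<^esub> x = \<zero>\<^bsub>?Q\<^esub>"
    then show "x \<in> K" using K.a_rcos_self[OF that] by (simp add: quotient_module_def)
  next
    assume "x \<in> K"
    then show "K +>\<^bsub>M\<^esub> x = \<zero>\<^bsub>?Q\<^esub>"
      using K.a_rcos_const[of x] by (simp add: quotient_module_def)
  qed
qed

lemma right_module_regular: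
  assumes "ring A" shows "right_module A (regular_module A)"
proof -
  interpret ring A by fact
  show ?thesis
    unfolding regular_module_def
    by (intro right_moduleI abelian_groupI)
      (auto simp: ring_axioms a_ac m_assoc l_distr r_distr intro: l_neg bexI[OF _ a_inv_closed])
qed

lemma regular_module_simps [simp]:
  "carrier (regular_module A) = carrier A" "\<zero>\<^bsub>regular_module A\<^esub> = \<zero>\<^bsub>A\<^esub>"
  "x \<oplus>\<^bsub>regular_module A\<^esub> y = x \<oplus>\<^bsub>A\<^esub> y" "a \<odot>\<^bsub>regular_module A\<^esub> x = x \<otimes>\<^bsub>A\<^esub> a"
  by (simp_all add: regular_module_def)

lemma linear_map_from_regular:
  assumes "right_module A X" "x \<in> carrier X"
  shows "linear_map A (regular_module A) X (\<lambda>a. a \<odot>\<^bsub>X\<^esub> x)"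
proof -
  interpret right_module A X by fact
  show ?thesis
    using assms(2) by (intro linear_mapI) (auto simp: smult_l_distr smult_assoc)
qed

lemma linear_map_regular_eq:
  assumes "right_module A X" "linear_map A (regular_module A) X h" "a \<in> carrier A"
  shows "h a = a \<odot>\<^bsub>X\<^esub> h \<one>\<^bsub>A\<^esub>"
proof -
  interpret right_module A X by fact
  show ?thesis using linear_map_smult[OF assms(2,3), of "\<one>\<^bsub>A\<^esub>"] assms(3) by simp
qed

lemma restrict_scalars_simps [simp]:
  "carrier (restrict_scalars f N) = carrier N" "\<zero>\<^bsub>restrict_scalars f N\<^esub> = \<zero>\<^bsub>N\<^esub>"
  "x \<oplus>\<^bsub>restrict_scalars f N\<^esub> y = x \<oplus>\<^bsub>N\<^esub> y" "a \<odot>\<^bsub>restrict_scalars f N\<^esub> x = f a \<odot>\<^bsub>N\<^esub> x"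
  by (simp_all add: restrict_scalars_def)

lemma right_module_restrict_scalars:
  assumes "ring A" "f \<in> ring_hom A B" "right_module B N"
  shows "right_module A (restrict_scalars f N)"
proof -
  interpret A: ring A by fact
  interpret N: right_module B N by fact
  note f = ring_hom_closed[OF assms(2)] ring_hom_add[OF assms(2)] ring_hom_mult[OF assms(2)]
    ring_hom_one[OF assms(2)]
  show ?thesis
  proof (rule right_moduleI)
    show "abelian_group (restrict_scalars f N)"
      by (rule abelian_groupI) (auto simp: N.M.a_ac intro: N.M.l_neg bexI[OF _ N.M.a_inv_closed])
  qed (auto simp: A.ring_axioms f N.smult_l_distr N.smult_r_distr N.smult_assoc)
qed

lemma direct_sum_simps [simp]:
  "carrier (direct_sum M N) = carrier M \<times> carrier N" "\<zero>\<^bsub>direct_sum M N\<^esub> = (\<zero>\<^bsub>M\<^esub>, \<zero>\<^bsub>N\<^esub>)"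
  "z \<oplus>\<^bsub>direct_sum M N\<^esub> z' = (fst z \<oplus>\<^bsub>M\<^esub> fst z', snd z \<oplus>\<^bsub>N\<^esub> snd z')"
  "a \<odot>\<^bsub>direct_sum M N\<^esub> z = (a \<odot>\<^bsub>M\<^esub> fst z, a \<odot>\<^bsub>N\<^esub> snd z)"
  by (simp_all add: direct_sum_def split_beta)

lemma right_module_direct_sum:
  assumes "right_module A M" "right_module A N"
  shows "right_module A (direct_sum M N)"
proof -
  interpret M: right_module A M by fact
  interpret N: right_module A N by fact
  show ?thesis
  proof (rule right_moduleI)
    show "abelian_group (direct_sum M N)"
    proof (rule abelian_groupI)
      fix z assume "z \<in> carrier (direct_sum M N)"
      then show "\<exists>y\<in>carrier (direct_sum M N). y \<oplus>\<^bsub>direct_sum M N\<^esub> z = \<zero>\<^bsub>direct_sum M N\<^esub>"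
        by (intro bexI[of _ "(\<ominus>\<^bsub>M\<^esub> fst z, \<ominus>\<^bsub>N\<^esub> snd z)"]) (auto simp: M.M.l_neg N.M.l_neg)
    qed (auto simp: M.M.a_ac N.M.a_ac)
  qed (auto simp: M.R.ring_axioms M.smult_l_distr M.smult_r_distr M.smult_assoc
      N.smult_l_distr N.smult_r_distr N.smult_assoc)
qed

lemma linear_map_fst: "linear_map A (direct_sum M N) M fst"
  and linear_map_snd: "linear_map A (direct_sum M N) N snd"
  by (auto intro!: linear_mapI)

lemma linear_map_Pair:
  "linear_map A L M h \<Longrightarrow> linear_map A L N k \<Longrightarrow> linear_map A L (direct_sum M N) (\<lambda>x. (h x, k x))"
  by (auto simp: linear_map_def Pi_iff)

lemma copower_carrier:
  "y \<in> carrier (copower J T) \<longleftrightarrow>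
    y \<in> J \<rightarrow>\<^sub>E carrier T \<and> finite {j \<in> J. y j \<noteq> \<zero>\<^bsub>T\<^esub>}"
  by (simp add: coproduct_def)

lemma copower_simps [simp]:
  "\<zero>\<^bsub>copower J T\<^esub> = (\<lambda>j\<in>J. \<zero>\<^bsub>T\<^esub>)"
  "x \<oplus>\<^bsub>copower J T\<^esub> y = (\<lambda>j\<in>J. x j \<oplus>\<^bsub>T\<^esub> y j)"
  "a \<odot>\<^bsub>copower J T\<^esub> x = (\<lambda>j\<in>J. a \<odot>\<^bsub>T\<^esub> x j)"
  by (simp_all add: coproduct_def)

lemma copower_memI:
  assumes "finite F" "\<And>j. j \<in> J \<Longrightarrow> y j \<in> carrier T" "\<And>j. j \<in> J \<Longrightarrow> j \<notin> F \<Longrightarrow> y j = \<zero>\<^bsub>T\<^esub>"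
  shows "restrict y J \<in> carrier (copower J T)"
proof -
  have "{j \<in> J. restrict y J j \<noteq> \<zero>\<^bsub>T\<^esub>} \<subseteq> F" using assms(3) by auto
  then show ?thesis
    using assms(2) finite_subset[OF _ assms(1)] unfolding copower_carrier by simp
qed

lemma right_module_copower:
  assumes "right_module A T"
  shows "right_module A (copower J T)"
proof -
  interpret right_module A T by fact
  have fin: "finite {j \<in> J. y j \<noteq> \<zero>\<^bsub>T\<^esub>}" if "y \<in> carrier (copower J T)" for y
    using that by (simp add: copower_carrier)
  have val: "y j \<in> carrier T" if "y \<in> carrier (copower J T)" "j \<in> J" for y j
    using that by (auto simp: copower_carrier)
  have ext: "restrict y J = y" if "y \<in> carrier (copower J T)" for y
    using that by (auto simp: copower_carrier PiE_def extensional_restrict)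
  show ?thesis
  proof (rule right_moduleI)
    show "abelian_group (copower J T)"
    proof (rule abelian_groupI)
      fix x y assume xy: "x \<in> carrier (copower J T)" "y \<in> carrier (copower J T)"
      then show "x \<oplus>\<^bsub>copower J T\<^esub> y \<in> carrier (copower J T)"
        unfolding copower_simps
        by (intro copower_memI[where F = "{j \<in> J. x j \<noteq> \<zero>\<^bsub>T\<^esub>} \<union> {j \<in> J. y j \<noteq> \<zero>\<^bsub>T\<^esub>}"])
          (auto simp: fin val)
      show "x \<oplus>\<^bsub>copower J T\<^esub> y = y \<oplus>\<^bsub>copower J T\<^esub> x"
        using xy by (auto simp: val M.a_comm intro!: restrict_ext)
    next
      show "\<zero>\<^bsub>copower J T\<^esub> \<in> carrier (copower J T)"
        by (auto simp: copower_carrier)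
    next
      fix x y z assume "x \<in> carrier (copower J T)" "y \<in> carrier (copower J T)" "z \<in> carrier (copower J T)"
      then show "x \<oplus>\<^bsub>copower J T\<^esub> y \<oplus>\<^bsub>copower J T\<^esub> z = x \<oplus>\<^bsub>copower J T\<^esub> (y \<oplus>\<^bsub>copower J T\<^esub> z)"
        by (auto simp: val M.a_assoc intro!: restrict_ext)
    next
      fix x assume x: "x \<in> carrier (copower J T)"
      show "\<zero>\<^bsub>copower J T\<^esub> \<oplus>\<^bsub>copower J T\<^esub> x = x"
        by (subst ext[OF x, symmetric]) (auto simp: val[OF x] intro!: restrict_ext)
      have "(\<lambda>j\<in>J. \<ominus>\<^bsub>T\<^esub> x j) \<in> carrier (copower J T)"
        using x by (intro copower_memI[where F = "{j \<in> J. x j \<noteq> \<zero>\<^bsub>T\<^esub>}"]) (auto simp: fin val)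
      moreover have "(\<lambda>j\<in>J. \<ominus>\<^bsub>T\<^esub> x j) \<oplus>\<^bsub>copower J T\<^esub> x = \<zero>\<^bsub>copower J T\<^esub>"
        using x by (auto simp: val M.l_neg intro!: restrict_ext)
      ultimately show "\<exists>y\<in>carrier (copower J T). y \<oplus>\<^bsub>copower J T\<^esub> x = \<zero>\<^bsub>copower J T\<^esub>" by blast
    qed
  next
    fix a x assume "a \<in> carrier A" "x \<in> carrier (copower J T)"
    then show "a \<odot>\<^bsub>copower J T\<^esub> x \<in> carrier (copower J T)"
      unfolding copower_simps
      by (intro copower_memI[where F = "{j \<in> J. x j \<noteq> \<zero>\<^bsub>T\<^esub>}"]) (auto simp: fin val smult_zero)
  next
    fix x assume x: "x \<in> carrier (copower J T)"
    show "\<one>\<^bsub>A\<^esub> \<odot>\<^bsub>copower J T\<^esub> x = x"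
      by (subst ext[OF x, symmetric]) (auto simp: val[OF x] intro!: restrict_ext)
  qed (auto simp: R.ring_axioms val smult_l_distr smult_r_distr smult_assoc intro!: restrict_ext)
qed

definition copower_in :: "'i set \<Rightarrow> ('a, 'x) module \<Rightarrow> 'i \<Rightarrow> 'x \<Rightarrow> 'i \<Rightarrow> 'x" where
  "copower_in J T j t = (\<lambda>i\<in>J. if i = j then t else \<zero>\<^bsub>T\<^esub>)"

definition copower_map ::
    "'i set \<Rightarrow> ('a, 'x) module \<Rightarrow> ('a, 'y) module \<Rightarrow> ('i \<Rightarrow> 'x \<Rightarrow> 'y) \<Rightarrow> ('i \<Rightarrow> 'x) \<Rightarrow> 'y" where
  "copower_map J T X e y = finsum X (\<lambda>j. e j (y j)) {j \<in> J. y j \<noteq> \<zero>\<^bsub>T\<^esub>}"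

lemma linear_map_copower_in:
  assumes "right_module A T"
  shows "linear_map A T (copower J T) (copower_in J T j)"
proof -
  interpret right_module A T by fact
  show ?thesis
  proof (rule linear_mapI)
    fix x assume "x \<in> carrier T"
    then show "copower_in J T j x \<in> carrier (copower J T)"
      unfolding copower_in_def by (intro copower_memI[where F = "{j}"]) auto
  qed (auto simp: copower_in_def smult_zero intro!: restrict_ext)
qed

lemma linear_map_copower_proj:
  "j \<in> J \<Longrightarrow> linear_map A (copower J T) T (\<lambda>y. y j)"
  by (intro linear_mapI) (auto simp: copower_carrier)

text \<open>
Every element is the finite sum of its components.
\<close>

lemma copower_induct:
  assumes T: "right_module A T" and y: "y \<in> carrier (copower J T)"
    and zero: "R \<zero>\<^bsub>copower J T\<^esub>"
    and add: "\<And>y y'. y \<in> carrier (copower J T) \<Longrightarrow> y' \<in> carrier (copower J T) \<Longrightarrow> R y \<Longrightarrow> R y' \<Longrightarrow>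
      R (y \<oplus>\<^bsub>copower J T\<^esub> y')"
    and ins: "\<And>j t. j \<in> J \<Longrightarrow> t \<in> carrier T \<Longrightarrow> R (copower_in J T j t)"
  shows "R y"
proof -
  interpret right_module A T by fact
  note in_closed = linear_map_closed[OF linear_map_copower_in[OF T]]
  have "finite F \<Longrightarrow> y \<in> carrier (copower J T) \<Longrightarrow> {j \<in> J. y j \<noteq> \<zero>\<^bsub>T\<^esub>} \<subseteq> F \<Longrightarrow> R y" for F y
  proof (induction F arbitrary: y rule: finite_induct)
    case empty
    then have "y = \<zero>\<^bsub>copower J T\<^esub>"
      by (auto simp: copower_carrier fun_eq_iff PiE_def extensional_def restrict_def)
    then show ?case using zero by (simp only:)
  next
    case (insert j F)
    show ?case
    proof (cases "j \<in> J")
      case True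
      let ?y = "\<lambda>i\<in>J. if i = j then \<zero>\<^bsub>T\<^esub> else y i"
      have yc: "y i \<in> carrier T" if "i \<in> J" for i using insert.prems(1) that by (auto simp: copower_carrier)
      have mem: "?y \<in> carrier (copower J T)"
        using insert.prems insert.hyps yc by (intro copower_memI[where F = F]) auto
      have "R ?y" using insert.prems by (intro insert.IH mem) auto
      then have "R (?y \<oplus>\<^bsub>copower J T\<^esub> copower_in J T j (y j))"
        using True yc by (intro add mem in_closed ins) auto
      moreover have "?y \<oplus>\<^bsub>copower J T\<^esub> copower_in J T j (y j) = y"
        using insert.prems(1) True yc
        by (auto simp: copower_in_def copower_carrier fun_eq_iff PiE_def extensional_def)
      ultimately show ?thesis by simp
    qed (use insert in auto)
  qed
  then show ?thesis using y by (auto simp: copower_carrier)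
qed

lemma linear_map_copower_eqI:
  assumes T: "right_module A T" and X: "right_module A X"
    and h: "linear_map A (copower J T) X h" and k: "linear_map A (copower J T) X k"
    and eq: "\<And>j t. j \<in> J \<Longrightarrow> t \<in> carrier T \<Longrightarrow> h (copower_in J T j t) = k (copower_in J T j t)"
    and y: "y \<in> carrier (copower J T)"
  shows "h y = k y"
proof (rule copower_induct[OF T y])
  show "h \<zero>\<^bsub>copower J T\<^esub> = k \<zero>\<^bsub>copower J T\<^esub>"
    using linear_map_zero[OF right_module_copower[OF T] X] h k by metis
qed (use h k in \<open>simp_all only: linear_map_add eq\<close>)

lemma copower_map_eq_sum:
  assumes T: "right_module A T" and X: "right_module A X"
    and e: "\<And>j. j \<in> J \<Longrightarrow> linear_map A T X (e j)" and y: "y \<in> J \<rightarrow> carrier T"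
    and F: "finite F" "F \<subseteq> J" "\<And>j. j \<in> J \<Longrightarrow> j \<notin> F \<Longrightarrow> y j = \<zero>\<^bsub>T\<^esub>"
  shows "copower_map J T X e y = finsum X (\<lambda>j. e j (y j)) F"
proof -
  interpret T: right_module A T by fact
  interpret X: right_module A X by fact
  show ?thesis
    unfolding copower_map_def
    using F y linear_map_closed[OF e] linear_map_zero[OF T X e]
    by (intro X.M.add.finprod_mono_neutral_cong_left) (auto simp: Pi_iff subset_iff)
qed

lemma linear_map_finsum_smult:
  assumes X: "right_module A X" and a: "a \<in> carrier A" and "finite F" "g \<in> F \<rightarrow> carrier X"
  shows "finsum X (\<lambda>j. a \<odot>\<^bsub>X\<^esub> g j) F = a \<odot>\<^bsub>X\<^esub> finsum X g F"
proof -
  interpret X: right_module A X by fact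
  show ?thesis
    using assms(3,4)
    by (induction F rule: finite_induct) (simp_all add: a X.smult_zero X.smult_r_distr Pi_iff)
qed

lemma linear_map_copower_map:
  assumes T: "right_module A T" and X: "right_module A X"
    and e: "\<And>j. j \<in> J \<Longrightarrow> linear_map A T X (e j)"
  shows "linear_map A (copower J T) X (copower_map J T X e)"
proof -
  interpret T: right_module A T by fact
  interpret X: right_module A X by fact
  note ec = linear_map_closed[OF e]
  have val: "y j \<in> carrier T" if "y \<in> carrier (copower J T)" "j \<in> J" for y j
    using that by (auto simp: copower_carrier)
  let ?s = "\<lambda>y. {j \<in> J. y j \<noteq> \<zero>\<^bsub>T\<^esub>}"
  have fin: "finite (?s y)" if "y \<in> carrier (copower J T)" for y
    using that by (auto simp: copower_carrier)
  show ?thesis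
  proof (rule linear_mapI)
    fix y assume "y \<in> carrier (copower J T)"
    then show "copower_map J T X e y \<in> carrier X"
      unfolding copower_map_def by (intro X.M.finsum_closed) (auto simp: val intro!: ec)
  next
    fix y z assume yz: "y \<in> carrier (copower J T)" "z \<in> carrier (copower J T)"
    let ?F = "?s y \<union> ?s z"
    have sum: "copower_map J T X e x = finsum X (\<lambda>j. e j (x j)) ?F"
      if "x \<in> J \<rightarrow> carrier T" "\<And>j. j \<in> J \<Longrightarrow> j \<notin> ?F \<Longrightarrow> x j = \<zero>\<^bsub>T\<^esub>" for x
      using that fin yz by (intro copower_map_eq_sum[OF T X e]) auto
    have "copower_map J T X e (y \<oplus>\<^bsub>copower J T\<^esub> z) =
        finsum X (\<lambda>j. e j ((y \<oplus>\<^bsub>copower J T\<^esub> z) j)) ?F"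
      using yz by (intro sum) (auto simp: val)
    also have "\<dots> = finsum X (\<lambda>j. e j (y j) \<oplus>\<^bsub>X\<^esub> e j (z j)) ?F"
      using yz ec val by (intro X.M.finsum_cong') (auto simp: linear_map_add[OF e])
    also have "\<dots> = finsum X (\<lambda>j. e j (y j)) ?F \<oplus>\<^bsub>X\<^esub> finsum X (\<lambda>j. e j (z j)) ?F"
      using yz ec val by (intro X.M.finsum_addf) auto
    also have "finsum X (\<lambda>j. e j (y j)) ?F = copower_map J T X e y"
      using yz val by (intro sum[symmetric]) auto
    also have "finsum X (\<lambda>j. e j (z j)) ?F = copower_map J T X e z"
      using yz val by (intro sum[symmetric]) auto
    finally show "copower_map J T X e (y \<oplus>\<^bsub>copower J T\<^esub> z) =
      copower_map J T X e y \<oplus>\<^bsub>X\<^esub> copower_map J T X e z" .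
  next
    fix a y assume a: "a \<in> carrier A" and y: "y \<in> carrier (copower J T)"
    have "copower_map J T X e (a \<odot>\<^bsub>copower J T\<^esub> y) =
        finsum X (\<lambda>j. e j ((a \<odot>\<^bsub>copower J T\<^esub> y) j)) (?s y)"
      using a y by (intro copower_map_eq_sum[OF T X e]) (auto simp: val fin T.smult_zero)
    also have "\<dots> = finsum X (\<lambda>j. a \<odot>\<^bsub>X\<^esub> e j (y j)) (?s y)"
      using a y ec val by (intro X.M.finsum_cong') (auto simp: linear_map_smult[OF e])
    also have "\<dots> = a \<odot>\<^bsub>X\<^esub> copower_map J T X e y"
      unfolding copower_map_def
      using a y ec val fin by (intro linear_map_finsum_smult[OF X]) auto
    finally show "copower_map J T X e (a \<odot>\<^bsub>copower J T\<^esub> y) = a \<odot>\<^bsub>X\<^esub> copower_map J T X e y" .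
  qed
qed

lemma copower_map_in:
  assumes T: "right_module A T" and X: "right_module A X"
    and e: "\<And>j. j \<in> J \<Longrightarrow> linear_map A T X (e j)" and j: "j \<in> J" "t \<in> carrier T"
  shows "copower_map J T X e (copower_in J T j t) = e j t"
proof -
  interpret T: right_module A T by fact
  interpret X: right_module A X by fact
  have "copower_map J T X e (copower_in J T j t) = finsum X (\<lambda>i. e i (copower_in J T j t i)) {j}"
    using j by (intro copower_map_eq_sum[OF T X e]) (auto simp: copower_in_def)
  also have "\<dots> = e j t"
    using j linear_map_closed[OF e] by (simp add: copower_in_def)
  finally show ?thesis .
qed

lemma linear_map_copower_functor:
  assumes T: "right_module A T" and T': "right_module A T'"
    and h: "linear_map A T T' h" and b: "bij_betw b J' J"
  shows "linear_map A (copower J T) (copower J' T') (\<lambda>y. \<lambda>i\<in>J'. h (y (b i)))"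
proof -
  have val: "y j \<in> carrier T" if "y \<in> carrier (copower J T)" "j \<in> J" for y j
    using that by (auto simp: copower_carrier)
  note bJ = bij_betw_apply[OF b]
  show ?thesis
  proof (rule linear_mapI)
    fix y assume y: "y \<in> carrier (copower J T)"
    have fin: "finite {i \<in> J'. b i \<in> {j \<in> J. y j \<noteq> \<zero>\<^bsub>T\<^esub>}}"
      using y b by (intro finite_inverse_image_gen[of _ b])
        (auto simp: copower_carrier bij_betw_def intro: inj_on_subset)
    show "(\<lambda>i\<in>J'. h (y (b i))) \<in> carrier (copower J' T')"
      using y bJ linear_map_closed[OF h] linear_map_zero[OF T T' h]
      by (intro copower_memI[OF fin]) (auto simp: copower_carrier)
  next
    fix y z assume "y \<in> carrier (copower J T)" "z \<in> carrier (copower J T)"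
    then show "(\<lambda>i\<in>J'. h ((y \<oplus>\<^bsub>copower J T\<^esub> z) (b i))) =
        (\<lambda>i\<in>J'. h (y (b i))) \<oplus>\<^bsub>copower J' T'\<^esub> (\<lambda>i\<in>J'. h (z (b i)))"
      using bJ linear_map_add[OF h] val by (auto intro!: restrict_ext)
  next
    fix a y assume "a \<in> carrier A" "y \<in> carrier (copower J T)"
    then show "(\<lambda>i\<in>J'. h ((a \<odot>\<^bsub>copower J T\<^esub> y) (b i))) =
        a \<odot>\<^bsub>copower J' T'\<^esub> (\<lambda>i\<in>J'. h (y (b i)))"
      using bJ linear_map_smult[OF h] val by (auto intro!: restrict_ext)
  qed
qed

lemma copower_iso:
  assumes T: "right_module A T" and T': "right_module A T'"
    and h: "linear_map A T T' h" "bij_betw h (carrier T) (carrier T')" and b: "bij_betw b J' J"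
  obtains k where "linear_map A (copower J T) (copower J' T') k"
    "bij_betw k (carrier (copower J T)) (carrier (copower J' T'))"
proof -
  let ?h' = "inv_into (carrier T) h" and ?b' = "inv_into J' b"
  let ?k = "\<lambda>y. \<lambda>i\<in>J'. h (y (b i))" and ?k' = "\<lambda>y. \<lambda>i\<in>J. ?h' (y (?b' i))"
  have k: "linear_map A (copower J T) (copower J' T') ?k"
    by (rule linear_map_copower_functor[OF T T' h(1) b])
  have k': "linear_map A (copower J' T') (copower J T) ?k'"
    by (rule linear_map_copower_functor[OF T' T linear_map_inv_into[OF T h] bij_betw_inv_into[OF b]])
  have "bij_betw ?k (carrier (copower J T)) (carrier (copower J' T'))"
  proof (rule bij_betw_byWitness[where f' = ?k'])
    show "\<forall>y\<in>carrier (copower J T). ?k' (?k y) = y"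
      using b h(2)
      by (auto simp: copower_carrier fun_eq_iff PiE_def extensional_def bij_betw_inv_into_right
          bij_betw_inv_into_left bij_betw_apply[OF bij_betw_inv_into[OF b]] Pi_iff)
    show "\<forall>y\<in>carrier (copower J' T'). ?k (?k' y) = y"
      using b h(2)
      by (auto simp: copower_carrier fun_eq_iff PiE_def extensional_def bij_betw_inv_into_right
          bij_betw_inv_into_left bij_betw_apply[OF b] Pi_iff)
  qed (use linear_map_closed[OF k] linear_map_closed[OF k'] in auto)
  with k show ?thesis using that by blast
qed

section \<open>Cardinalities\<close>

lemma lepoll_times:
  assumes "infinite (UNIV :: 'u set)" "X \<lesssim> (UNIV :: 'u set)" "Y \<lesssim> (UNIV :: 'u set)"
  shows "X \<times> Y \<lesssim> (UNIV :: 'u set)"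
proof -
  have "(UNIV :: 'u set) \<times> (UNIV :: 'u set) \<approx> (UNIV :: 'u set)"
    using card_of_Times_same_infinite[OF assms(1)] by (simp add: eqpoll_iff_card_of_ordIso)
  then show ?thesis
    using times_lepoll_mono[OF assms(2,3)] lepoll_trans2 by blast
qed

lemma lepoll_Plus:
  assumes "infinite (UNIV :: 'u set)" "X \<lesssim> (UNIV :: 'u set)" "Y \<lesssim> (UNIV :: 'u set)"
  shows "X <+> Y \<lesssim> (UNIV :: 'u set)"
proof -
  have "(UNIV :: 'u set) <+> (UNIV :: 'u set) \<approx> (UNIV :: 'u set)"
    using card_of_Plus_infinite1[OF assms(1) card_of_mono1[OF subset_refl]]
    by (simp add: eqpoll_iff_card_of_ordIso)
  then show ?thesis
    using sum_lepoll_mono[OF assms(2,3)] lepoll_trans2 by blast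
qed

lemma lepoll_Un:
  assumes "infinite C" "A \<lesssim> C" "B \<lesssim> C" shows "A \<union> B \<lesssim> C"
  using assms card_of_Un_ordLeq_infinite_Field[of "card_of C" A B]
  by (simp add: lepoll_def card_of_ordLeq[symmetric] Field_card_of card_of_card_order_on)

text \<open>
For each of the countably many lengths, the lists of that length are at most as many as the elements
of the infinite type \<open>'u\<close>.
\<close>

lemma lepoll_lists_UNIV:
  assumes U: "infinite (UNIV :: 'u set)" and X: "X \<lesssim> (UNIV :: 'u set)"
  shows "lists X \<lesssim> (UNIV :: 'u set)"
proof -
  have "{l :: 'u list. length l = n} \<lesssim> (UNIV :: 'u set)" for n
  proof (induction n)
    case (Suc n)
    have "{l :: 'u list. length l = Suc n} \<subseteq> (\<lambda>(x, l). x # l) ` (UNIV \<times> {l. length l = n})"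
      by (auto simp: length_Suc_conv)
    then have "{l :: 'u list. length l = Suc n} \<lesssim> (UNIV :: 'u set) \<times> {l :: 'u list. length l = n}"
      by (rule subset_image_lepoll)
    also have "\<dots> \<lesssim> (UNIV :: 'u set)" using Suc by (intro lepoll_times[OF U]) auto
    finally show ?case .
  qed (use U in \<open>simp add: finite_lepoll_infinite\<close>)
  then have "\<forall>n. \<exists>g :: 'u \<Rightarrow> 'u list. {l. length l = n} \<subseteq> range g"
    unfolding lepoll_iff by blast
  then obtain g :: "nat \<Rightarrow> 'u \<Rightarrow> 'u list" where g: "{l. length l = n} \<subseteq> range (g n)" for n
    by metis
  have "lists (UNIV :: 'u set) \<subseteq> (\<lambda>(n, u). g n u) ` (UNIV \<times> UNIV)"
  proof
    fix l :: "'u list"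
    have "l \<in> range (g (length l))" using g[of "length l"] by auto
    then obtain u where "l = g (length l) u" by blast
    then show "l \<in> (\<lambda>(n, u). g n u) ` (UNIV \<times> UNIV)"
      by (intro image_eqI[of _ _ "(length l, u)"]) auto
  qed
  then have "lists (UNIV :: 'u set) \<lesssim> (UNIV :: nat set) \<times> (UNIV :: 'u set)"
    by (rule subset_image_lepoll)
  also have "\<dots> \<lesssim> (UNIV :: 'u set)"
    using U infinite_le_lepoll by (intro lepoll_times[OF U]) auto
  finally show ?thesis
    using lists_lepoll_mono[OF X] lepoll_trans by blast
qed

text \<open>
An element is recovered from the finite list of its nonzero components.
\<close>

lemma lepoll_copower:
  assumes "infinite (UNIV :: 'u set)" "J \<lesssim> (UNIV :: 'u set)" "carrier T \<lesssim> (UNIV :: 'u set)"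
  shows "carrier (copower J T) \<lesssim> (UNIV :: 'u set)"
proof -
  let ?f = "\<lambda>l. \<lambda>j\<in>J. case map_of l j of Some t \<Rightarrow> t | None \<Rightarrow> \<zero>\<^bsub>T\<^esub>"
  have "carrier (copower J T) \<subseteq> ?f ` lists (J \<times> carrier T)"
  proof
    fix y assume y: "y \<in> carrier (copower J T)"
    then obtain js where js: "set js = {j \<in> J. y j \<noteq> \<zero>\<^bsub>T\<^esub>}"
      using finite_list unfolding copower_carrier by blast
    let ?l = "map (\<lambda>j. (j, y j)) js"
    have l: "?l \<in> lists (J \<times> carrier T)" using js y by (auto simp: copower_carrier)
    have "?f ?l = y"
      using y js by (auto simp: fun_eq_iff copower_carrier map_of_map_restrict restrict_map_def PiE_def
          extensional_def)
    then show "y \<in> ?f ` lists (J \<times> carrier T)" using l by (rule image_eqI[OF sym])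
  qed
  then have "carrier (copower J T) \<lesssim> lists (J \<times> carrier T)" by (rule subset_image_lepoll)
  also have "\<dots> \<lesssim> (UNIV :: 'u set)"
    using assms by (intro lepoll_lists_UNIV lepoll_times)
  finally show ?thesis .
qed

text \<open>
A maximal set \<open>S\<close> disjoint from its image under \<open>t\<close> covers \<open>H\<close> together with that image and with its
preimage under \<open>t\<close>, so it is as large as \<open>H\<close>; dropping one point \<open>d\<close> does not change this. For the
translation \<open>t s = s - d\<close> of a group, every \<open>s \<in> S\<close> is then the sum of \<open>t s\<close> and \<open>d\<close>, which both lie
outside of \<open>S\<close>.
\<close>

lemma large_set_avoiding_shift:
  assumes H: "infinite H" and inj: "inj_on t H" and t: "\<And>s. s \<in> H \<Longrightarrow> t s \<noteq> s"
  obtains S where "S \<subseteq> H" "\<And>s. s \<in> S \<Longrightarrow> t s \<notin> S" "d \<notin> S" "H \<lesssim> S"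
proof -
  let ?F = "{S. S \<subseteq> H \<and> (\<forall>s\<in>S. t s \<notin> S)}"
  have "\<exists>S\<in>?F. \<forall>X\<in>?F. S \<subseteq> X \<longrightarrow> X = S"
  proof (rule subset_Zorn_nonempty)
    fix \<C> assume "\<C> \<noteq> {}" and chain: "subset.chain ?F \<C>"
    have "t s \<notin> \<Union>\<C>" if s: "s \<in> \<Union>\<C>" for s
    proof
      assume "t s \<in> \<Union>\<C>"
      then obtain X Y where "s \<in> X" "t s \<in> Y" "X \<in> \<C>" "Y \<in> \<C>" using s by blast
      moreover have "X \<subseteq> Y \<or> Y \<subseteq> X"
        using chain calculation by (auto simp: subset_chain_def)
      moreover have "X \<in> ?F" "Y \<in> ?F"
        using chain calculation by (auto simp: subset_chain_def)
      ultimately show False by blast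
    qed
    then show "\<Union>\<C> \<in> ?F" using chain by (auto simp: subset_chain_def)
  qed blast
  then obtain S where SF: "S \<in> ?F" and SX: "\<forall>X\<in>?F. S \<subseteq> X \<longrightarrow> X = S" ..
  have S: "S \<subseteq> H" "\<And>s. s \<in> S \<Longrightarrow> t s \<notin> S" using SF by auto
  have max: "X = S" if "X \<subseteq> H" "\<forall>s\<in>X. t s \<notin> X" "S \<subseteq> X" for X
    using SX that by simp
  have cover: "H \<subseteq> S \<union> t ` S \<union> {x \<in> H. t x \<in> S}"
  proof
    fix x assume x: "x \<in> H"
    show "x \<in> S \<union> t ` S \<union> {x \<in> H. t x \<in> S}"
    proof (rule ccontr)
      assume *: "\<not> ?thesis"
      then have "\<forall>s\<in>insert x S. t s \<notin> insert x S" using S(2) t[OF x] x by auto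
      then have "insert x S = S" using x S(1) by (intro max) auto
      with * show False by blast
    qed
  qed
  have pre: "{x \<in> H. t x \<in> S} \<lesssim> S"
    using inj by (auto simp: lepoll_def inj_on_def intro!: exI[of _ t])
  have S_inf: "infinite S"
  proof
    assume fin: "finite S"
    have "finite (t ` {x \<in> H. t x \<in> S})" by (rule finite_subset[OF _ fin]) blast
    then have "finite {x \<in> H. t x \<in> S}"
      by (rule finite_imageD) (rule inj_on_subset[OF inj], blast)
    then show False using finite_subset[OF cover] fin H by blast
  qed
  have "H \<lesssim> S \<union> t ` S \<union> {x \<in> H. t x \<in> S}" using cover by (rule subset_imp_lepoll)
  also have "\<dots> \<lesssim> S" using S_inf pre by (intro lepoll_Un image_lepoll) auto
  finally have "H \<lesssim> S" .
  also have "S \<lesssim> insert d (S - {d})" by (rule subset_imp_lepoll) blast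
  also have "insert d (S - {d}) \<lesssim> S - {d}" using S_inf by (intro infinite_insert_lepoll) simp
  finally have "H \<lesssim> S - {d}" .
  then show ?thesis using S by (intro that[of "S - {d}"]) auto
qed

section \<open>Ring epimorphisms and linear maps\<close>

text \<open>
The trivial extension of \<open>B\<close> by a bimodule \<open>S\<close> of additive maps \<open>d : B \<rightarrow> B\<close>, on which \<open>b\<close> acts from
the left by \<open>d \<mapsto> (x \<mapsto> d (x b))\<close> and \<open>c\<close> from the right by \<open>d \<mapsto> (x \<mapsto> d x \<cdot> c)\<close>.
\<close>

definition trivial_extension :: "('b, 'n) ring_scheme \<Rightarrow> ('b \<Rightarrow> 'b) set \<Rightarrow> ('b \<times> ('b \<Rightarrow> 'b)) ring" where
  "trivial_extension B S =
     \<lparr>carrier = carrier B \<times> S,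
      mult = (\<lambda>(b, d) (c, d'). (b \<otimes>\<^bsub>B\<^esub> c, \<lambda>x\<in>carrier B. d' (x \<otimes>\<^bsub>B\<^esub> b) \<oplus>\<^bsub>B\<^esub> d x \<otimes>\<^bsub>B\<^esub> c)),
      one = (\<one>\<^bsub>B\<^esub>, \<lambda>x\<in>carrier B. \<zero>\<^bsub>B\<^esub>),
      zero = (\<zero>\<^bsub>B\<^esub>, \<lambda>x\<in>carrier B. \<zero>\<^bsub>B\<^esub>),
      add = (\<lambda>(b, d) (c, d'). (b \<oplus>\<^bsub>B\<^esub> c, \<lambda>x\<in>carrier B. d x \<oplus>\<^bsub>B\<^esub> d' x))\<rparr>"

locale additive_bimodule = ring B for B :: "('b, 'n) ring_scheme" (structure) +
  fixes S :: "('b \<Rightarrow> 'b) set"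
  assumes S_maps: "d \<in> S \<Longrightarrow> d \<in> carrier B \<rightarrow>\<^sub>E carrier B"
    and S_additive: "d \<in> S \<Longrightarrow> x \<in> carrier B \<Longrightarrow> y \<in> carrier B \<Longrightarrow> d (x \<oplus> y) = d x \<oplus> d y"
    and S_zero: "(\<lambda>x\<in>carrier B. \<zero>) \<in> S"
    and S_add: "d \<in> S \<Longrightarrow> d' \<in> S \<Longrightarrow> (\<lambda>x\<in>carrier B. d x \<oplus> d' x) \<in> S"
    and S_left: "d \<in> S \<Longrightarrow> b \<in> carrier B \<Longrightarrow> (\<lambda>x\<in>carrier B. d (x \<otimes> b)) \<in> S"
    and S_right: "d \<in> S \<Longrightarrow> b \<in> carrier B \<Longrightarrow> (\<lambda>x\<in>carrier B. d x \<otimes> b) \<in> S"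
begin

lemma S_closed: "d \<in> S \<Longrightarrow> x \<in> carrier B \<Longrightarrow> d x \<in> carrier B"
  using S_maps by auto

lemma S_minus: "d \<in> S \<Longrightarrow> (\<lambda>x\<in>carrier B. \<ominus> d x) \<in> S"
proof -
  assume d: "d \<in> S"
  have "(\<lambda>x\<in>carrier B. \<ominus> d x) = (\<lambda>x\<in>carrier B. d x \<otimes> (\<ominus> \<one>))"
    using d by (auto simp: S_closed r_minus intro!: restrict_ext)
  then show ?thesis using S_right[OF d, of "\<ominus> \<one>"] by simp
qed

lemma S_restrict: "d \<in> S \<Longrightarrow> restrict d (carrier B) = d"
  using S_maps by (auto simp: PiE_def extensional_restrict)

lemma S_mult:
  assumes "d \<in> S" "d' \<in> S" "b \<in> carrier B" "c \<in> carrier B"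
  shows "(\<lambda>x\<in>carrier B. d' (x \<otimes> b) \<oplus> d x \<otimes> c) \<in> S"
proof -
  have "(\<lambda>x\<in>carrier B. d' (x \<otimes> b) \<oplus> d x \<otimes> c) =
      (\<lambda>x\<in>carrier B. (\<lambda>x\<in>carrier B. d' (x \<otimes> b)) x \<oplus> (\<lambda>x\<in>carrier B. d x \<otimes> c) x)"
    by (auto intro!: restrict_ext)
  then show ?thesis using S_add[OF S_left[OF assms(2,3)] S_right[OF assms(1,4)]] by simp
qed

lemma ring_trivial_extension: "ring (trivial_extension B S)"
proof (rule ringI)
  let ?C = "trivial_extension B S"
  show "abelian_group ?C"
  proof (rule abelian_groupI)
    fix x y assume "x \<in> carrier ?C" "y \<in> carrier ?C"
    then show "x \<oplus>\<^bsub>?C\<^esub> y \<in> carrier ?C" "x \<oplus>\<^bsub>?C\<^esub> y = y \<oplus>\<^bsub>?C\<^esub> x"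
      by (auto simp: trivial_extension_def S_add S_closed a_comm intro!: restrict_ext)
  next
    show "\<zero>\<^bsub>?C\<^esub> \<in> carrier ?C" by (simp add: trivial_extension_def S_zero)
  next
    fix x y z assume "x \<in> carrier ?C" "y \<in> carrier ?C" "z \<in> carrier ?C"
    then show "x \<oplus>\<^bsub>?C\<^esub> y \<oplus>\<^bsub>?C\<^esub> z = x \<oplus>\<^bsub>?C\<^esub> (y \<oplus>\<^bsub>?C\<^esub> z)"
      by (auto simp: trivial_extension_def S_closed a_assoc intro!: restrict_ext)
  next
    fix x assume x: "x \<in> carrier ?C"
    then have "\<zero>\<^bsub>?C\<^esub> \<oplus>\<^bsub>?C\<^esub> x = (fst x, restrict (snd x) (carrier B))"
      by (auto simp: trivial_extension_def S_closed intro!: restrict_ext)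
    then show "\<zero>\<^bsub>?C\<^esub> \<oplus>\<^bsub>?C\<^esub> x = x"
      using x by (auto simp: trivial_extension_def S_restrict)
    have "(\<ominus> fst x, \<lambda>y\<in>carrier B. \<ominus> snd x y) \<in> carrier ?C"
      using x by (auto simp: trivial_extension_def S_minus)
    moreover have "(\<ominus> fst x, \<lambda>y\<in>carrier B. \<ominus> snd x y) \<oplus>\<^bsub>?C\<^esub> x = \<zero>\<^bsub>?C\<^esub>"
      using x by (auto simp: trivial_extension_def l_neg S_closed intro!: restrict_ext)
    ultimately show "\<exists>y\<in>carrier ?C. y \<oplus>\<^bsub>?C\<^esub> x = \<zero>\<^bsub>?C\<^esub>" by blast
  qed
  show "monoid ?C"
  proof (rule monoidI)
    fix x y assume "x \<in> carrier ?C" "y \<in> carrier ?C"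
    then show "x \<otimes>\<^bsub>?C\<^esub> y \<in> carrier ?C"
      by (auto simp: trivial_extension_def S_mult)
  next
    show "\<one>\<^bsub>?C\<^esub> \<in> carrier ?C" by (simp add: trivial_extension_def S_zero)
  next
    fix x y z assume "x \<in> carrier ?C" "y \<in> carrier ?C" "z \<in> carrier ?C"
    then show "x \<otimes>\<^bsub>?C\<^esub> y \<otimes>\<^bsub>?C\<^esub> z = x \<otimes>\<^bsub>?C\<^esub> (y \<otimes>\<^bsub>?C\<^esub> z)"
      by (auto simp: trivial_extension_def S_closed a_assoc m_assoc l_distr intro!: restrict_ext)
  next
    fix x assume x: "x \<in> carrier ?C"
    have "\<one>\<^bsub>?C\<^esub> \<otimes>\<^bsub>?C\<^esub> x = (fst x, restrict (snd x) (carrier B))"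
      using x by (auto simp: trivial_extension_def S_closed intro!: restrict_ext)
    then show "\<one>\<^bsub>?C\<^esub> \<otimes>\<^bsub>?C\<^esub> x = x"
      using x by (auto simp: trivial_extension_def S_restrict)
    have "x \<otimes>\<^bsub>?C\<^esub> \<one>\<^bsub>?C\<^esub> = (fst x, restrict (snd x) (carrier B))"
      using x by (auto simp: trivial_extension_def S_closed intro!: restrict_ext)
    then show "x \<otimes>\<^bsub>?C\<^esub> \<one>\<^bsub>?C\<^esub> = x"
      using x by (auto simp: trivial_extension_def S_restrict)
  qed
next
  let ?C = "trivial_extension B S"
  fix x y z assume "x \<in> carrier ?C" "y \<in> carrier ?C" "z \<in> carrier ?C"
  then show "(x \<oplus>\<^bsub>?C\<^esub> y) \<otimes>\<^bsub>?C\<^esub> z = x \<otimes>\<^bsub>?C\<^esub> z \<oplus>\<^bsub>?C\<^esub> y \<otimes>\<^bsub>?C\<^esub> z"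
    and "z \<otimes>\<^bsub>?C\<^esub> (x \<oplus>\<^bsub>?C\<^esub> y) = z \<otimes>\<^bsub>?C\<^esub> x \<oplus>\<^bsub>?C\<^esub> z \<otimes>\<^bsub>?C\<^esub> y"
    by (auto simp: trivial_extension_def S_closed S_additive a_ac l_distr r_distr intro!: restrict_ext)
qed

end

text \<open>
The maps \<open>x \<mapsto> \<Sum> e (x b) c\<close>, which form the bimodule generated by \<open>e\<close>. Indexing them by lists bounds
its cardinality.
\<close>

definition twist_sum :: "('b, 'n) ring_scheme \<Rightarrow> ('b \<Rightarrow> 'b) \<Rightarrow> ('b \<times> 'b) list \<Rightarrow> 'b \<Rightarrow> 'b" where
  "twist_sum B e l = (\<lambda>x\<in>carrier B.
     foldr (\<lambda>(b, c) s. e (x \<otimes>\<^bsub>B\<^esub> b) \<otimes>\<^bsub>B\<^esub> c \<oplus>\<^bsub>B\<^esub> s) l \<zero>\<^bsub>B\<^esub>)"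

context ring
begin

lemma twist_sum_Nil: "x \<in> carrier R \<Longrightarrow> twist_sum R e [] x = \<zero>"
  and twist_sum_Cons: "x \<in> carrier R \<Longrightarrow>
    twist_sum R e (bc # l) x = e (x \<otimes> fst bc) \<otimes> snd bc \<oplus> twist_sum R e l x"
  by (simp_all add: twist_sum_def split_beta)

lemma twist_sum_closed:
  assumes e: "\<And>x. x \<in> carrier R \<Longrightarrow> e x \<in> carrier R"
    and l: "l \<in> lists (carrier R \<times> carrier R)" and x: "x \<in> carrier R"
  shows "twist_sum R e l x \<in> carrier R"
  using l by induction (auto simp: twist_sum_Nil twist_sum_Cons x e)

lemma additive_bimodule_twist_sum:
  assumes e: "\<And>x. x \<in> carrier R \<Longrightarrow> e x \<in> carrier R"
    and e_add: "\<And>x y. x \<in> carrier R \<Longrightarrow> y \<in> carrier R \<Longrightarrow> e (x \<oplus> y) = e x \<oplus> e y"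
  shows "additive_bimodule R (twist_sum R e ` lists (carrier R \<times> carrier R))"
proof -
  let ?L = "lists (carrier R \<times> carrier R)"
  have ext: "twist_sum R e l = restrict (twist_sum R e l) (carrier R)" for l
    by (simp add: twist_sum_def)
  note closed = twist_sum_closed[of e, OF e]
  show ?thesis
  proof
    fix d assume "d \<in> twist_sum R e ` ?L"
    then obtain l where l: "l \<in> ?L" "d = twist_sum R e l" by blast
    show "d \<in> carrier R \<rightarrow>\<^sub>E carrier R"
      unfolding l(2) by (intro PiE_I closed l(1)) (simp_all add: twist_sum_def)
  next
    fix d x y assume "d \<in> twist_sum R e ` ?L" and xy: "x \<in> carrier R" "y \<in> carrier R"
    then obtain l where l: "l \<in> ?L" "d = twist_sum R e l" by blast
    have "twist_sum R e l (x \<oplus> y) = twist_sum R e l x \<oplus> twist_sum R e l y"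
      using l(1)
    proof induction
      case (Cons bc l)
      then show ?case
        using xy closed[of l x] closed[of l y]
        by (auto simp: twist_sum_Cons e e_add l_distr a_ac)
    qed (simp add: xy twist_sum_Nil)
    then show "d (x \<oplus> y) = d x \<oplus> d y" by (simp add: l)
  next
    have "(\<lambda>x\<in>carrier R. \<zero>) = twist_sum R e []" by (simp add: twist_sum_def)
    then show "(\<lambda>x\<in>carrier R. \<zero>) \<in> twist_sum R e ` ?L" by blast
  next
    fix d d' assume "d \<in> twist_sum R e ` ?L" "d' \<in> twist_sum R e ` ?L"
    then obtain l l' where l: "l \<in> ?L" "d = twist_sum R e l" and l': "l' \<in> ?L" "d' = twist_sum R e l'"
      by blast
    have "twist_sum R e (l @ l') x = d x \<oplus> d' x" if x: "x \<in> carrier R" for x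
      unfolding l(2) l'(2) using l(1)
    proof induction
      case (Cons bc l)
      then show ?case
        using x l'(1) closed[of l x] closed[of l' x] by (auto simp: twist_sum_Cons e a_ac)
    qed (use l'(1) x closed in \<open>simp add: twist_sum_Nil\<close>)
    then have "(\<lambda>x\<in>carrier R. d x \<oplus> d' x) = twist_sum R e (l @ l')"
      by (subst ext) (auto intro!: restrict_ext)
    then show "(\<lambda>x\<in>carrier R. d x \<oplus> d' x) \<in> twist_sum R e ` ?L"
      using l(1) l'(1) by auto
  next
    fix d b assume "d \<in> twist_sum R e ` ?L" and b: "b \<in> carrier R"
    then obtain l where l: "l \<in> ?L" "d = twist_sum R e l" by blast
    let ?l = "map (\<lambda>(b', c). (b \<otimes> b', c)) l"
    have "twist_sum R e ?l x = d (x \<otimes> b)" if x: "x \<in> carrier R" for x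
      unfolding l(2) using l(1)
      by induction (use b x in \<open>auto simp: twist_sum_Nil twist_sum_Cons m_assoc\<close>)
    then have "(\<lambda>x\<in>carrier R. d (x \<otimes> b)) = twist_sum R e ?l"
      by (subst ext) (auto intro!: restrict_ext)
    moreover have "?l \<in> ?L" using l(1) b by (induction l) auto
    ultimately show "(\<lambda>x\<in>carrier R. d (x \<otimes> b)) \<in> twist_sum R e ` ?L" by blast
  next
    fix d b assume "d \<in> twist_sum R e ` ?L" and b: "b \<in> carrier R"
    then obtain l where l: "l \<in> ?L" "d = twist_sum R e l" by blast
    let ?l = "map (\<lambda>(b', c). (b', c \<otimes> b)) l"
    have "twist_sum R e ?l x = d x \<otimes> b" if x: "x \<in> carrier R" for x
      unfolding l(2) using l(1)
    proof induction
      case (Cons bc l)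
      then show ?case
        using b x closed[of l x] by (auto simp: twist_sum_Cons m_assoc e l_distr)
    qed (use b x in \<open>simp add: twist_sum_Nil\<close>)
    then have "(\<lambda>x\<in>carrier R. d x \<otimes> b) = twist_sum R e ?l"
      by (subst ext) (auto intro!: restrict_ext)
    moreover have "?l \<in> ?L" using l(1) b by (induction l) auto
    ultimately show "(\<lambda>x\<in>carrier R. d x \<otimes> b) \<in> twist_sum R e ` ?L" by blast
  qed
qed

end

text \<open>
The commutator \<open>\<delta> b = b \<cdot> e - e \<cdot> b\<close> is a derivation of \<open>B\<close> with values in the bimodule generated by
\<open>e\<close>. Hence \<open>b \<mapsto> (b, \<delta> b)\<close> and \<open>b \<mapsto> (b, 0)\<close> are ring homomorphisms to the trivial extension. They
agree on the image of \<open>f\<close> when \<open>e\<close> is \<open>A\<close>-linear, so they are equal and \<open>\<delta> = 0\<close>. The epimorphism is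
tested only against rings over \<open>'u\<close>, which is why the generated bimodule takes the place of the
bimodule of all additive maps.
\<close>

lemma ring_epimorphism_full:
  fixes A :: "('a, 'm) ring_scheme" and B :: "('b, 'n) ring_scheme"
  assumes U: "infinite (UNIV :: 'u set)" and B: "carrier B \<lesssim> (UNIV :: 'u set)"
    and f: "ring_epimorphism TYPE('u) A B f"
    and e: "\<And>x. x \<in> carrier B \<Longrightarrow> e x \<in> carrier B"
    and e_add: "\<And>x y. x \<in> carrier B \<Longrightarrow> y \<in> carrier B \<Longrightarrow> e (x \<oplus>\<^bsub>B\<^esub> y) = e x \<oplus>\<^bsub>B\<^esub> e y"
    and e_lin: "\<And>x a. x \<in> carrier B \<Longrightarrow> a \<in> carrier A \<Longrightarrow> e (x \<otimes>\<^bsub>B\<^esub> f a) = e x \<otimes>\<^bsub>B\<^esub> f a"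
    and xb: "x \<in> carrier B" "b \<in> carrier B"
  shows "e (x \<otimes>\<^bsub>B\<^esub> b) = e x \<otimes>\<^bsub>B\<^esub> b"
proof -
  interpret B: ring B using f by (simp add: ring_epimorphism_def)
  have fc: "f a \<in> carrier B" if "a \<in> carrier A" for a
    using f that by (auto simp: ring_epimorphism_def ring_hom_closed)
  let ?L = "lists (carrier B \<times> carrier B)"
  define S where "S = twist_sum B e ` ?L"
  interpret additive_bimodule B S
    unfolding S_def by (rule B.additive_bimodule_twist_sum) (auto simp: e e_add)
  define C where "C = trivial_extension B S"
  interpret C: ring C unfolding C_def by (rule ring_trivial_extension)
  have "carrier C \<lesssim> (UNIV :: 'u set)"
  proof -
    have "S \<lesssim> ?L" unfolding S_def by (rule image_lepoll)
    also have "?L \<lesssim> (UNIV :: 'u set)" using U B by (intro lepoll_lists_UNIV lepoll_times)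
    finally show ?thesis using U B by (simp add: C_def trivial_extension_def lepoll_times)
  qed
  then obtain j :: "'b \<times> ('b \<Rightarrow> 'b) \<Rightarrow> 'u" where j: "inj_on j (carrier C)"
    by (auto simp: lepoll_def)
  define C' where "C' = image_ring j C"
  have C': "ring C'" unfolding C'_def by (rule C.inj_imp_image_ring_is_ring[OF j])
  have jhom: "j \<in> ring_hom C C'"
    using inj_imp_image_ring_iso[OF j] by (auto simp: C'_def ring_iso_def)
  \<comment> \<open>the commutator of \<open>e\<close> with \<open>b\<close>, and below its expression as a \<^const>\<open>twist_sum\<close>\<close>
  let ?d = "\<lambda>b. \<lambda>x\<in>carrier B. e (x \<otimes>\<^bsub>B\<^esub> b) \<oplus>\<^bsub>B\<^esub> e x \<otimes>\<^bsub>B\<^esub> (\<ominus>\<^bsub>B\<^esub> b)"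
  let ?g = "\<lambda>b. (b, ?d b)" and ?h = "\<lambda>b. (b, \<lambda>x\<in>carrier B. \<zero>\<^bsub>B\<^esub>)"
  have dS: "?d b \<in> S" if b: "b \<in> carrier B" for b
  proof -
    have "?d b = twist_sum B e [(b, \<one>\<^bsub>B\<^esub>), (\<one>\<^bsub>B\<^esub>, \<ominus>\<^bsub>B\<^esub> b)]"
      using b by (auto simp: twist_sum_def e intro!: restrict_ext)
    then show ?thesis using b by (auto simp: S_def)
  qed
  have h: "?h \<in> ring_hom B C"
    by (rule ring_hom_memI) (auto simp: C_def trivial_extension_def S_zero intro!: restrict_ext)
  have g: "?g \<in> ring_hom B C"
  proof (rule ring_hom_memI)
    fix b c assume bc: "b \<in> carrier B" "c \<in> carrier B"
    have "?d (b \<otimes>\<^bsub>B\<^esub> c) x = ?d c (x \<otimes>\<^bsub>B\<^esub> b) \<oplus>\<^bsub>B\<^esub> ?d b x \<otimes>\<^bsub>B\<^esub> c" if x: "x \<in> carrier B" for x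
      using bc x
      by (simp add: B.l_distr B.m_assoc e B.r_minus B.l_minus B.a_assoc) (simp add: e B.m_assoc[symmetric] B.r_neg1)
    then show "?g (b \<otimes>\<^bsub>B\<^esub> c) = ?g b \<otimes>\<^bsub>C\<^esub> ?g c"
      by (auto simp: C_def trivial_extension_def intro!: restrict_ext)
    have "?d (b \<oplus>\<^bsub>B\<^esub> c) x = ?d b x \<oplus>\<^bsub>B\<^esub> ?d c x" if x: "x \<in> carrier B" for x
      using bc x by (simp add: B.r_distr e e_add B.minus_add B.a_ac)
    then show "?g (b \<oplus>\<^bsub>B\<^esub> c) = ?g b \<oplus>\<^bsub>C\<^esub> ?g c"
      by (auto simp: C_def trivial_extension_def intro!: restrict_ext)
  next
    show "?g \<one>\<^bsub>B\<^esub> = \<one>\<^bsub>C\<^esub>"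
      by (auto simp: C_def trivial_extension_def e B.r_minus B.r_neg intro!: restrict_ext)
  qed (auto simp: C_def trivial_extension_def dS)
  have comp: "(\<lambda>b. j (k b)) \<in> ring_hom B C'" if "k \<in> ring_hom B C" for k
    using ring_hom_trans[OF that jhom] by (simp add: comp_def)
  have gf: "?g (f a) = ?h (f a)" if "a \<in> carrier A" for a
    using that by (auto simp: e_lin e fc B.r_minus B.r_neg intro!: restrict_ext)
  have epi: "g b = h b" if "ring D" "g \<in> ring_hom B D" "h \<in> ring_hom B D"
    "\<forall>a\<in>carrier A. g (f a) = h (f a)" for g h and D :: "'u ring"
    using f that xb(2) unfolding ring_epimorphism_def by blast
  have "j (?g b) = j (?h b)"
    using gf by (intro epi[OF C' comp[OF g] comp[OF h]] ballI arg_cong[where f = j])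
  then have "?g b = ?h b"
    by (rule inj_onD[OF j]) (rule ring_hom_closed[OF g xb(2)] ring_hom_closed[OF h xb(2)])+
  then have "?d b = (\<lambda>x\<in>carrier B. \<zero>\<^bsub>B\<^esub>)" by (simp only: prod.inject)
  from fun_cong[OF this, of x] have "e (x \<otimes>\<^bsub>B\<^esub> b) \<oplus>\<^bsub>B\<^esub> e x \<otimes>\<^bsub>B\<^esub> (\<ominus>\<^bsub>B\<^esub> b) = \<zero>\<^bsub>B\<^esub>"
    using xb by simp
  then have "e (x \<otimes>\<^bsub>B\<^esub> b) \<ominus>\<^bsub>B\<^esub> e x \<otimes>\<^bsub>B\<^esub> b = \<zero>\<^bsub>B\<^esub>"
    using xb by (simp add: a_minus_def B.r_minus e)
  then show ?thesis
    using xb e by (simp add: B.minus_eq_zero_iff)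
qed

section \<open>The torsion class and the trace\<close>

text \<open>
The condition defining \<^const>\<open>D_class\<close>, in terms of \<^const>\<open>linear_map\<close>.
\<close>

definition extends_along ::
    "('a, 'm) ring_scheme \<Rightarrow> ('a, 'p) module \<Rightarrow> ('a, 'q) module \<Rightarrow> ('p \<Rightarrow> 'q) \<Rightarrow> ('a, 'x) module \<Rightarrow> bool"
  where
  "extends_along A P Q \<sigma> X \<longleftrightarrow> (\<forall>h. linear_map A P X h \<longrightarrow>
     (\<exists>k. linear_map A Q X k \<and> (\<forall>x\<in>carrier P. k (\<sigma> x) = h x)))"

lemma extends_alongE:
  assumes "extends_along A P Q \<sigma> X" "linear_map A P X h"
  obtains k where "linear_map A Q X k" "\<And>x. x \<in> carrier P \<Longrightarrow> k (\<sigma> x) = h x"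
  using assms unfolding extends_along_def by blast

lemma mem_D_class_iff:
  assumes P: "right_module A P" and Q: "right_module A Q" and \<sigma>: "linear_map A P Q \<sigma>"
  shows "X \<in> D_class A P Q \<sigma> \<longleftrightarrow> right_module A X \<and> extends_along A P Q \<sigma> X"
proof -
  have "(\<lambda>h. compose (carrier P) h \<sigma>) ` mod_hom A Q X = mod_hom A P X \<longleftrightarrow> extends_along A P Q \<sigma> X"
  proof
    assume eq: "(\<lambda>h. compose (carrier P) h \<sigma>) ` mod_hom A Q X = mod_hom A P X"
    show "extends_along A P Q \<sigma> X"
      unfolding extends_along_def
    proof (intro allI impI)
      fix h assume "linear_map A P X h"
      then have "restrict h (carrier P) \<in> (\<lambda>h. compose (carrier P) h \<sigma>) ` mod_hom A Q X"
        using eq restrict_in_mod_hom[OF P] by blast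
      then obtain k where k: "k \<in> mod_hom A Q X" "restrict h (carrier P) = compose (carrier P) k \<sigma>"
        by blast
      have "k (\<sigma> x) = h x" if "x \<in> carrier P" for x
        using fun_cong[OF k(2), of x] that by (simp add: compose_def)
      then show "\<exists>k. linear_map A Q X k \<and> (\<forall>x\<in>carrier P. k (\<sigma> x) = h x)"
        using k(1) by (auto simp: mod_hom_iff)
    qed
  next
    assume ext: "extends_along A P Q \<sigma> X"
    show "(\<lambda>h. compose (carrier P) h \<sigma>) ` mod_hom A Q X = mod_hom A P X"
    proof (intro equalityI subsetI)
      fix h assume "h \<in> (\<lambda>h. compose (carrier P) h \<sigma>) ` mod_hom A Q X"
      then obtain k where "k \<in> mod_hom A Q X" "h = compose (carrier P) k \<sigma>" by blast
      then show "h \<in> mod_hom A P X"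
        unfolding compose_def
        using restrict_in_mod_hom[OF P linear_map_comp[OF \<sigma>, of X k]] by (simp add: mod_hom_iff)
    next
      fix h assume h: "h \<in> mod_hom A P X"
      then obtain k where k: "linear_map A Q X k" "\<And>x. x \<in> carrier P \<Longrightarrow> k (\<sigma> x) = h x"
        using extends_alongE[OF ext] by (metis mod_hom_iff)
      have "h = compose (carrier P) (restrict k (carrier Q)) \<sigma>"
        using h k linear_map_closed[OF \<sigma>]
        by (auto simp: mod_hom_iff compose_def fun_eq_iff extensional_def)
      then show "h \<in> (\<lambda>h. compose (carrier P) h \<sigma>) ` mod_hom A Q X"
        using restrict_in_mod_hom[OF Q k(1)] by blast
    qed
  qed
  then show ?thesis by (simp add: D_class_def Mod_class_def)
qed

lemma extends_along_iso:
  assumes X: "right_module A X" and i: "linear_map A X Y i" "bij_betw i (carrier X) (carrier Y)"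
    and ext: "extends_along A P Q \<sigma> X"
  shows "extends_along A P Q \<sigma> Y"
  unfolding extends_along_def
proof (intro allI impI)
  fix h assume h: "linear_map A P Y h"
  note i' = linear_map_inv_into[OF X i]
  obtain k where k: "linear_map A Q X k"
    "\<And>x. x \<in> carrier P \<Longrightarrow> k (\<sigma> x) = inv_into (carrier X) i (h x)"
    using extends_alongE[OF ext linear_map_comp[OF h i']] by blast
  have "i (k (\<sigma> x)) = h x" if "x \<in> carrier P" for x
    using k(2)[OF that] i(2) linear_map_closed[OF h that]
    by (simp add: bij_betw_inv_into_right)
  then show "\<exists>k. linear_map A Q Y k \<and> (\<forall>x\<in>carrier P. k (\<sigma> x) = h x)"
    using linear_map_comp[OF k(1) i(1)] by blast
qed

lemma extends_along_direct_sum: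
  assumes "extends_along A P Q \<sigma> X" "extends_along A P Q \<sigma> Y"
  shows "extends_along A P Q \<sigma> (direct_sum X Y)"
  unfolding extends_along_def
proof (intro allI impI)
  fix h assume h: "linear_map A P (direct_sum X Y) h"
  obtain k where k: "linear_map A Q X k" "\<And>x. x \<in> carrier P \<Longrightarrow> k (\<sigma> x) = fst (h x)"
    using extends_alongE[OF assms(1) linear_map_comp[OF h linear_map_fst]] by blast
  obtain l where l: "linear_map A Q Y l" "\<And>x. x \<in> carrier P \<Longrightarrow> l (\<sigma> x) = snd (h x)"
    using extends_alongE[OF assms(2) linear_map_comp[OF h linear_map_snd]] by blast
  show "\<exists>k. linear_map A Q (direct_sum X Y) k \<and> (\<forall>x\<in>carrier P. k (\<sigma> x) = h x)"
    using linear_map_Pair[OF k(1) l(1)] k(2) l(2) by (intro exI[of _ "\<lambda>x. (k x, l x)"]) auto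
qed

lemma projective_lift:
  assumes P: "projective TYPE('u) A P"
    and N: "right_module A N" "carrier N \<lesssim> (UNIV :: 'u set)"
    and N': "right_module A N'" "carrier N' \<lesssim> (UNIV :: 'u set)"
    and g: "linear_map A N N' g" "g ` carrier N = carrier N'" and h: "linear_map A P N' h"
  obtains k where "linear_map A P N k" "\<And>x. x \<in> carrier P \<Longrightarrow> g (k x) = h x"
proof -
  have PM: "right_module A P" using P by (simp add: projective_def)
  obtain M :: "('a, 'u) module" and i where M: "right_module A M" and
    i: "linear_map A N M i" "bij_betw i (carrier N) (carrier M)"
    using small_copy[OF N] by blast
  obtain M' :: "('a, 'u) module" and i' where M': "right_module A M'" and
    i': "linear_map A N' M' i'" "bij_betw i' (carrier N') (carrier M')"
    using small_copy[OF N'] by blast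
  let ?j = "inv_into (carrier N) i"
  have j: "linear_map A M N ?j" by (rule linear_map_inv_into[OF N(1) i])
  have jim: "?j ` carrier M = carrier N"
    using bij_betw_inv_into[OF i(2)] by (simp add: bij_betw_def)
  let ?g = "restrict (\<lambda>x. i' (g (?j x))) (carrier M)" and ?h = "restrict (\<lambda>x. i' (h x)) (carrier P)"
  have g': "?g \<in> mod_hom A M M'"
    by (intro restrict_in_mod_hom[OF M] linear_map_comp[OF linear_map_comp[OF j g(1)] i'(1)])
  have "?g ` carrier M = i' ` g ` ?j ` carrier M" by (simp add: image_image)
  then have "?g ` carrier M = carrier M'"
    using i'(2) by (simp add: jim g(2) bij_betw_def)
  moreover have h': "?h \<in> mod_hom A P M'"
    by (intro restrict_in_mod_hom[OF PM] linear_map_comp[OF h i'(1)])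
  ultimately obtain k where k: "k \<in> mod_hom A P M" "compose (carrier P) ?g k = ?h"
    using P M M' g' unfolding projective_def Mod_class_def mem_Collect_eq by blast
  have k': "linear_map A P M k" using k(1) by (simp add: mod_hom_iff)
  have "g (?j (k x)) = h x" if x: "x \<in> carrier P" for x
  proof -
    have "i' (g (?j (k x))) = i' (h x)"
      using fun_cong[OF k(2), of x] x linear_map_closed[OF k' x] by (simp add: compose_def)
    then show ?thesis
      using i'(2) linear_map_closed[OF h x] linear_map_closed[OF g(1)]
        linear_map_closed[OF j linear_map_closed[OF k' x]]
      by (auto simp: bij_betw_def dest: inj_onD)
  qed
  then show ?thesis using that linear_map_comp[OF k' j] by blast
qed

definition hom_vanishes ::
    "('a, 'm) ring_scheme \<Rightarrow> ('a, 't) module \<Rightarrow> ('a, 'x) module \<Rightarrow> bool" where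
  "hom_vanishes A T X \<longleftrightarrow> (\<forall>u. linear_map A T X u \<longrightarrow> (\<forall>t\<in>carrier T. u t = \<zero>\<^bsub>X\<^esub>))"

lemma hom_vanishesD: "hom_vanishes A T X \<Longrightarrow> linear_map A T X u \<Longrightarrow> t \<in> carrier T \<Longrightarrow> u t = \<zero>\<^bsub>X\<^esub>"
  by (simp add: hom_vanishes_def)

lemma mod_hom_eq_zero_iff:
  assumes M: "right_module A M" and N: "right_module A N"
  shows "mod_hom A M N = {\<lambda>x\<in>carrier M. \<zero>\<^bsub>N\<^esub>} \<longleftrightarrow> hom_vanishes A M N"
  unfolding hom_vanishes_def
proof (intro iffI allI impI ballI)
  fix u x assume eq: "mod_hom A M N = {\<lambda>x\<in>carrier M. \<zero>\<^bsub>N\<^esub>}" and u: "linear_map A M N u"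
    and x: "x \<in> carrier M"
  have "restrict u (carrier M) \<in> mod_hom A M N" by (rule restrict_in_mod_hom[OF M u])
  then have "restrict u (carrier M) = (\<lambda>x\<in>carrier M. \<zero>\<^bsub>N\<^esub>)" using eq by simp
  from fun_cong[OF this, of x] show "u x = \<zero>\<^bsub>N\<^esub>" using x by simp
next
  assume zero: "\<forall>u. linear_map A M N u \<longrightarrow> (\<forall>x\<in>carrier M. u x = \<zero>\<^bsub>N\<^esub>)"
  have "g = (\<lambda>x\<in>carrier M. \<zero>\<^bsub>N\<^esub>)" if "g \<in> mod_hom A M N" for g
    using that zero by (auto simp: mod_hom_iff extensional_def fun_eq_iff)
  moreover have "(\<lambda>x\<in>carrier M. \<zero>\<^bsub>N\<^esub>) \<in> mod_hom A M N"
    by (rule restrict_in_mod_hom[OF M linear_map_const_zero[OF N]])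
  ultimately show "mod_hom A M N = {\<lambda>x\<in>carrier M. \<zero>\<^bsub>N\<^esub>}" by blast
qed

text \<open>
The submodule of \<open>X\<close> generated by the images of all maps \<open>T \<rightarrow> X\<close>. Closure under scalars comes for
free, since each image is a submodule.
\<close>

inductive_set trace ::
    "('a, 'm) ring_scheme \<Rightarrow> ('a, 't) module \<Rightarrow> ('a, 'x) module \<Rightarrow> 'x set"
  for A :: "('a, 'm) ring_scheme" and T :: "('a, 't) module" and X :: "('a, 'x) module" where
    zero: "\<zero>\<^bsub>X\<^esub> \<in> trace A T X"
  | add: "linear_map A T X u \<Longrightarrow> t \<in> carrier T \<Longrightarrow> x \<in> trace A T X \<Longrightarrow> u t \<oplus>\<^bsub>X\<^esub> x \<in> trace A T X"

lemma trace_subset: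
  assumes "right_module A X" "x \<in> trace A T X" shows "x \<in> carrier X"
proof -
  interpret right_module A X by fact
  show ?thesis using assms(2) by induction (auto simp: linear_map_closed)
qed

lemma trace_image:
  assumes "right_module A X" "linear_map A T X u" "t \<in> carrier T"
  shows "u t \<in> trace A T X"
proof -
  interpret right_module A X by fact
  show ?thesis
    using trace.add[OF assms(2,3) trace.zero] linear_map_closed[OF assms(2,3)] by simp
qed

lemma trace_add_closed:
  assumes X: "right_module A X" and x: "x \<in> trace A T X" and y: "y \<in> trace A T X"
  shows "x \<oplus>\<^bsub>X\<^esub> y \<in> trace A T X"
proof -
  interpret right_module A X by fact
  note sub = trace_subset[OF X, where T = T]
  from x show ?thesis
  proof induction
    case zero
    then show ?case using y sub by simp
  next
    case (add u t x)
    then show ?case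
      using trace.add[OF add.hyps(1,2) add.IH] sub[OF y] sub[OF add.hyps(3)]
      by (simp add: linear_map_closed M.a_assoc)
  qed
qed

lemma right_submodule_trace:
  assumes T: "right_module A T" and X: "right_module A X"
  shows "right_submodule A X (trace A T X)"
proof -
  interpret T: right_module A T by fact
  interpret X: right_module A X by fact
  have "a \<odot>\<^bsub>X\<^esub> x \<in> trace A T X" if a: "a \<in> carrier A" and x: "x \<in> trace A T X" for a x
    using x
  proof induction
    case zero
    then show ?case by (simp add: X.smult_zero[OF a] trace.zero)
  next
    case (add u t x)
    then show ?case
      using trace.add[OF add.hyps(1), of "a \<odot>\<^bsub>T\<^esub> t", OF _ add.IH] a trace_subset[OF X add.hyps(3)]
      by (simp add: linear_map_smult X.smult_r_distr linear_map_closed)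
  qed
  then show ?thesis
    using trace_subset[OF X] trace_add_closed[OF X] trace.zero by (auto simp: right_submodule_def)
qed

lemma linear_map_trace:
  assumes X: "right_module A X" and Y: "right_module A Y" and h: "linear_map A X Y h"
    and x: "x \<in> trace A T X"
  shows "h x \<in> trace A T Y"
  using x
proof induction
  case zero
  then show ?case by (simp add: linear_map_zero[OF X Y h] trace.zero)
next
  case (add u t x)
  then show ?case
    using trace.add[OF linear_map_comp[OF add.hyps(1) h] add.hyps(2) add.IH]
      trace_subset[OF X add.hyps(3)]
    by (simp add: linear_map_add[OF h] linear_map_closed)
qed

lemma trace_vanishes:
  assumes X: "right_module A X" and Y: "right_module A Y" and h: "linear_map A X Y h"
    and zero: "hom_vanishes A T Y"
    and x: "x \<in> trace A T X"
  shows "h x = \<zero>\<^bsub>Y\<^esub>"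
proof -
  interpret Y: right_module A Y by fact
  have "y = \<zero>\<^bsub>Y\<^esub>" if "y \<in> trace A T Y" for y
    using that by induction (auto simp: hom_vanishesD[OF zero])
  then show ?thesis using linear_map_trace[OF assms(1-3) x] by blast
qed

lemma copower_image_trace:
  assumes T: "right_module A T" and X: "right_module A X"
    and k: "linear_map A (copower J T) X k" and y: "y \<in> carrier (copower J T)"
  shows "k y \<in> trace A T X"
proof (rule copower_induct[OF T y])
  show "k \<zero>\<^bsub>copower J T\<^esub> \<in> trace A T X"
    using linear_map_zero[OF right_module_copower[OF T] X k] trace.zero by metis
next
  fix y y' assume "y \<in> carrier (copower J T)" "y' \<in> carrier (copower J T)"
    "k y \<in> trace A T X" "k y' \<in> trace A T X"
  then show "k (y \<oplus>\<^bsub>copower J T\<^esub> y') \<in> trace A T X"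
    by (simp only: linear_map_add[OF k] trace_add_closed[OF X])
next
  fix j t assume "t \<in> carrier T"
  then show "k (copower_in J T j t) \<in> trace A T X"
    by (rule trace_image[OF X linear_map_comp[OF linear_map_copower_in[OF T] k]])
qed

abbreviation (input) small :: "'u itself \<Rightarrow> 'x set \<Rightarrow> bool" where
  "small U X \<equiv> X \<lesssim> (UNIV :: 'u set)"

text \<open>
A partial silting module with a chosen cokernel map \<open>p\<close> of \<open>\<sigma>\<close>. The last assumption holds because
\<open>T\<^sub>1\<close> lies in the torsion class \<open>D\<^sub>\<sigma>\<close>, which is closed under coproducts.
\<close>

locale silting_setup =
  fixes U :: "'u itself" and A :: "('a, 'm) ring_scheme"
    and P :: "('a, 'p) module" and Q :: "('a, 'q) module" and \<sigma> :: "'p \<Rightarrow> 'q"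
    and T1 :: "('a, 't) module" and p :: "'q \<Rightarrow> 't"
  assumes infinite_U: "infinite (UNIV :: 'u set)"
    and small_A: "carrier A \<lesssim> (UNIV :: 'u set)"
    and small_Q: "carrier Q \<lesssim> (UNIV :: 'u set)"
    and small_I: "mod_hom A P (regular_module A) \<lesssim> (UNIV :: 'u set)"
    and ring_A: "ring A"
    and projective_P: "projective TYPE('u) A P" and projective_Q: "projective TYPE('u) A Q"
    and T1: "right_module A T1"
    and \<sigma>: "linear_map A P Q \<sigma>"
    and p: "linear_map A Q T1 p" and p_surj: "p ` carrier Q = carrier T1"
    and exact: "\<sigma> ` carrier P = {q \<in> carrier Q. p q = \<zero>\<^bsub>T1\<^esub>}"
    and extends_copower: "\<And>J :: 'u set. extends_along A P Q \<sigma> (copower J T1)"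
begin

abbreviation I0 :: "('p \<Rightarrow> 'a) set" where "I0 \<equiv> mod_hom A P (regular_module A)"

sublocale A: ring A by (rule ring_A)
sublocale P: right_module A P using projective_P by (simp add: projective_def)
sublocale Q: right_module A Q using projective_Q by (simp add: projective_def)
sublocale T1: right_module A T1 by (rule T1)

lemma P: "right_module A P" and Q: "right_module A Q"
  by (rule P.right_module_axioms Q.right_module_axioms)+

lemma small_T1: "small U (carrier T1)"
  using image_lepoll[of p "carrier Q"] small_Q lepoll_trans by (auto simp: p_surj)

lemma extends_small_copower:
  assumes "small U J"
  shows "extends_along A P Q \<sigma> (copower J T1)"
proof -
  obtain b :: "_ \<Rightarrow> 'u" where "inj_on b J" using assms by (auto simp: lepoll_def)
  then have b: "bij_betw (inv_into J b) (b ` J) J"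
    by (simp add: bij_betw_inv_into inj_on_imp_bij_betw)
  then have b': "bij_betw b J (b ` J)" using \<open>inj_on b J\<close> by (simp add: bij_betw_def)
  obtain k where k: "linear_map A (copower (b ` J) T1) (copower J T1) k"
    "bij_betw k (carrier (copower (b ` J) T1)) (carrier (copower J T1))"
    by (rule copower_iso[OF T1 T1 linear_map_id bij_betw_id[unfolded id_def] b'])
  show ?thesis
    by (rule extends_along_iso[OF right_module_copower[OF T1] k extends_copower])
qed

lemma extends_T1: "extends_along A P Q \<sigma> T1"
proof -
  have "bij_betw (\<lambda>y. y ()) (carrier (copower {()} T1)) (carrier T1)"
  proof (rule bij_betw_byWitness[where f' = "\<lambda>t _. t"])
    show "(\<lambda>t _. t) ` carrier T1 \<subseteq> carrier (copower {()} T1)" by (auto simp: copower_carrier PiE_def extensional_def)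
  qed (auto simp: copower_carrier fun_eq_iff)
  moreover have "small U {()}" using infinite_U by (simp add: finite_lepoll_infinite)
  ultimately show ?thesis
    using extends_along_iso[OF right_module_copower[OF T1] linear_map_copower_proj]
      extends_small_copower by (metis insertI1)
qed

text \<open>
As \<open>P\<close> is projective, a map from \<open>P\<close> to the quotient lifts to \<open>X\<close>, where it extends along \<open>\<sigma>\<close>.
\<close>

lemma extends_quotient:
  assumes X: "right_module A X" "small U (carrier X)" and Y: "right_module A Y"
    and g: "linear_map A X Y g" "g ` carrier X = carrier Y"
    and ext: "extends_along A P Q \<sigma> X"
  shows "extends_along A P Q \<sigma> Y"
  unfolding extends_along_def
proof (intro allI impI)
  fix h assume h: "linear_map A P Y h"
  have "small U (carrier Y)" using image_lepoll[of g "carrier X"] X(2) lepoll_trans g(2) by auto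
  then obtain l where l: "linear_map A P X l" "\<And>x. x \<in> carrier P \<Longrightarrow> g (l x) = h x"
    using projective_lift[OF projective_P X Y _ g h] by blast
  obtain k where "linear_map A Q X k" "\<And>x. x \<in> carrier P \<Longrightarrow> k (\<sigma> x) = l x"
    using extends_alongE[OF ext l(1)] by blast
  then show "\<exists>k. linear_map A Q Y k \<and> (\<forall>x\<in>carrier P. k (\<sigma> x) = h x)"
    using l(2) by (intro exI[of _ "\<lambda>x. g (k x)"]) (auto intro: linear_map_comp[OF _ g(1)])
qed

lemma factor_through_p:
  assumes X: "right_module A X" and d: "linear_map A Q X d"
    and zero: "\<And>x. x \<in> carrier P \<Longrightarrow> d (\<sigma> x) = \<zero>\<^bsub>X\<^esub>"
  obtains u where "linear_map A T1 X u" "\<And>q. q \<in> carrier Q \<Longrightarrow> u (p q) = d q"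
proof (rule linear_map_factor[OF Q T1 X p p_surj d])
  fix q assume "q \<in> carrier Q" "p q = \<zero>\<^bsub>T1\<^esub>"
  then have "q \<in> \<sigma> ` carrier P" using exact by blast
  then show "d q = \<zero>\<^bsub>X\<^esub>" using zero by blast
qed (use that in blast)

lemma p_\<sigma>: "x \<in> carrier P \<Longrightarrow> p (\<sigma> x) = \<zero>\<^bsub>T1\<^esub>"
  using exact by blast

text \<open>
The trace is a quotient of a coproduct of copies of \<open>T\<^sub>1\<close>. Choosing one map for each element of the
union of the images, instead of taking all maps \<open>T\<^sub>1 \<rightarrow> X\<close>, keeps the index set no larger than \<open>X\<close>.
\<close>

lemma extends_trace:
  assumes X: "right_module A X" "small U (carrier X)"
  shows "extends_along A P Q \<sigma> (X\<lparr>carrier := trace A T1 X\<rparr>)"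
proof -
  define V where "V = {x. \<exists>u. linear_map A T1 X u \<and> x \<in> u ` carrier T1}"
  have "V \<subseteq> carrier X" unfolding V_def using linear_map_closed by fastforce
  then have V: "small U V" using X(2) lepoll_trans subset_imp_lepoll by blast
  have "\<forall>x. \<exists>u. x \<in> V \<longrightarrow> linear_map A T1 X u \<and> x \<in> u ` carrier T1"
    unfolding V_def by blast
  from choice[OF this] obtain e
    where e: "\<And>x. x \<in> V \<Longrightarrow> linear_map A T1 X (e x) \<and> x \<in> e x ` carrier T1"
    by blast
  let ?m = "copower_map V T1 X e"
  have m: "linear_map A (copower V T1) X ?m"
    using e by (intro linear_map_copower_map[OF T1 X(1)]) blast
  have m_in: "?m (copower_in V T1 x t) = e x t" if "x \<in> V" "t \<in> carrier T1" for x t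
    using e that by (intro copower_map_in[OF T1 X(1)]) auto
  have "?m y \<in> trace A T1 X" if "y \<in> carrier (copower V T1)" for y
    by (rule copower_image_trace[OF T1 X(1) m that])
  then have m': "linear_map A (copower V T1) (X\<lparr>carrier := trace A T1 X\<rparr>) ?m"
    by (intro linear_map_submodule m) auto
  have "x \<in> ?m ` carrier (copower V T1)" if "x \<in> trace A T1 X" for x
    using that
  proof induction
    case zero
    then show ?case using right_submodule_image[OF right_module_copower[OF T1] X(1) m]
      by (simp add: right_submodule_def)
  next
    case (add u t x)
    then have "u t \<in> V" unfolding V_def by blast
    then obtain t' where "t' \<in> carrier T1" "u t = e (u t) t'" using e by blast
    then have "u t = ?m (copower_in V T1 (u t) t')" using m_in[OF \<open>u t \<in> V\<close>] by simp
    then have "u t \<in> ?m ` carrier (copower V T1)"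
      using linear_map_closed[OF linear_map_copower_in[OF T1] \<open>t' \<in> carrier T1\<close>] by (rule image_eqI)
    then show ?case
      using add.IH
      by (rule right_submodule_add[OF right_submodule_image[OF right_module_copower[OF T1] X(1) m]])
  qed
  then have surj: "?m ` carrier (copower V T1) = carrier (X\<lparr>carrier := trace A T1 X\<rparr>)"
    using linear_map_closed[OF m'] by auto
  show ?thesis
    by (rule extends_quotient[OF right_module_copower[OF T1] lepoll_copower[OF infinite_U V small_T1]
          right_module_submodule[OF X(1) right_submodule_trace[OF T1 X(1)]] m' surj
          extends_small_copower[OF V]])
qed

text \<open>
Let \<open>S\<close> be the trace. Since \<open>Q\<close> is projective, \<open>u \<circ> p\<close> lifts to \<open>k : Q \<rightarrow> X\<close>, and \<open>k \<circ> \<sigma>\<close> has values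
in \<open>S\<close>. As \<open>S\<close> lies in \<open>D\<^sub>\<sigma>\<close>, there is \<open>l : Q \<rightarrow> S\<close> with \<open>l \<circ> \<sigma> = k \<circ> \<sigma>\<close>. Now \<open>k - l\<close> factors
through \<open>T\<^sub>1\<close>, so it has values in \<open>S\<close>; hence so has \<open>k\<close>, and \<open>u = 0\<close>.
\<close>

lemma hom_T1_trace_quotient:
  assumes X: "right_module A X" "small U (carrier X)"
  shows "hom_vanishes A T1 (quotient_module X (trace A T1 X))"
  unfolding hom_vanishes_def
proof (intro allI impI ballI)
  fix u t
  assume u: "linear_map A T1 (quotient_module X (trace A T1 X)) u" and t: "t \<in> carrier T1"
  interpret X: right_module A X by fact
  let ?S = "trace A T1 X"
  let ?R = "quotient_module X ?S" and ?\<pi> = "\<lambda>x. ?S +>\<^bsub>X\<^esub> x"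
  note S = right_submodule_trace[OF T1 X(1)]
  note \<pi> = quotient_module_proj[OF X(1) S]
  note R = quotient_module_right_module[OF X(1) S]
  note \<pi>_zero = quotient_module_eq_zero[OF X(1) S]
  have SX: "?S \<subseteq> carrier X" using trace_subset[OF X(1)] by blast
  have "small U (carrier ?R)"
    using image_lepoll[of ?\<pi> "carrier X"] X(2) lepoll_trans
    by (auto simp: quotient_module_surj[OF X(1) S])
  then obtain k where k: "linear_map A Q X k" "\<And>q. q \<in> carrier Q \<Longrightarrow> ?\<pi> (k q) = u (p q)"
    using projective_lift[OF projective_Q X R _ \<pi> quotient_module_surj[OF X(1) S]
        linear_map_comp[OF p u]] by blast
  have "k (\<sigma> x) \<in> ?S" if x: "x \<in> carrier P" for x
  proof -
    have "?\<pi> (k (\<sigma> x)) = \<zero>\<^bsub>?R\<^esub>"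
      using k(2)[OF linear_map_closed[OF \<sigma> x]] linear_map_zero[OF T1 R u] by (simp add: p_\<sigma> x)
    then show ?thesis
      using \<pi>_zero linear_map_closed[OF k(1) linear_map_closed[OF \<sigma> x]] by blast
  qed
  then have "linear_map A P (X\<lparr>carrier := ?S\<rparr>) (\<lambda>x. k (\<sigma> x))"
    by (intro linear_map_submodule linear_map_comp[OF \<sigma> k(1)]) auto
  then obtain l where l: "linear_map A Q (X\<lparr>carrier := ?S\<rparr>) l"
    "\<And>x. x \<in> carrier P \<Longrightarrow> l (\<sigma> x) = k (\<sigma> x)"
    using extends_alongE[OF extends_trace[OF X]] by blast
  have l': "linear_map A Q X l" by (rule linear_map_from_submodule[OF l(1) SX])
  have "k (\<sigma> x) \<ominus>\<^bsub>X\<^esub> l (\<sigma> x) = \<zero>\<^bsub>X\<^esub>" if x: "x \<in> carrier P" for x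
    using l(2)[OF x] linear_map_closed[OF k(1) linear_map_closed[OF \<sigma> x]] by (simp add: X.M.minus_eq_zero_iff)
  then obtain v where v: "linear_map A T1 X v"
    "\<And>q. q \<in> carrier Q \<Longrightarrow> v (p q) = k q \<ominus>\<^bsub>X\<^esub> l q"
    using factor_through_p[OF X(1) linear_map_diff[OF X(1) k(1) l']] by blast
  obtain q where q: "q \<in> carrier Q" "t = p q" using t p_surj by blast
  have kl: "k q \<in> carrier X" "l q \<in> carrier X"
    using linear_map_closed[OF k(1) q(1)] linear_map_closed[OF l' q(1)] by auto
  have "k q = v t \<oplus>\<^bsub>X\<^esub> l q"
    using v(2)[OF q(1)] kl q(2) by (simp add: a_minus_def X.M.a_assoc X.M.l_neg)
  moreover have "v t \<in> ?S" by (rule trace_image[OF X(1) v(1) t])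
  moreover have "l q \<in> ?S" using linear_map_closed[OF l(1) q(1)] by simp
  ultimately have "k q \<in> ?S" using trace_add_closed[OF X(1)] by simp
  then show "u t = \<zero>\<^bsub>?R\<^esub>" using \<pi>_zero[OF kl(1)] k(2)[OF q(1)] q(2) by simp
qed

end

section \<open>The approximation of the ring\<close>

type_synonym ('a, 'p, 'q) bongartz = "('a \<times> (('p \<Rightarrow> 'a) \<Rightarrow> 'q)) set"

lemma finsum_regular_module: "finsum (regular_module A) = finsum A"
  by (simp add: finsum_def finprod_def regular_module_def mk_module_def fun_eq_iff)

context silting_setup
begin

abbreviation (input) A\<^sub>A :: "('a, 'a) module" where "A\<^sub>A \<equiv> regular_module A"

abbreviation (input) sum_P where "sum_P \<equiv> copower I0 P"
abbreviation (input) sum_Q where "sum_Q \<equiv> copower I0 Q"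
abbreviation (input) sum_T where "sum_T \<equiv> copower I0 T1"
abbreviation (input) A_Q_sum where "A_Q_sum \<equiv> direct_sum A\<^sub>A (copower I0 Q)"

definition M :: "('a, ('a, 'p, 'q) bongartz) module" where
  "M = bongartz_M A P Q \<sigma>"

definition can :: "(('p \<Rightarrow> 'a) \<Rightarrow> 'p) \<Rightarrow> 'a" where
  "can = copower_map I0 P A\<^sub>A (\<lambda>s. s)"

definition relations :: "('a, 'p, 'q) bongartz" where
  "relations = (\<lambda>z. (can z, \<ominus>\<^bsub>sum_Q\<^esub> (\<lambda>s\<in>I0. \<sigma> (z s)))) ` carrier sum_P"

abbreviation (input) coset where "coset z \<equiv> relations +>\<^bsub>A_Q_sum\<^esub> z"

definition \<phi> :: "'a \<Rightarrow> ('a, 'p, 'q) bongartz" where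
  "\<phi> a = coset (a, \<zero>\<^bsub>sum_Q\<^esub>)"

definition summand :: "('p \<Rightarrow> 'a) \<Rightarrow> 'q \<Rightarrow> ('a, 'p, 'q) bongartz" where
  "summand s q = coset (\<zero>\<^bsub>A\<^esub>, copower_in I0 Q s q)"

lemma A_A: "right_module A A\<^sub>A"
  by (rule right_module_regular[OF ring_A])

lemma copower_Q: "right_module A sum_Q" and copower_P: "right_module A sum_P"
  by (intro right_module_copower P Q)+

lemma A_Q: "right_module A A_Q_sum"
  by (intro right_module_direct_sum A_A copower_Q)

lemma I0_linear: "s \<in> I0 \<Longrightarrow> linear_map A P A\<^sub>A s"
  by (simp add: mod_hom_iff)

lemma can: "linear_map A sum_P A\<^sub>A can"
  unfolding can_def by (rule linear_map_copower_map[OF P A_A I0_linear])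

lemma can_in: "s \<in> I0 \<Longrightarrow> x \<in> carrier P \<Longrightarrow> can (copower_in I0 P s x) = s x"
  unfolding can_def by (rule copower_map_in[OF P A_A I0_linear])

lemma map_\<sigma>: "linear_map A sum_P sum_Q (\<lambda>z. \<lambda>s\<in>I0. \<sigma> (z s))"
  by (rule linear_map_copower_functor[OF P Q \<sigma> bij_betw_id[unfolded id_def]])

lemma map_\<sigma>_in:
  "s \<in> I0 \<Longrightarrow> x \<in> carrier P \<Longrightarrow> (\<lambda>r\<in>I0. \<sigma> (copower_in I0 P s x r)) = copower_in I0 Q s (\<sigma> x)"
  unfolding copower_in_def using linear_map_zero[OF P Q \<sigma>] by (intro restrict_ext) auto

lemma relations: "right_submodule A A_Q_sum relations"
  unfolding relations_def
  by (intro right_submodule_image[OF copower_P A_Q] linear_map_Pair can linear_map_uminus[OF copower_Q map_\<sigma>])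

lemma M_eq: "M = quotient_module A_Q_sum relations"
  by (simp add: M_def bongartz_M_def pushout_def Let_def relations_def can_def copower_map_def
      finsum_regular_module)

lemma M: "right_module A M"
  unfolding M_eq by (rule quotient_module_right_module[OF A_Q relations])

lemma M_proj: "linear_map A A_Q_sum M (\<lambda>z. coset z)"
  unfolding M_eq by (rule quotient_module_proj[OF A_Q relations])

lemma small_M: "small U (carrier M)"
proof -
  have "small U (carrier A_Q_sum)"
    using lepoll_times[OF infinite_U small_A lepoll_copower[OF infinite_U small_I small_Q]] by simp
  then show ?thesis
    unfolding M_eq quotient_module_surj[OF A_Q relations, symmetric]
    using image_lepoll lepoll_trans by blast
qed

lemma \<phi>: "linear_map A A\<^sub>A M \<phi>"
  unfolding \<phi>_def
  by (intro linear_map_comp[OF _ M_proj] linear_map_Pair linear_map_id linear_map_const_zero copower_Q)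

lemma summand: "linear_map A Q M (summand s)"
  unfolding summand_def
  using linear_map_const_zero[OF A_A, of Q]
  by (intro linear_map_comp[OF _ M_proj] linear_map_Pair linear_map_copower_in Q) simp

lemma summand_\<sigma>:
  assumes s: "s \<in> I0" and x: "x \<in> carrier P"
  shows "summand s (\<sigma> x) = \<phi> (s x)"
proof -
  interpret V: right_module A sum_Q by (rule copower_Q)
  interpret M: right_module A M by (rule M)
  let ?v = "copower_in I0 Q s (\<sigma> x)"
  have v: "?v \<in> carrier sum_Q"
    using linear_map_closed[OF linear_map_copower_in[OF Q] linear_map_closed[OF \<sigma> x]] .
  have sx: "s x \<in> carrier A" using linear_map_closed[OF I0_linear[OF s] x] by simp
  have "(can (copower_in I0 P s x), \<ominus>\<^bsub>sum_Q\<^esub> (\<lambda>r\<in>I0. \<sigma> (copower_in I0 P s x r))) \<in> relations"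
    unfolding relations_def
    using linear_map_closed[OF linear_map_copower_in[OF P] x] by (rule imageI)
  then have rel: "(s x, \<ominus>\<^bsub>sum_Q\<^esub> ?v) \<in> relations"
    using s x by (simp only: can_in map_\<sigma>_in)
  then have "coset (s x, \<ominus>\<^bsub>sum_Q\<^esub> ?v) = \<zero>\<^bsub>M\<^esub>"
    unfolding M_eq using quotient_module_eq_zero[OF A_Q relations] sx v
    by (metis V.M.a_inv_closed SigmaI direct_sum_simps(1) regular_module_simps(1))
  moreover have "coset (s x, \<ominus>\<^bsub>sum_Q\<^esub> ?v) \<oplus>\<^bsub>M\<^esub> summand s (\<sigma> x) =
      coset ((s x, \<ominus>\<^bsub>sum_Q\<^esub> ?v) \<oplus>\<^bsub>A_Q_sum\<^esub> (\<zero>\<^bsub>A\<^esub>, ?v))"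
    unfolding summand_def using sx v by (subst linear_map_add[OF M_proj]) (auto simp del: copower_simps)
  moreover have "(s x, \<ominus>\<^bsub>sum_Q\<^esub> ?v) \<oplus>\<^bsub>A_Q_sum\<^esub> (\<zero>\<^bsub>A\<^esub>, ?v) =
      (s x, \<zero>\<^bsub>sum_Q\<^esub>)"
    using sx v V.M.l_neg[OF v] by (simp del: copower_simps)
  moreover have "summand s (\<sigma> x) \<in> carrier M" by (rule linear_map_closed[OF summand linear_map_closed[OF \<sigma> x]])
  ultimately show ?thesis by (simp add: \<phi>_def del: copower_simps)
qed

lemma M_cases:
  assumes "m \<in> carrier M"
  obtains a y where "a \<in> carrier A" "y \<in> carrier sum_Q"
    "m = \<phi> a \<oplus>\<^bsub>M\<^esub> coset (\<zero>\<^bsub>A\<^esub>, y)"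
proof -
  interpret V: right_module A sum_Q by (rule copower_Q)
  obtain z where "z \<in> carrier A_Q_sum" "m = coset z"
    using assms quotient_module_surj[OF A_Q relations] unfolding M_eq by blast
  then obtain a y where ay: "a \<in> carrier A" "y \<in> carrier sum_Q" "m = coset (a, y)"
    by (cases z) (auto simp del: copower_simps)
  have "(a, y) = (a, \<zero>\<^bsub>sum_Q\<^esub>) \<oplus>\<^bsub>A_Q_sum\<^esub> (\<zero>\<^bsub>A\<^esub>, y)"
    using ay by (simp del: copower_simps)
  then have "m = \<phi> a \<oplus>\<^bsub>M\<^esub> coset (\<zero>\<^bsub>A\<^esub>, y)"
    unfolding \<phi>_def ay(3) using ay(1,2)
    by (subst linear_map_add[OF M_proj, symmetric]) (auto simp del: copower_simps)
  then show ?thesis using that ay by blast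
qed

lemma linear_map_incl_Q: "linear_map A sum_Q M (\<lambda>y. coset (\<zero>\<^bsub>A\<^esub>, y))"
  using linear_map_const_zero[OF A_A, of sum_Q]
  by (intro linear_map_comp[OF _ M_proj] linear_map_Pair linear_map_id) simp

text \<open>
The universal property of the pushout, with the map out of \<open>Q\<^sup>(\<^sup>I\<^sup>0\<^sup>)\<close> given by its components \<open>d s\<close>.
\<close>

lemma M_universal:
  assumes X: "right_module A X" and g: "linear_map A A\<^sub>A X g"
    and d: "\<And>s. s \<in> I0 \<Longrightarrow> linear_map A Q X (d s)"
    and d_\<sigma>: "\<And>s x. s \<in> I0 \<Longrightarrow> x \<in> carrier P \<Longrightarrow> d s (\<sigma> x) = g (s x)"
  obtains h where "linear_map A M X h" "\<And>a. a \<in> carrier A \<Longrightarrow> h (\<phi> a) = g a"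
    "\<And>s q. s \<in> I0 \<Longrightarrow> q \<in> carrier Q \<Longrightarrow> h (summand s q) = d s q"
proof -
  interpret V: right_module A sum_Q by (rule copower_Q)
  interpret X: right_module A X by fact
  let ?\<epsilon> = "copower_map I0 Q X d"
  have \<epsilon>: "linear_map A sum_Q X ?\<epsilon>" by (rule linear_map_copower_map[OF Q X d])
  let ?e = "\<lambda>z. g (fst z) \<oplus>\<^bsub>X\<^esub> ?\<epsilon> (snd z)"
  have e: "linear_map A A_Q_sum X ?e"
    by (intro linear_map_plus[OF X] linear_map_comp[OF linear_map_fst g] linear_map_comp[OF linear_map_snd \<epsilon>])
  have g_can: "g (can z) = ?\<epsilon> (\<lambda>s\<in>I0. \<sigma> (z s))" if z: "z \<in> carrier sum_P" for z
  proof (rule linear_map_copower_eqI[OF P X linear_map_comp[OF can g] linear_map_comp[OF map_\<sigma> \<epsilon>] _ z])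
    fix s x assume "s \<in> I0" "x \<in> carrier P"
    then show "g (can (copower_in I0 P s x)) = ?\<epsilon> (\<lambda>r\<in>I0. \<sigma> (copower_in I0 P s x r))"
      using copower_map_in[OF Q X, of I0 d s "\<sigma> x"] d linear_map_closed[OF \<sigma>]
      by (simp only: can_in map_\<sigma>_in d_\<sigma>)
  qed
  have "?e z = \<zero>\<^bsub>X\<^esub>" if rel: "z \<in> relations" for z
  proof -
    obtain w where w: "w \<in> carrier sum_P"
      "z = (can w, \<ominus>\<^bsub>sum_Q\<^esub> (\<lambda>s\<in>I0. \<sigma> (w s)))"
      using rel unfolding relations_def by blast
    show ?thesis
      using linear_map_minus[OF copower_Q X \<epsilon> linear_map_closed[OF map_\<sigma> w(1)]]
        linear_map_closed[OF linear_map_comp[OF map_\<sigma> \<epsilon>] w(1)] g_can[OF w(1)] X.M.r_neg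
      by (simp only: w(2) fst_conv snd_conv)
  qed
  then obtain h where h: "linear_map A M X h"
    "\<And>z. z \<in> carrier A_Q_sum \<Longrightarrow> h (coset z) = ?e z"
    unfolding M_eq
    using linear_map_factor[OF A_Q quotient_module_right_module[OF A_Q relations] X
        quotient_module_proj[OF A_Q relations] quotient_module_surj[OF A_Q relations] e]
      quotient_module_eq_zero[OF A_Q relations] by metis
  have "h (\<phi> a) = g a" if a: "a \<in> carrier A" for a
    using h(2)[of "(a, \<zero>\<^bsub>sum_Q\<^esub>)"] a linear_map_zero[OF copower_Q X \<epsilon>] linear_map_closed[OF g]
    by (simp add: \<phi>_def del: copower_simps)
  moreover have "h (summand s q) = d s q" if sq: "s \<in> I0" "q \<in> carrier Q" for s q
  proof -
    have "copower_in I0 Q s q \<in> carrier sum_Q"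
      by (rule linear_map_closed[OF linear_map_copower_in[OF Q] sq(2)])
    moreover have "?\<epsilon> (copower_in I0 Q s q) = d s q"
      by (rule copower_map_in[OF Q X d sq])
    ultimately show ?thesis
      using h(2)[of "(\<zero>\<^bsub>A\<^esub>, copower_in I0 Q s q)"] linear_map_zero[OF A_A X g]
        linear_map_closed[OF d[OF sq(1)] sq(2)]
      by (simp add: summand_def del: copower_simps)
  qed
  ultimately show ?thesis using that h(1) by blast
qed

text \<open>
The cokernel of \<open>\<phi>\<close>, obtained from the universal property of \<open>M\<close>.
\<close>

definition \<kappa> :: "('a, 'p, 'q) bongartz \<Rightarrow> ('p \<Rightarrow> 'a) \<Rightarrow> 't" where
  "\<kappa> = (SOME \<kappa>. linear_map A M sum_T \<kappa> \<and>
     (\<forall>a\<in>carrier A. \<kappa> (\<phi> a) = \<zero>\<^bsub>sum_T\<^esub>) \<and>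
     (\<forall>s\<in>I0. \<forall>q\<in>carrier Q. \<kappa> (summand s q) = copower_in I0 T1 s (p q)))"

lemma C: "right_module A sum_T"
  by (rule right_module_copower[OF T1])

lemma \<kappa>_spec: "linear_map A M sum_T \<kappa> \<and>
     (\<forall>a\<in>carrier A. \<kappa> (\<phi> a) = \<zero>\<^bsub>sum_T\<^esub>) \<and>
     (\<forall>s\<in>I0. \<forall>q\<in>carrier Q. \<kappa> (summand s q) = copower_in I0 T1 s (p q))"
proof -
  have in_p: "linear_map A Q sum_T (\<lambda>q. copower_in I0 T1 s (p q))" for s
    by (intro linear_map_comp[OF p] linear_map_copower_in[OF T1])
  have in_p_\<sigma>: "copower_in I0 T1 s (p (\<sigma> x)) = \<zero>\<^bsub>sum_T\<^esub>"
    if "x \<in> carrier P" for s x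
    using linear_map_zero[OF T1 C linear_map_copower_in[OF T1]] by (simp only: p_\<sigma>[OF that])
  have "\<exists>\<kappa>. linear_map A M sum_T \<kappa> \<and>
     (\<forall>a\<in>carrier A. \<kappa> (\<phi> a) = \<zero>\<^bsub>sum_T\<^esub>) \<and>
     (\<forall>s\<in>I0. \<forall>q\<in>carrier Q. \<kappa> (summand s q) = copower_in I0 T1 s (p q))"
    by (rule M_universal[OF C, of "\<lambda>_. \<zero>\<^bsub>sum_T\<^esub>" "\<lambda>s q. copower_in I0 T1 s (p q)",
          OF linear_map_const_zero[OF C] in_p in_p_\<sigma>]) (assumption, intro exI conjI ballI, assumption, simp_all)
  from someI_ex[OF this] show ?thesis unfolding \<kappa>_def .
qed

lemma \<kappa>: "linear_map A M sum_T \<kappa>"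
  and \<kappa>_\<phi>: "a \<in> carrier A \<Longrightarrow> \<kappa> (\<phi> a) = \<zero>\<^bsub>sum_T\<^esub>"
  and \<kappa>_summand: "s \<in> I0 \<Longrightarrow> q \<in> carrier Q \<Longrightarrow> \<kappa> (summand s q) = copower_in I0 T1 s (p q)"
  using \<kappa>_spec by blast+

lemma \<kappa>_surj: "\<kappa> ` carrier M = carrier sum_T"
proof -
  have "y \<in> \<kappa> ` carrier M" if "y \<in> carrier sum_T" for y
  proof (rule copower_induct[OF T1 that])
    show "\<zero>\<^bsub>sum_T\<^esub> \<in> \<kappa> ` carrier M"
      using right_submodule_image[OF M C \<kappa>] by (simp only: right_submodule_def)
  next
    fix y y' assume "y \<in> \<kappa> ` carrier M" "y' \<in> \<kappa> ` carrier M"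
    then show "y \<oplus>\<^bsub>sum_T\<^esub> y' \<in> \<kappa> ` carrier M"
      by (rule right_submodule_add[OF right_submodule_image[OF M C \<kappa>]])
  next
    fix s t assume s: "s \<in> I0" and "t \<in> carrier T1"
    then obtain q where q: "q \<in> carrier Q" "t = p q" using p_surj by blast
    have "copower_in I0 T1 s t = \<kappa> (summand s q)" using \<kappa>_summand[OF s q(1)] q(2) by simp
    then show "copower_in I0 T1 s t \<in> \<kappa> ` carrier M"
      using linear_map_closed[OF summand q(1)] by (rule image_eqI)
  qed
  then show ?thesis using linear_map_closed[OF \<kappa>] by auto
qed

text \<open>
If \<open>\<kappa>\<close> kills the class of \<open>(a, y)\<close>, then \<open>y\<close> comes from \<open>P\<^sup>(\<^sup>I\<^sup>0\<^sup>)\<close> by exactness, and the pushout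
relations move it into the component \<open>A\<close>.
\<close>

lemma \<kappa>_kernel:
  assumes m: "m \<in> carrier M" and zero: "\<kappa> m = \<zero>\<^bsub>sum_T\<^esub>"
  shows "\<exists>a\<in>carrier A. m = \<phi> a"
proof -
  interpret V: right_module A sum_Q by (rule copower_Q)
  interpret C: right_module A sum_T by (rule C)
  interpret M: right_module A M by (rule M)
  obtain a y where ay: "a \<in> carrier A" "y \<in> carrier sum_Q" "m = \<phi> a \<oplus>\<^bsub>M\<^esub> coset (\<zero>\<^bsub>A\<^esub>, y)"
    using M_cases[OF m] by blast
  have \<phi>a: "\<phi> a \<in> carrier M" using linear_map_closed[OF \<phi>] ay(1) by simp
  have y: "y s \<in> carrier Q" if "s \<in> I0" for s using ay(2) that by (auto simp: copower_carrier)
  have "\<kappa> (coset (\<zero>\<^bsub>A\<^esub>, y)) = \<zero>\<^bsub>sum_T\<^esub>"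
    using zero linear_map_add[OF \<kappa> \<phi>a linear_map_closed[OF linear_map_incl_Q ay(2)]] \<kappa>_\<phi>[OF ay(1)]
      linear_map_closed[OF linear_map_comp[OF linear_map_incl_Q \<kappa>] ay(2)]
    by (simp only: ay(3) C.M.l_zero)
  moreover have "\<kappa> (coset (\<zero>\<^bsub>A\<^esub>, y)) s = p (y s)" if s: "s \<in> I0" for s
  proof (rule linear_map_copower_eqI[OF Q T1 _ _ _ ay(2)])
    show "linear_map A sum_Q T1 (\<lambda>y. \<kappa> (coset (\<zero>\<^bsub>A\<^esub>, y)) s)"
      by (intro linear_map_comp[OF linear_map_comp[OF linear_map_incl_Q \<kappa>]] linear_map_copower_proj s)
    show "linear_map A sum_Q T1 (\<lambda>y. p (y s))"
      by (intro linear_map_comp[OF linear_map_copower_proj p] s)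
    fix r q assume "r \<in> I0" "q \<in> carrier Q"
    then show "\<kappa> (coset (\<zero>\<^bsub>A\<^esub>, copower_in I0 Q r q)) s = p (copower_in I0 Q r q s)"
      using \<kappa>_summand[of r q] s linear_map_zero[OF Q T1 p] unfolding summand_def by (simp add: copower_in_def)
  qed
  ultimately have "p (y s) = \<zero>\<^bsub>T1\<^esub>" if "s \<in> I0" for s using that by (metis copower_simps(1) restrict_apply')
  then have "\<exists>x\<in>carrier P. y s = \<sigma> x" if "s \<in> I0" for s using exact y that by blast
  then obtain z where z: "\<And>s. s \<in> I0 \<Longrightarrow> z s \<in> carrier P \<and> y s = \<sigma> (z s)" by metis
  define z' where "z' = (\<lambda>s\<in>I0. if y s = \<zero>\<^bsub>Q\<^esub> then \<zero>\<^bsub>P\<^esub> else z s)"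
  have zP: "z' \<in> carrier sum_P"
    unfolding z'_def using ay(2) z by (intro copower_memI[of "{s \<in> I0. y s \<noteq> \<zero>\<^bsub>Q\<^esub>}"]) (auto simp: copower_carrier)
  have "(\<lambda>s\<in>I0. \<sigma> (z' s)) = restrict y I0"
    unfolding z'_def using z linear_map_zero[OF P Q \<sigma>] by (intro restrict_ext) auto
  also have "\<dots> = y" using ay(2) by (simp add: copower_carrier PiE_def extensional_restrict)
  finally have \<sigma>_z: "(\<lambda>s\<in>I0. \<sigma> (z' s)) = y" .
  have "(can z', \<ominus>\<^bsub>sum_Q\<^esub> (\<lambda>s\<in>I0. \<sigma> (z' s))) \<in> relations"
    unfolding relations_def using zP by (rule imageI)
  then have rel: "(can z', \<ominus>\<^bsub>sum_Q\<^esub> y) \<in> relations" by (simp only: \<sigma>_z)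
  have cz: "can z' \<in> carrier A" using linear_map_closed[OF can zP] by simp
  have ny: "\<ominus>\<^bsub>sum_Q\<^esub> y \<in> carrier sum_Q" using ay(2) by simp
  have "\<phi> (can z') = coset ((can z', \<ominus>\<^bsub>sum_Q\<^esub> y) \<oplus>\<^bsub>A_Q_sum\<^esub> (\<zero>\<^bsub>A\<^esub>, y))"
    using cz V.M.l_neg[OF ay(2)] by (simp add: \<phi>_def del: copower_simps)
  also have "\<dots> = coset (can z', \<ominus>\<^bsub>sum_Q\<^esub> y) \<oplus>\<^bsub>M\<^esub> coset (\<zero>\<^bsub>A\<^esub>, y)"
    using cz ny ay(2) by (intro linear_map_add[OF M_proj]) (auto simp del: copower_simps)
  also have "coset (can z', \<ominus>\<^bsub>sum_Q\<^esub> y) = \<zero>\<^bsub>M\<^esub>"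
    unfolding M_eq using quotient_module_eq_zero[OF A_Q relations] rel cz ny by simp
  finally have "coset (\<zero>\<^bsub>A\<^esub>, y) = \<phi> (can z')"
    using linear_map_closed[OF linear_map_incl_Q ay(2)] by simp
  then have "m = \<phi> (a \<oplus>\<^bsub>A\<^esub> can z')"
    using linear_map_add[OF \<phi>, of a "can z'"] ay(1,3) cz by simp
  then show ?thesis using ay(1) cz by blast
qed

text \<open>
For \<open>h : P \<rightarrow> M\<close>, the map \<open>\<kappa> \<circ> h\<close> extends along \<open>\<sigma>\<close> because \<open>T\<^sub>1\<^sup>(\<^sup>I\<^sup>0\<^sup>)\<close> lies in \<open>D\<^sub>\<sigma>\<close>; let
\<open>k : Q \<rightarrow> M\<close> lift the extension. Then \<open>h - k \<circ> \<sigma>\<close> has values in the image of \<open>\<phi>\<close>, so it is \<open>\<phi> \<circ> s\<close>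
for some \<open>s : P \<rightarrow> A\<close>. This \<open>s\<close> belongs to \<open>I\<^sub>0\<close>, and the pushout was built so that \<open>\<phi> \<circ> s\<close> extends
along \<open>\<sigma>\<close>, namely to the component map with index \<open>s\<close>.
\<close>

lemma extends_M: "extends_along A P Q \<sigma> M"
  unfolding extends_along_def
proof (intro allI impI)
  fix h assume h: "linear_map A P M h"
  interpret M: right_module A M by (rule M)
  interpret C: right_module A sum_T by (rule C)
  obtain k' where k': "linear_map A Q sum_T k'"
    "\<And>x. x \<in> carrier P \<Longrightarrow> k' (\<sigma> x) = \<kappa> (h x)"
    using extends_alongE[OF extends_small_copower[OF small_I] linear_map_comp[OF h \<kappa>]] by blast
  obtain k where k: "linear_map A Q M k" "\<And>q. q \<in> carrier Q \<Longrightarrow> \<kappa> (k q) = k' q"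
    using projective_lift[OF projective_Q M small_M C lepoll_copower[OF infinite_U small_I small_T1]
        \<kappa> \<kappa>_surj k'(1)] by blast
  let ?d = "\<lambda>x. h x \<ominus>\<^bsub>M\<^esub> k (\<sigma> x)"
  have k\<sigma>: "linear_map A P M (\<lambda>x. k (\<sigma> x))" by (rule linear_map_comp[OF \<sigma> k(1)])
  have d: "linear_map A P M ?d" by (rule linear_map_diff[OF M h k\<sigma>])
  have "\<exists>a\<in>carrier A. ?d x = \<phi> a" if x: "x \<in> carrier P" for x
  proof (rule \<kappa>_kernel)
    show "?d x \<in> carrier M" by (rule linear_map_closed[OF d x])
    have hk: "h x \<in> carrier M" "k (\<sigma> x) \<in> carrier M"
      by (rule linear_map_closed[OF h x] linear_map_closed[OF k\<sigma> x])+
    have "\<kappa> (?d x) = \<kappa> (h x) \<ominus>\<^bsub>sum_T\<^esub> \<kappa> (k (\<sigma> x))"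
      unfolding a_minus_def using hk
      by (simp only: linear_map_add[OF \<kappa>] linear_map_minus[OF M C \<kappa>] M.M.a_inv_closed)
    also have "\<kappa> (k (\<sigma> x)) = \<kappa> (h x)"
      using k(2)[OF linear_map_closed[OF \<sigma> x]] k'(2)[OF x] by simp
    finally show "\<kappa> (?d x) = \<zero>\<^bsub>sum_T\<^esub>"
      using linear_map_closed[OF \<kappa> hk(1)] by (simp only: C.M.minus_eq_zero_iff)
  qed
  then have d': "linear_map A P (M\<lparr>carrier := \<phi> ` carrier A\<rparr>) ?d"
    by (intro linear_map_submodule[OF d]) blast
  have \<phi>': "linear_map A A\<^sub>A (M\<lparr>carrier := \<phi> ` carrier A\<rparr>) \<phi>"
    by (intro linear_map_submodule[OF \<phi>]) simp
  have sub: "right_module A (M\<lparr>carrier := \<phi> ` carrier A\<rparr>)"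
    using right_module_submodule[OF M right_submodule_image[OF A_A M \<phi>]] by simp
  obtain s where s: "linear_map A P A\<^sub>A s" "\<And>x. x \<in> carrier P \<Longrightarrow> \<phi> (s x) = ?d x"
    using projective_lift[OF projective_P A_A _ sub _ \<phi>' _ d'] small_A
      lepoll_trans[OF image_lepoll small_A, of \<phi>] by auto
  let ?s = "restrict s (carrier P)"
  have s': "?s \<in> I0" by (rule restrict_in_mod_hom[OF P s(1)])
  have "k (\<sigma> x) \<oplus>\<^bsub>M\<^esub> summand ?s (\<sigma> x) = h x" if x: "x \<in> carrier P" for x
  proof -
    have "h x \<in> carrier M" "k (\<sigma> x) \<in> carrier M"
      by (rule linear_map_closed[OF h x] linear_map_closed[OF k\<sigma> x])+
    then have "k (\<sigma> x) \<oplus>\<^bsub>M\<^esub> (h x \<ominus>\<^bsub>M\<^esub> k (\<sigma> x)) = h x"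
      by (simp add: a_minus_def M.M.a_lcomm M.M.r_neg)
    then show ?thesis using summand_\<sigma>[OF s' x] s(2)[OF x] x by simp
  qed
  then show "\<exists>k. linear_map A Q M k \<and> (\<forall>x\<in>carrier P. k (\<sigma> x) = h x)"
    using linear_map_plus[OF M k(1) summand, of ?s] by blast
qed

end

section \<open>The completed module\<close>

context silting_setup
begin

definition T :: "('a, 't \<times> ('a, 'p, 'q) bongartz) module" where
  "T = bongartz_completion A P Q \<sigma> T1"

lemma T_eq: "T = direct_sum T1 M"
  by (simp add: T_def bongartz_completion_def M_def)

lemma T: "right_module A T"
  unfolding T_eq by (rule right_module_direct_sum[OF T1 M])

lemma small_T: "small U (carrier T)"
  using lepoll_times[OF infinite_U small_T1 small_M] by (simp add: T_eq)

lemma extends_T: "extends_along A P Q \<sigma> T"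
  unfolding T_eq by (rule extends_along_direct_sum[OF extends_T1 extends_M])

sublocale M: right_module A M by (rule M)
sublocale T: right_module A T by (rule T)

lemma T_fst: "linear_map A T T1 fst" and T_snd: "linear_map A T M snd"
  unfolding T_eq by (rule linear_map_fst linear_map_snd)+

lemma T_inl: "linear_map A T1 T (\<lambda>t. (t, \<zero>\<^bsub>M\<^esub>))" and T_inr: "linear_map A M T (\<lambda>m. (\<zero>\<^bsub>T1\<^esub>, m))"
  unfolding T_eq
  by (intro linear_map_Pair linear_map_id linear_map_const_zero M T1)+

lemma T_split:
  assumes X: "right_module A X" and h: "linear_map A T X h" and x: "x \<in> carrier T"
  shows "h x = h (fst x, \<zero>\<^bsub>M\<^esub>) \<oplus>\<^bsub>X\<^esub> h (\<zero>\<^bsub>T1\<^esub>, snd x)"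
proof -
  have "(fst x, \<zero>\<^bsub>M\<^esub>) \<in> carrier T" "(\<zero>\<^bsub>T1\<^esub>, snd x) \<in> carrier T"
    using x by (auto simp: T_eq)
  from linear_map_add[OF h this] show ?thesis using x by (auto simp: T_eq)
qed

definition \<tau> :: "'t \<times> ('a, 'p, 'q) bongartz" where "\<tau> = (\<zero>\<^bsub>T1\<^esub>, \<phi> \<one>\<^bsub>A\<^esub>)"

lemma \<phi>_one: "\<phi> \<one>\<^bsub>A\<^esub> \<in> carrier M"
  using linear_map_closed[OF \<phi>] by simp

lemma \<tau>_closed: "\<tau> \<in> carrier T"
  by (simp add: \<tau>_def T_eq \<phi>_one)

text \<open>
A map out of \<open>A\<close> is given by an element of \<open>X\<close>. Its composites with all \<open>s : P \<rightarrow> A\<close> extend along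
\<open>\<sigma>\<close>, and the extensions are the components of a map out of the pushout.
\<close>

lemma M_approximation:
  assumes X: "right_module A X" and ext: "extends_along A P Q \<sigma> X" and x: "x \<in> carrier X"
  obtains h where "linear_map A M X h" "h (\<phi> \<one>\<^bsub>A\<^esub>) = x"
proof -
  interpret X: right_module A X by fact
  let ?g = "\<lambda>a. a \<odot>\<^bsub>X\<^esub> x"
  have g: "linear_map A A\<^sub>A X ?g" by (rule linear_map_from_regular[OF X x])
  have "\<forall>s. \<exists>d. s \<in> I0 \<longrightarrow> linear_map A Q X d \<and> (\<forall>z\<in>carrier P. d (\<sigma> z) = ?g (s z))"
    using ext linear_map_comp[OF I0_linear g] unfolding extends_along_def by blast
  from choice[OF this] obtain d where
    d: "\<And>s. s \<in> I0 \<Longrightarrow> linear_map A Q X (d s)"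
      "\<And>s z. s \<in> I0 \<Longrightarrow> z \<in> carrier P \<Longrightarrow> d s (\<sigma> z) = ?g (s z)" by blast
  obtain h where h: "linear_map A M X h" "\<And>a. a \<in> carrier A \<Longrightarrow> h (\<phi> a) = ?g a"
    by (rule M_universal[OF X g d]) (assumption, assumption, assumption, rule that)
  show ?thesis using that[OF h(1)] h(2)[of "\<one>\<^bsub>A\<^esub>"] x by simp
qed

lemma M_factor_\<kappa>:
  assumes X: "right_module A X" and h: "linear_map A M X h" and zero: "h (\<phi> \<one>\<^bsub>A\<^esub>) = \<zero>\<^bsub>X\<^esub>"
  obtains u where "linear_map A sum_T X u" "\<And>m. m \<in> carrier M \<Longrightarrow> u (\<kappa> m) = h m"
proof (rule linear_map_factor[OF M C X \<kappa> \<kappa>_surj h])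
  fix m assume "m \<in> carrier M" "\<kappa> m = \<zero>\<^bsub>sum_T\<^esub>"
  then obtain a where a: "a \<in> carrier A" "m = \<phi> a" using \<kappa>_kernel by blast
  interpret X: right_module A X by fact
  show "h m = \<zero>\<^bsub>X\<^esub>"
    using linear_map_regular_eq[OF X linear_map_comp[OF \<phi> h] a(1)] a zero by (simp add: X.smult_zero)
qed (use that in blast)

text \<open>
The difference of \<open>h\<close> and \<open>k\<close> vanishes on \<open>T\<^sub>1\<close>, and on \<open>M\<close> it factors through the coproduct \<open>M / \<phi>(A)\<close>
of copies of \<open>T\<^sub>1\<close>.
\<close>

lemma linear_map_T_eqI:
  assumes X: "right_module A X"
    and zero: "hom_vanishes A T1 X"
    and h: "linear_map A T X h" and k: "linear_map A T X k" and eq: "h \<tau> = k \<tau>"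
    and x: "x \<in> carrier T"
  shows "h x = k x"
proof -
  interpret X: right_module A X by fact
  let ?d = "\<lambda>x. h x \<ominus>\<^bsub>X\<^esub> k x"
  have d: "linear_map A T X ?d" by (rule linear_map_diff[OF X h k])
  have "?d \<tau> = \<zero>\<^bsub>X\<^esub>"
    using linear_map_closed[OF h \<tau>_closed] linear_map_closed[OF k \<tau>_closed] eq
    by (simp add: X.M.minus_eq_zero_iff)
  then obtain u where u: "linear_map A sum_T X u"
    "\<And>m. m \<in> carrier M \<Longrightarrow> u (\<kappa> m) = ?d (\<zero>\<^bsub>T1\<^esub>, m)"
    using M_factor_\<kappa>[OF X linear_map_comp[OF T_inr d]] unfolding \<tau>_def by blast
  have x': "fst x \<in> carrier T1" "snd x \<in> carrier M" using x by (auto simp: T_eq)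
  have "u (\<kappa> (snd x)) = \<zero>\<^bsub>X\<^esub>"
    by (rule linear_map_copower_eqI[OF T1 X u(1) linear_map_const_zero[OF X] _ linear_map_closed[OF \<kappa> x'(2)]])
      (rule hom_vanishesD[OF zero linear_map_comp[OF linear_map_copower_in[OF T1] u(1)]])
  then have "?d (\<zero>\<^bsub>T1\<^esub>, snd x) = \<zero>\<^bsub>X\<^esub>" using u(2)[OF x'(2)] by simp
  moreover have "?d (fst x, \<zero>\<^bsub>M\<^esub>) = \<zero>\<^bsub>X\<^esub>"
    by (rule hom_vanishesD[OF zero linear_map_comp[OF T_inl d] x'(1)])
  ultimately have "?d x = \<zero>\<^bsub>X\<^esub>" using T_split[OF X d x] by simp
  then show ?thesis
    using linear_map_closed[OF h x] linear_map_closed[OF k x] by (simp add: X.M.minus_eq_zero_iff)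
qed

end

section \<open>The ideal of maps factoring through Add\<close>

lemma End_ring_simps [simp]:
  "carrier (End_ring A M) = mod_hom A M M" "\<zero>\<^bsub>End_ring A M\<^esub> = (\<lambda>x\<in>carrier M. \<zero>\<^bsub>M\<^esub>)"
  "\<one>\<^bsub>End_ring A M\<^esub> = (\<lambda>x\<in>carrier M. x)"
  "g \<oplus>\<^bsub>End_ring A M\<^esub> h = (\<lambda>x\<in>carrier M. g x \<oplus>\<^bsub>M\<^esub> h x)"
  "g \<otimes>\<^bsub>End_ring A M\<^esub> h = compose (carrier M) g h"
  by (simp_all add: End_ring_def)

lemma ring_End_ring:
  assumes M: "right_module A M" shows "ring (End_ring A M)"
proof -
  interpret right_module A M by fact
  have lin: "linear_map A M M g" if "g \<in> mod_hom A M M" for g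
    using that by (simp add: mod_hom_iff)
  have val: "g x \<in> carrier M" if "g \<in> mod_hom A M M" "x \<in> carrier M" for g x
    using linear_map_closed[OF lin] that by blast
  have ext: "restrict g (carrier M) = g" if "g \<in> mod_hom A M M" for g
    using that by (simp add: mod_hom_iff extensional_restrict)
  note mem = restrict_in_mod_hom[OF M]
  show ?thesis
  proof (rule ringI)
    show "abelian_group (End_ring A M)"
    proof (rule abelian_groupI)
      fix g h assume gh: "g \<in> carrier (End_ring A M)" "h \<in> carrier (End_ring A M)"
      then show "g \<oplus>\<^bsub>End_ring A M\<^esub> h \<in> carrier (End_ring A M)"
        by (simp add: mem linear_map_plus[OF M lin lin])
      show "g \<oplus>\<^bsub>End_ring A M\<^esub> h = h \<oplus>\<^bsub>End_ring A M\<^esub> g"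
        using gh by (auto simp: val M.a_comm intro!: restrict_ext)
    next
      show "\<zero>\<^bsub>End_ring A M\<^esub> \<in> carrier (End_ring A M)"
        by (simp add: mem linear_map_const_zero[OF M])
    next
      fix g h k assume "g \<in> carrier (End_ring A M)" "h \<in> carrier (End_ring A M)" "k \<in> carrier (End_ring A M)"
      then show "g \<oplus>\<^bsub>End_ring A M\<^esub> h \<oplus>\<^bsub>End_ring A M\<^esub> k = g \<oplus>\<^bsub>End_ring A M\<^esub> (h \<oplus>\<^bsub>End_ring A M\<^esub> k)"
        by (auto simp: val M.a_assoc intro!: restrict_ext)
    next
      fix g assume g: "g \<in> carrier (End_ring A M)"
      then have "\<zero>\<^bsub>End_ring A M\<^esub> \<oplus>\<^bsub>End_ring A M\<^esub> g = restrict g (carrier M)"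
        by (auto simp: val intro!: restrict_ext)
      then show "\<zero>\<^bsub>End_ring A M\<^esub> \<oplus>\<^bsub>End_ring A M\<^esub> g = g" using g by (simp add: ext)
      show "\<exists>h\<in>carrier (End_ring A M). h \<oplus>\<^bsub>End_ring A M\<^esub> g = \<zero>\<^bsub>End_ring A M\<^esub>"
        using g mem[OF linear_map_uminus[OF M lin]]
        by (intro bexI[of _ "\<lambda>x\<in>carrier M. \<ominus>\<^bsub>M\<^esub> g x"]) (auto simp: val M.l_neg intro!: restrict_ext)
    qed
    show "monoid (End_ring A M)"
    proof (rule monoidI)
      fix g h assume "g \<in> carrier (End_ring A M)" "h \<in> carrier (End_ring A M)"
      then show "g \<otimes>\<^bsub>End_ring A M\<^esub> h \<in> carrier (End_ring A M)"
        by (simp add: compose_def mem linear_map_comp[OF lin lin])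
    next
      show "\<one>\<^bsub>End_ring A M\<^esub> \<in> carrier (End_ring A M)" by (simp add: mem linear_map_id)
    next
      fix g h k assume "g \<in> carrier (End_ring A M)" "h \<in> carrier (End_ring A M)" "k \<in> carrier (End_ring A M)"
      then show "g \<otimes>\<^bsub>End_ring A M\<^esub> h \<otimes>\<^bsub>End_ring A M\<^esub> k = g \<otimes>\<^bsub>End_ring A M\<^esub> (h \<otimes>\<^bsub>End_ring A M\<^esub> k)"
        by (auto simp: val compose_def intro!: restrict_ext)
    next
      fix g assume g: "g \<in> carrier (End_ring A M)"
      then have "\<one>\<^bsub>End_ring A M\<^esub> \<otimes>\<^bsub>End_ring A M\<^esub> g = restrict g (carrier M)"
        "g \<otimes>\<^bsub>End_ring A M\<^esub> \<one>\<^bsub>End_ring A M\<^esub> = restrict g (carrier M)"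
        by (auto simp: val compose_def intro!: restrict_ext)
      then show "\<one>\<^bsub>End_ring A M\<^esub> \<otimes>\<^bsub>End_ring A M\<^esub> g = g" "g \<otimes>\<^bsub>End_ring A M\<^esub> \<one>\<^bsub>End_ring A M\<^esub> = g"
        using g by (simp_all add: ext)
    qed
  qed (auto simp: val compose_def linear_map_add[OF lin] intro!: restrict_ext)
qed

context silting_setup
begin

definition F where "F = factoring_ideal TYPE('u) A T T1"

abbreviation on_T :: "('t \<times> ('a, 'p, 'q) bongartz \<Rightarrow> 't \<times> ('a, 'p, 'q) bongartz) \<Rightarrow> _" where
  "on_T g \<equiv> restrict g (carrier T)"

lemma copower_copy_in_Add:
  assumes J: "small U J"
  obtains N :: "('a, 'u) module" and i where "N \<in> Add_class A T1"
    "linear_map A (copower J T1) N i" "bij_betw i (carrier (copower J T1)) (carrier N)"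
proof -
  have CJ: "right_module A (copower J T1)" by (rule right_module_copower[OF T1])
  obtain N :: "('a, 'u) module" and i where N: "right_module A N"
    "linear_map A (copower J T1) N i" "bij_betw i (carrier (copower J T1)) (carrier N)"
    using small_copy[OF CJ lepoll_copower[OF infinite_U J small_T1]] by blast
  interpret N: right_module A N by (rule N(1))
  obtain b :: "_ \<Rightarrow> 'u" where b: "inj_on b J" using J by (auto simp: lepoll_def)
  have b': "bij_betw (inv_into J b) (b ` J) J"
    using b by (simp add: bij_betw_inv_into inj_on_imp_bij_betw)
  obtain k where k: "linear_map A (copower J T1) (copower (b ` J) T1) k"
    "bij_betw k (carrier (copower J T1)) (carrier (copower (b ` J) T1))"
    by (rule copower_iso[OF T1 T1 linear_map_id bij_betw_id[unfolded id_def] b'])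
  \<comment> \<open>a zero module over \<open>'u\<close>, as the complement that \<^const>\<open>Add_class\<close> asks for\<close>
  let ?Z = "N\<lparr>carrier := {\<zero>\<^bsub>N\<^esub>}\<rparr>"
  have Z: "right_module A ?Z"
    by (rule right_module_submodule[OF N(1)]) (simp add: right_submodule_def N.smult_zero)
  note i' = linear_map_inv_into[OF CJ N(2,3)]
  have "bij_betw fst (carrier (direct_sum N ?Z)) (carrier N)"
    by (auto simp: bij_betw_def inj_on_def image_iff)
  from bij_betw_trans[OF bij_betw_trans[OF this bij_betw_inv_into[OF N(3)]] k(2)]
  have "bij_betw (\<lambda>z. k (inv_into (carrier (copower J T1)) i (fst z)))
      (carrier (direct_sum N ?Z)) (carrier (copower (b ` J) T1))"
    by (simp add: comp_def)
  moreover have "linear_map A (direct_sum N ?Z) (copower (b ` J) T1)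
      (\<lambda>z. k (inv_into (carrier (copower J T1)) i (fst z)))"
    by (intro linear_map_comp[OF linear_map_comp[OF linear_map_fst i'] k(1)])
  ultimately have "mod_isomorphic A (direct_sum N ?Z) (copower (b ` J) T1)"
    unfolding mod_isomorphic_iff[OF right_module_direct_sum[OF N(1) Z]] by blast
  then have "N \<in> Add_class A T1"
    unfolding Add_class_def Mod_class_def using N(1) Z by blast
  then show ?thesis using that N(2,3) by blast
qed

text \<open>
With the converse \<open>F_E\<close>, this replaces the modules in \<open>Add(T\<^sub>1)\<close> by the copowers of \<open>T\<^sub>1\<close> of which they
are summands.
\<close>

lemma F_I:
  assumes J: "small U J" and h: "linear_map A T (copower J T1) h" and k: "linear_map A (copower J T1) T k"
  shows "on_T (\<lambda>x. k (h x)) \<in> F"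
proof -
  have CJ: "right_module A (copower J T1)" by (rule right_module_copower[OF T1])
  obtain N :: "('a, 'u) module" and i where N: "N \<in> Add_class A T1"
    and i: "linear_map A (copower J T1) N i" "bij_betw i (carrier (copower J T1)) (carrier N)"
    using copower_copy_in_Add[OF J] by blast
  have N': "right_module A N" using N by (simp add: Add_class_def Mod_class_def)
  let ?j = "inv_into (carrier (copower J T1)) i"
  let ?h = "restrict (\<lambda>x. i (h x)) (carrier T)" and ?k = "restrict (\<lambda>y. k (?j y)) (carrier N)"
  have ih: "linear_map A T N (\<lambda>x. i (h x))" by (rule linear_map_comp[OF h i(1)])
  have "?h \<in> mod_hom A T N" by (rule restrict_in_mod_hom[OF T ih])
  moreover have "?k \<in> mod_hom A N T"
    by (rule restrict_in_mod_hom[OF N' linear_map_comp[OF linear_map_inv_into[OF CJ i] k]])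
  moreover have "on_T (\<lambda>x. k (h x)) = compose (carrier T) ?k ?h"
    using linear_map_closed[OF ih] linear_map_closed[OF h] i(2)
    by (auto simp: compose_def bij_betw_inv_into_left intro!: restrict_ext)
  moreover have "on_T (\<lambda>x. k (h x)) \<in> mod_hom A T T"
    by (rule restrict_in_mod_hom[OF T linear_map_comp[OF h k]])
  ultimately show ?thesis unfolding F_def factoring_ideal_def using N by blast
qed

lemma F_E:
  assumes "g \<in> F"
  obtains J :: "'u set" and h k where "linear_map A T (copower J T1) h"
    "linear_map A (copower J T1) T k" "g = on_T (\<lambda>x. k (h x))"
proof -
  obtain N :: "('a, 'u) module" and h k where N: "N \<in> Add_class A T1"
    and hk: "h \<in> mod_hom A T N" "k \<in> mod_hom A N T" "g = compose (carrier T) k h"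
    using assms unfolding F_def factoring_ideal_def by blast
  obtain J :: "'u set" and N' :: "('a, 'u) module" where
    N': "right_module A N" "right_module A N'" "mod_isomorphic A (direct_sum N N') (copower J T1)"
    using N unfolding Add_class_def Mod_class_def by blast
  interpret N': right_module A N' by (rule N'(2))
  have S: "right_module A (direct_sum N N')" by (rule right_module_direct_sum[OF N'(1,2)])
  obtain i where i: "linear_map A (direct_sum N N') (copower J T1) i"
    "bij_betw i (carrier (direct_sum N N')) (carrier (copower J T1))"
    using N'(3) unfolding mod_isomorphic_iff[OF S] by blast
  have h: "linear_map A T N h" and k: "linear_map A N T k" using hk by (simp_all add: mod_hom_iff)
  let ?j = "inv_into (carrier (direct_sum N N')) i"
  have h0: "linear_map A T (direct_sum N N') (\<lambda>x. (h x, \<zero>\<^bsub>N'\<^esub>))"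
    by (intro linear_map_Pair h linear_map_const_zero N')
  have h': "linear_map A T (copower J T1) (\<lambda>x. i (h x, \<zero>\<^bsub>N'\<^esub>))"
    by (rule linear_map_comp[OF h0 i(1)])
  have k': "linear_map A (copower J T1) T (\<lambda>y. k (fst (?j y)))"
    by (rule linear_map_comp[OF linear_map_comp[OF linear_map_inv_into[OF S i] linear_map_fst] k])
  have "?j (i (h x, \<zero>\<^bsub>N'\<^esub>)) = (h x, \<zero>\<^bsub>N'\<^esub>)" if "x \<in> carrier T" for x
    using i(2) linear_map_closed[OF h0 that] by (rule bij_betw_inv_into_left)
  then have "g = on_T (\<lambda>x. k (fst (?j (i (h x, \<zero>\<^bsub>N'\<^esub>)))))"
    unfolding hk(3) compose_def by (intro restrict_ext) simp
  then show ?thesis using that h' k' by blast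
qed

lemma F_hom: "g \<in> F \<Longrightarrow> g \<in> mod_hom A T T"
  by (simp add: F_def factoring_ideal_def)

lemma small_subset: "small U (J :: 'u set)"
  by (rule subset_imp_lepoll) simp

text \<open>
The sum factors through the copower over the disjoint union of the two index sets.
\<close>

lemma F_add:
  assumes "g \<in> F" "g' \<in> F" shows "g \<oplus>\<^bsub>End_ring A T\<^esub> g' \<in> F"
proof -
  obtain J :: "'u set" and h k where h: "linear_map A T (copower J T1) h"
    and k: "linear_map A (copower J T1) T k" and g: "g = on_T (\<lambda>x. k (h x))"
    using F_E[OF assms(1)] by blast
  obtain J' :: "'u set" and h' k' where h': "linear_map A T (copower J' T1) h'"
    and k': "linear_map A (copower J' T1) T k'" and g': "g' = on_T (\<lambda>x. k' (h' x))"
    using F_E[OF assms(2)] by blast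
  let ?C = "copower (J <+> J') T1"
  have C: "right_module A ?C" by (rule right_module_copower[OF T1])
  define l where "l = copower_map J T1 ?C (\<lambda>j. copower_in (J <+> J') T1 (Inl j))"
  define r where "r = copower_map J' T1 ?C (\<lambda>j. copower_in (J <+> J') T1 (Inr j))"
  define e where "e = case_sum (\<lambda>j t. k (copower_in J T1 j t)) (\<lambda>j t. k' (copower_in J' T1 j t))"
  define m where "m = copower_map (J <+> J') T1 T e"
  have l: "linear_map A (copower J T1) ?C l" and r: "linear_map A (copower J' T1) ?C r"
    unfolding l_def r_def
    by (rule linear_map_copower_map[OF T1 C linear_map_copower_in[OF T1]])+
  have e: "linear_map A T1 T (e j)" for j
    unfolding e_def
    by (cases j) (auto intro: linear_map_comp[OF linear_map_copower_in[OF T1] k]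
        linear_map_comp[OF linear_map_copower_in[OF T1] k'])
  have m: "linear_map A ?C T m" unfolding m_def by (rule linear_map_copower_map[OF T1 T e])
  have ml: "m (l y) = k y" if "y \<in> carrier (copower J T1)" for y
  proof (rule linear_map_copower_eqI[OF T1 T linear_map_comp[OF l m] k _ that])
    fix j t assume "j \<in> J" "t \<in> carrier T1"
    then show "m (l (copower_in J T1 j t)) = k (copower_in J T1 j t)"
      using copower_map_in[OF T1 C linear_map_copower_in[OF T1], of j J t Inl]
        copower_map_in[OF T1 T e, of "Inl j" "J <+> J'" t]
      by (simp add: l_def m_def e_def InlI)
  qed
  have mr: "m (r y) = k' y" if "y \<in> carrier (copower J' T1)" for y
  proof (rule linear_map_copower_eqI[OF T1 T linear_map_comp[OF r m] k' _ that])
    fix j t assume "j \<in> J'" "t \<in> carrier T1"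
    then show "m (r (copower_in J' T1 j t)) = k' (copower_in J' T1 j t)"
      using copower_map_in[OF T1 C linear_map_copower_in[OF T1], of j J' t Inr]
        copower_map_in[OF T1 T e, of "Inr j" "J <+> J'" t]
      by (simp add: r_def m_def e_def InrI)
  qed
  let ?h = "\<lambda>x. l (h x) \<oplus>\<^bsub>?C\<^esub> r (h' x)"
  have lh: "linear_map A T ?C (\<lambda>x. l (h x))" and rh: "linear_map A T ?C (\<lambda>x. r (h' x))"
    by (rule linear_map_comp[OF h l] linear_map_comp[OF h' r])+
  have "on_T (\<lambda>x. m (?h x)) \<in> F"
    using lepoll_Plus[OF infinite_U small_subset small_subset] linear_map_plus[OF C lh rh] m by (rule F_I)
  moreover have "m (?h x) = k (h x) \<oplus>\<^bsub>T\<^esub> k' (h' x)" if x: "x \<in> carrier T" for x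
    using linear_map_add[OF m linear_map_closed[OF lh x] linear_map_closed[OF rh x]]
      ml[OF linear_map_closed[OF h x]] mr[OF linear_map_closed[OF h' x]] by (simp only:)
  ultimately show ?thesis by (simp add: g g' cong: restrict_cong)
qed

lemma F_mult:
  assumes "g \<in> F" "g' \<in> mod_hom A T T" shows "g \<otimes>\<^bsub>End_ring A T\<^esub> g' \<in> F"
proof -
  obtain J :: "'u set" and h k where h: "linear_map A T (copower J T1) h"
    and k: "linear_map A (copower J T1) T k" and g: "g = on_T (\<lambda>x. k (h x))"
    using F_E[OF assms(1)] by blast
  have g': "linear_map A T T g'" using assms(2) by (simp add: mod_hom_iff)
  have "g \<otimes>\<^bsub>End_ring A T\<^esub> g' = on_T (\<lambda>x. k (h (g' x)))"
    using linear_map_closed[OF g'] by (auto simp: g compose_def intro!: restrict_ext)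
  then show ?thesis using F_I[OF small_subset linear_map_comp[OF g' h] k] by simp
qed

section \<open>Idempotency of the ideal\<close>

lemma F_trace: "g \<in> F \<Longrightarrow> x \<in> carrier T \<Longrightarrow> g x \<in> trace A T1 T"
proof -
  assume g: "g \<in> F" and x: "x \<in> carrier T"
  obtain J :: "'u set" and h k where h: "linear_map A T (copower J T1) h"
    and k: "linear_map A (copower J T1) T k" and g: "g = on_T (\<lambda>x. k (h x))"
    using F_E[OF g] by blast
  show ?thesis using copower_image_trace[OF T1 T k linear_map_closed[OF h x]] x by (simp add: g)
qed

definition F_square where "F_square = ideal_prod (End_ring A T) F F"

lemma F_square_prod:
  assumes "on_T a \<in> F" "on_T b \<in> F" and b: "linear_map A T T b"
  shows "on_T (\<lambda>x. a (b x)) \<in> F_square"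
proof -
  have "on_T a \<otimes>\<^bsub>End_ring A T\<^esub> on_T b = on_T (\<lambda>x. a (b x))"
    using linear_map_closed[OF b] by (auto simp: compose_def intro!: restrict_ext)
  then show ?thesis using ideal_prod.prod[OF assms(1,2), of "End_ring A T"] by (simp add: F_square_def)
qed

lemma F_square_add:
  assumes "on_T a \<in> F_square" "on_T b \<in> F_square"
  shows "on_T (\<lambda>x. a x \<oplus>\<^bsub>T\<^esub> b x) \<in> F_square"
proof -
  have "on_T a \<oplus>\<^bsub>End_ring A T\<^esub> on_T b = on_T (\<lambda>x. a x \<oplus>\<^bsub>T\<^esub> b x)" by (auto intro!: restrict_ext)
  then show ?thesis using ideal_prod.sum[OF assms[unfolded F_square_def]] by (simp add: F_square_def)
qed

lemma on_T_cong: "on_T a \<in> S \<Longrightarrow> (\<And>x. x \<in> carrier T \<Longrightarrow> b x = a x) \<Longrightarrow> on_T b \<in> S"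
  by (simp cong: restrict_cong)

lemma F_through_T1:
  assumes b: "linear_map A T T1 b" and a: "linear_map A T1 T a"
  shows "on_T (\<lambda>x. a (b x)) \<in> F"
proof -
  have "small U {()}" using infinite_U by (simp add: finite_lepoll_infinite)
  from F_I[OF this linear_map_comp[OF b linear_map_copower_in[OF T1]]
      linear_map_comp[OF linear_map_copower_proj a]]
  have "on_T (\<lambda>x. a (copower_in {()} T1 () (b x) ())) \<in> F" by blast
  then show ?thesis by (rule on_T_cong) (simp add: copower_in_def)
qed

text \<open>
As \<open>T\<^sub>1\<close> is a summand of \<open>T\<close>, the map \<open>a \<circ> b\<close> is the product of \<open>T \<rightarrow> T\<^sub>1 \<rightarrow> T\<close>, the projection followed
by \<open>a\<close>, and \<open>T \<rightarrow> T\<^sub>1 \<rightarrow> T\<close>, the map \<open>b\<close> followed by the inclusion.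
\<close>

lemma F_square_through_T1:
  assumes b: "linear_map A T T1 b" and a: "linear_map A T1 T a"
  shows "on_T (\<lambda>x. a (b x)) \<in> F_square"
proof -
  have "on_T (\<lambda>x. a (fst x)) \<in> F" by (rule F_through_T1[OF T_fst a])
  moreover have "on_T (\<lambda>x. (b x, \<zero>\<^bsub>M\<^esub>)) \<in> F" by (rule F_through_T1[OF b T_inl])
  moreover have "linear_map A T T (\<lambda>x. (b x, \<zero>\<^bsub>M\<^esub>))" by (rule linear_map_comp[OF b T_inl])
  ultimately have "on_T (\<lambda>x. a (fst (b x, \<zero>\<^bsub>M\<^esub>))) \<in> F_square" by (rule F_square_prod)
  then show ?thesis by simp
qed

lemma F_square_zero: "on_T (\<lambda>x. \<zero>\<^bsub>T\<^esub>) \<in> F_square"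
  using F_square_through_T1[OF linear_map_const_zero[OF T1] linear_map_const_zero[OF T]] by simp

lemma \<kappa>_snd: "linear_map A T sum_T (\<lambda>x. \<kappa> (snd x))"
  by (rule linear_map_comp[OF T_snd \<kappa>])

text \<open>
Here \<open>u \<circ> \<kappa>\<close> is a finite sum of maps through \<open>T\<^sub>1\<close>. The induction is over a set of indices outside of
which \<open>u\<close> vanishes.
\<close>

lemma F_square_\<kappa>_finite:
  assumes u: "linear_map A sum_T T u" and "finite I0"
  shows "on_T (\<lambda>x. u (\<kappa> (snd x))) \<in> F_square"
proof -
  have "finite D \<Longrightarrow> D \<subseteq> I0 \<Longrightarrow> linear_map A sum_T T u \<Longrightarrow>
      (\<And>s t. s \<in> I0 \<Longrightarrow> s \<notin> D \<Longrightarrow> t \<in> carrier T1 \<Longrightarrow> u (copower_in I0 T1 s t) = \<zero>\<^bsub>T\<^esub>) \<Longrightarrow>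
      on_T (\<lambda>x. u (\<kappa> (snd x))) \<in> F_square" for D u
  proof (induction D arbitrary: u rule: finite_induct)
    case empty
    have "u y = \<zero>\<^bsub>T\<^esub>" if "y \<in> carrier sum_T" for y
      by (rule linear_map_copower_eqI[OF T1 T empty(2) linear_map_const_zero[OF T] _ that])
        (use empty(3) in simp)
    then show ?case
      using F_square_zero by (rule_tac on_T_cong[OF F_square_zero]) (simp add: linear_map_closed[OF \<kappa>_snd])
  next
    case (insert s D)
    note u = insert.prems(2)
    have s: "s \<in> I0" using insert.prems(1) by blast
    have us: "linear_map A T1 T (\<lambda>t. u (copower_in I0 T1 s t))"
      by (rule linear_map_comp[OF linear_map_copower_in[OF T1] u])
    have ys: "linear_map A sum_T T (\<lambda>y. u (copower_in I0 T1 s (y s)))"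
      by (rule linear_map_comp[OF linear_map_copower_proj[OF s] us])
    \<comment> \<open>\<open>u\<close> with its component \<open>s\<close> removed\<close>
    let ?v = "\<lambda>y. u y \<ominus>\<^bsub>T\<^esub> u (copower_in I0 T1 s (y s))"
    have v: "linear_map A sum_T T ?v" by (rule linear_map_diff[OF T u ys])
    have "?v (copower_in I0 T1 r t) = \<zero>\<^bsub>T\<^esub>" if r: "r \<in> I0" "r \<notin> D" and t: "t \<in> carrier T1" for r t
    proof (cases "r = s")
      case True
      then have "copower_in I0 T1 r t s = t" using s by (simp add: copower_in_def)
      then show ?thesis using True linear_map_closed[OF us t] by (simp add: T.M.minus_eq_zero_iff)
    next
      case False
      then have "copower_in I0 T1 r t s = \<zero>\<^bsub>T1\<^esub>" using s by (simp add: copower_in_def)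
      then show ?thesis
        using insert.prems(3)[of r t] r t False linear_map_zero[OF T1 T us]
        by (simp add: T.M.minus_eq_zero_iff)
    qed
    then have "on_T (\<lambda>x. ?v (\<kappa> (snd x))) \<in> F_square"
      using insert.prems(1) v by (intro insert.IH) auto
    moreover have "on_T (\<lambda>x. u (copower_in I0 T1 s (\<kappa> (snd x) s))) \<in> F_square"
      by (rule F_square_through_T1[OF linear_map_comp[OF \<kappa>_snd linear_map_copower_proj[OF s]] us])
    ultimately have "on_T (\<lambda>x. ?v (\<kappa> (snd x)) \<oplus>\<^bsub>T\<^esub> u (copower_in I0 T1 s (\<kappa> (snd x) s))) \<in> F_square"
      by (rule F_square_add)
    then show ?case
    proof (rule on_T_cong)
      fix x assume "x \<in> carrier T"
      from linear_map_closed[OF \<kappa>_snd this]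
      show "u (\<kappa> (snd x)) = ?v (\<kappa> (snd x)) \<oplus>\<^bsub>T\<^esub> u (copower_in I0 T1 s (\<kappa> (snd x) s))"
        using linear_map_closed[OF u] linear_map_closed[OF ys]
        by (simp add: a_minus_def T.M.a_assoc T.M.l_neg)
    qed
  qed
  from this[OF assms(2) subset_refl u] show ?thesis by blast
qed

lemma I0_diff:
  assumes s: "s \<in> I0" and d: "d \<in> I0"
  shows "(\<lambda>x\<in>carrier P. s x \<oplus>\<^bsub>A\<^esub> \<ominus>\<^bsub>A\<^esub> d x) \<in> I0"
proof -
  interpret AA: right_module A A\<^sub>A by (rule A_A)
  have eq: "\<ominus>\<^bsub>A\<^sub>A\<^esub> a = \<ominus>\<^bsub>A\<^esub> a" if "a \<in> carrier A" for a
    using that by (intro AA.M.minus_equality) (auto simp: A.l_neg)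
  have "linear_map A P A\<^sub>A (\<lambda>x. s x \<oplus>\<^bsub>A\<^sub>A\<^esub> \<ominus>\<^bsub>A\<^sub>A\<^esub> d x)"
    by (intro linear_map_plus linear_map_uminus A_A I0_linear s d)
  from restrict_in_mod_hom[OF P this] show ?thesis
    using linear_map_closed[OF I0_linear[OF d]] by (simp add: eq cong: restrict_cong)
qed

lemma I0_closed: "s \<in> I0 \<Longrightarrow> x \<in> carrier P \<Longrightarrow> s x \<in> carrier A"
  using linear_map_closed[OF I0_linear] by simp

text \<open>
Write \<open>c\<^sub>s\<close> for the component maps \<open>Q \<rightarrow> M\<close>. From \<open>s = r + d\<close> and \<open>c\<^sub>s \<circ> \<sigma> = \<phi> \<circ> s\<close> it follows that
\<open>c\<^sub>s - c\<^sub>r - c\<^sub>d\<close> vanishes on the image of \<open>\<sigma>\<close>, so it induces a map \<open>T\<^sub>1 \<rightarrow> M\<close>.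
\<close>

lemma lift_difference:
  assumes s: "s \<in> I0" and d: "d \<in> I0"
  defines "r \<equiv> \<lambda>x\<in>carrier P. s x \<oplus>\<^bsub>A\<^esub> \<ominus>\<^bsub>A\<^esub> d x"
  shows "\<exists>w. linear_map A T1 M w \<and> (\<forall>t\<in>carrier T1.
    \<kappa> (w t) \<oplus>\<^bsub>sum_T\<^esub>
      (copower_in I0 T1 r t \<oplus>\<^bsub>sum_T\<^esub> copower_in I0 T1 d t) =
    copower_in I0 T1 s t)"
proof -
  interpret C: right_module A sum_T by (rule C)
  have r: "r \<in> I0" unfolding r_def by (rule I0_diff[OF s d])
  let ?rd = "\<lambda>q. summand r q \<oplus>\<^bsub>M\<^esub> summand d q"
  let ?w = "\<lambda>q. summand s q \<ominus>\<^bsub>M\<^esub> ?rd q"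
  have rd: "linear_map A Q M ?rd" by (rule linear_map_plus[OF M summand summand])
  have w: "linear_map A Q M ?w" by (rule linear_map_diff[OF M summand rd])
  have "?w (\<sigma> x) = \<zero>\<^bsub>M\<^esub>" if x: "x \<in> carrier P" for x
  proof -
    have "r x \<oplus>\<^bsub>A\<^esub> d x = s x"
      using I0_closed[OF s x] I0_closed[OF d x] x by (simp add: r_def A.a_assoc A.l_neg)
    then have "?rd (\<sigma> x) = summand s (\<sigma> x)"
      using summand_\<sigma>[OF r x] summand_\<sigma>[OF d x] summand_\<sigma>[OF s x]
        linear_map_add[OF \<phi>, of "r x" "d x"] I0_closed[OF r x] I0_closed[OF d x] by simp
    then show ?thesis
      using linear_map_closed[OF summand linear_map_closed[OF \<sigma> x]] by (simp add: M.M.minus_eq_zero_iff)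
  qed
  then obtain w where w': "linear_map A T1 M w" "\<And>q. q \<in> carrier Q \<Longrightarrow> w (p q) = ?w q"
    using factor_through_p[OF M w] by blast
  have "\<kappa> (w t) \<oplus>\<^bsub>sum_T\<^esub> (copower_in I0 T1 r t \<oplus>\<^bsub>sum_T\<^esub> copower_in I0 T1 d t) =
      copower_in I0 T1 s t" if t: "t \<in> carrier T1" for t
  proof -
    obtain q where q: "q \<in> carrier Q" "t = p q" using t p_surj by blast
    have sq: "summand s q \<in> carrier M" "summand r q \<in> carrier M" "summand d q \<in> carrier M"
      by (rule linear_map_closed[OF summand q(1)])+
    have "w t \<oplus>\<^bsub>M\<^esub> ?rd q = summand s q"
      using w'(2)[OF q(1)] sq by (simp add: q(2) a_minus_def M.M.a_assoc M.M.l_neg)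
    then have "\<kappa> (w t \<oplus>\<^bsub>M\<^esub> ?rd q) = copower_in I0 T1 s t"
      using \<kappa>_summand[OF s q(1)] q(2) by (simp only:)
    moreover have "w t \<in> carrier M" by (rule linear_map_closed[OF w'(1) t])
    ultimately show ?thesis
      using sq \<kappa>_summand[OF r q(1)] \<kappa>_summand[OF d q(1)] q(2)
      by (simp only: linear_map_add[OF \<kappa>] M.M.a_closed)
  qed
  then show ?thesis using w'(1) by (intro exI[of _ w]) blast
qed

text \<open>
Take \<open>S\<close> from \<open>large_set_avoiding_shift\<close> for the translation by some \<open>d \<noteq> 0\<close> and an injection
\<open>\<beta> : I\<^sub>0 \<rightarrow> S\<close>. Let \<open>v : T\<^sub>1\<^sup>(\<^sup>I\<^sup>0\<^sup>) \<rightarrow> M\<close> send the copy \<open>s\<close> of \<open>T\<^sub>1\<close> to \<open>M\<close> by a map that lifts the component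
\<open>\<beta> s\<close> up to the components \<open>\<beta> s - d\<close> and \<open>d\<close>. Let \<open>a\<close> read off only components in \<open>\<beta>(I\<^sub>0)\<close>, applying
on \<open>\<beta> s\<close> what \<open>u\<close> does on \<open>s\<close>; it ignores \<open>\<beta> s - d\<close> and \<open>d\<close>, which are not in \<open>S\<close>. Then
\<open>a \<circ> \<kappa> \<circ> v = u\<close>, so \<open>u \<circ> \<kappa>\<close> is the product of \<open>a \<circ> \<kappa>\<close> and \<open>v \<circ> \<kappa>\<close>.
\<close>

lemma F_square_\<kappa>_infinite:
  assumes u: "linear_map A sum_T T u" and inf: "infinite I0"
  shows "on_T (\<lambda>x. u (\<kappa> (snd x))) \<in> F_square"
proof -
  interpret C: right_module A sum_T by (rule C)
  let ?z = "\<lambda>x\<in>carrier P. \<zero>\<^bsub>A\<^esub>"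
  have "\<not> I0 \<subseteq> {?z}" using inf finite_subset by blast
  then obtain d where d: "d \<in> I0" "d \<noteq> ?z" by blast
  have "d x = undefined" if "x \<notin> carrier P" for x
    using d(1) that by (auto simp: mod_hom_iff extensional_def)
  then obtain x\<^sub>0 where x0: "x\<^sub>0 \<in> carrier P" "d x\<^sub>0 \<noteq> \<zero>\<^bsub>A\<^esub>"
    using d(2) by (metis (no_types, lifting) restrict_apply ext)
  let ?t = "\<lambda>s. \<lambda>x\<in>carrier P. s x \<oplus>\<^bsub>A\<^esub> \<ominus>\<^bsub>A\<^esub> d x"
  have inj: "inj_on ?t I0"
  proof (rule inj_onI)
    fix s s' assume ss: "s \<in> I0" "s' \<in> I0" "?t s = ?t s'"
    have "s x = s' x" if x: "x \<in> carrier P" for x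
      using fun_cong[OF ss(3), of x] x I0_closed[OF ss(1) x] I0_closed[OF ss(2) x] I0_closed[OF d(1) x]
      by simp
    then show "s = s'" using ss(1,2) by (auto simp: mod_hom_iff intro: extensionalityI)
  qed
  have "?t s \<noteq> s" if s: "s \<in> I0" for s
  proof
    assume "?t s = s"
    from fun_cong[OF this, of x\<^sub>0] have "s x\<^sub>0 \<oplus>\<^bsub>A\<^esub> \<ominus>\<^bsub>A\<^esub> d x\<^sub>0 = s x\<^sub>0" using x0 by simp
    then have "\<ominus>\<^bsub>A\<^esub> d x\<^sub>0 = \<zero>\<^bsub>A\<^esub>"
      using I0_closed[OF s x0(1)] I0_closed[OF d(1) x0(1)] by (simp add: A.add.l_cancel_one')
    then show False using x0 I0_closed[OF d(1) x0(1)] by (metis A.minus_minus A.minus_zero)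
  qed
  then obtain S where S: "S \<subseteq> I0" "\<And>s. s \<in> S \<Longrightarrow> ?t s \<notin> S" "d \<notin> S" "I0 \<lesssim> S"
    using large_set_avoiding_shift[OF inf inj, of d] by blast
  obtain \<beta> where \<beta>: "inj_on \<beta> I0" "\<beta> ` I0 \<subseteq> S" using S(4) by (auto simp: lepoll_def)
  have \<beta>S: "\<beta> s \<in> S" "\<beta> s \<in> I0" if "s \<in> I0" for s using that \<beta>(2) S(1) by auto
  have "\<forall>s. \<exists>w. s \<in> I0 \<longrightarrow> linear_map A T1 M w \<and> (\<forall>t\<in>carrier T1.
      \<kappa> (w t) \<oplus>\<^bsub>sum_T\<^esub>
        (copower_in I0 T1 (?t (\<beta> s)) t \<oplus>\<^bsub>sum_T\<^esub> copower_in I0 T1 d t) =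
      copower_in I0 T1 (\<beta> s) t)"
    using lift_difference[OF \<beta>S(2) d(1)] by simp
  from choice[OF this] obtain w where w: "\<And>s. s \<in> I0 \<Longrightarrow> linear_map A T1 M (w s)"
    and \<kappa>w: "\<And>s t. s \<in> I0 \<Longrightarrow> t \<in> carrier T1 \<Longrightarrow> \<kappa> (w s t) \<oplus>\<^bsub>sum_T\<^esub>
        (copower_in I0 T1 (?t (\<beta> s)) t \<oplus>\<^bsub>sum_T\<^esub> copower_in I0 T1 d t) =
      copower_in I0 T1 (\<beta> s) t" by blast
  define v where "v = copower_map I0 T1 M w"
  have v: "linear_map A sum_T M v" unfolding v_def by (rule linear_map_copower_map[OF T1 M w])
  define e where "e r = (if r \<in> \<beta> ` I0 then (\<lambda>t. u (copower_in I0 T1 (inv_into I0 \<beta> r) t)) else (\<lambda>t. \<zero>\<^bsub>T\<^esub>))" for r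
  have e: "linear_map A T1 T (e r)" for r
    using linear_map_comp[OF linear_map_copower_in[OF T1] u] linear_map_const_zero[OF T, of T1]
    by (simp add: e_def)
  define a where "a = copower_map I0 T1 T e"
  have a: "linear_map A sum_T T a" unfolding a_def by (rule linear_map_copower_map[OF T1 T e])
  have a_in: "a (copower_in I0 T1 r t) = e r t" if "r \<in> I0" "t \<in> carrier T1" for r t
    unfolding a_def using that by (rule copower_map_in[OF T1 T e])
  have av: "a (\<kappa> (v y)) = u y" if "y \<in> carrier sum_T" for y
  proof (rule linear_map_copower_eqI[OF T1 T linear_map_comp[OF linear_map_comp[OF v \<kappa>] a] u _ that])
    fix s t assume s: "s \<in> I0" and t: "t \<in> carrier T1"
    have r: "?t (\<beta> s) \<in> I0" by (rule I0_diff[OF \<beta>S(2)[OF s] d(1)])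
    have "v (copower_in I0 T1 s t) = w s t" unfolding v_def by (rule copower_map_in[OF T1 M w s t])
    moreover have in_c: "copower_in I0 T1 r t \<in> carrier sum_T" for r
      by (rule linear_map_closed[OF linear_map_copower_in[OF T1] t])
    moreover have \<kappa>wc: "\<kappa> (w s t) \<in> carrier sum_T"
      by (rule linear_map_closed[OF \<kappa> linear_map_closed[OF w[OF s] t]])
    moreover have "?t (\<beta> s) \<notin> \<beta> ` I0" "d \<notin> \<beta> ` I0"
      using S(2)[OF \<beta>S(1)[OF s]] S(3) \<beta>(2) by blast+
    then have "a (copower_in I0 T1 (?t (\<beta> s)) t) = \<zero>\<^bsub>T\<^esub>" "a (copower_in I0 T1 d t) = \<zero>\<^bsub>T\<^esub>"
      using a_in[OF r t] a_in[OF d(1) t] by (simp_all only: e_def if_False)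
    moreover have "a (copower_in I0 T1 (\<beta> s) t) = u (copower_in I0 T1 s t)"
      using a_in[OF \<beta>S(2)[OF s] t] s \<beta>(1) by (simp add: e_def)
    moreover have "a (\<kappa> (w s t)) \<in> carrier T" by (rule linear_map_closed[OF a \<kappa>wc])
    ultimately show "a (\<kappa> (v (copower_in I0 T1 s t))) = u (copower_in I0 T1 s t)"
      using arg_cong[OF \<kappa>w[OF s t], of a]
      by (simp only: linear_map_add[OF a] C.M.a_closed T.M.r_zero T.M.zero_closed)
  qed
  have v': "linear_map A sum_T T (\<lambda>y. (\<zero>\<^bsub>T1\<^esub>, v y))" by (rule linear_map_comp[OF v T_inr])
  have "on_T (\<lambda>x. a (\<kappa> (snd x))) \<in> F" "on_T (\<lambda>x. (\<zero>\<^bsub>T1\<^esub>, v (\<kappa> (snd x)))) \<in> F"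
    by (rule F_I[OF small_I \<kappa>_snd a] F_I[OF small_I \<kappa>_snd v'])+
  from F_square_prod[OF this linear_map_comp[OF \<kappa>_snd v']]
  have "on_T (\<lambda>x. a (\<kappa> (v (\<kappa> (snd x))))) \<in> F_square" by simp
  then show ?thesis by (rule on_T_cong) (simp add: av linear_map_closed[OF \<kappa>_snd])
qed

lemma F_square_\<kappa>:
  "linear_map A sum_T T u \<Longrightarrow> on_T (\<lambda>x. u (\<kappa> (snd x))) \<in> F_square"
  using F_square_\<kappa>_finite F_square_\<kappa>_infinite by blast

text \<open>
For \<open>u : T\<^sub>1 \<rightarrow> T\<close> and \<open>t \<in> T\<^sub>1\<close>, some map \<open>M \<rightarrow> T\<^sub>1\<close> sends \<open>\<phi> 1\<close> to \<open>t\<close>, and composing it with \<open>u\<close> gives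
a map through \<open>T\<^sub>1\<close> with value \<open>u t\<close> at \<open>\<tau>\<close>.
\<close>

lemma F_square_interpolate:
  assumes "x \<in> trace A T1 T"
  shows "\<exists>m. linear_map A T T m \<and> on_T m \<in> F_square \<and> m \<tau> = x"
  using assms
proof induction
  case zero
  then show ?case
    by (intro exI[of _ "\<lambda>x. \<zero>\<^bsub>T\<^esub>"] conjI linear_map_const_zero[OF T] F_square_zero refl)
next
  case (add u t x)
  then obtain m where m: "linear_map A T T m" "on_T m \<in> F_square" "m \<tau> = x" by blast
  obtain k where k: "linear_map A M T1 k" "k (\<phi> \<one>\<^bsub>A\<^esub>) = t"
    using M_approximation[OF T1 extends_T1 add.hyps(2)] by blast
  have k': "linear_map A T T1 (\<lambda>x. k (snd x))" by (rule linear_map_comp[OF T_snd k(1)])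
  show ?case
  proof (intro exI conjI)
    show "linear_map A T T (\<lambda>x. u (k (snd x)) \<oplus>\<^bsub>T\<^esub> m x)"
      by (rule linear_map_plus[OF T linear_map_comp[OF k' add.hyps(1)] m(1)])
    show "on_T (\<lambda>x. u (k (snd x)) \<oplus>\<^bsub>T\<^esub> m x) \<in> F_square"
      by (rule F_square_add[OF F_square_through_T1[OF k' add.hyps(1)] m(2)])
    show "u (k (snd \<tau>)) \<oplus>\<^bsub>T\<^esub> m \<tau> = u t \<oplus>\<^bsub>T\<^esub> x"
      using k(2) m(3) by (simp add: \<tau>_def)
  qed
qed

text \<open>
Subtracting an interpolating map one may assume \<open>g \<tau> = 0\<close>. Then \<open>g\<close> is the sum of a map through the
summand \<open>T\<^sub>1\<close> and of a map through \<open>\<kappa>\<close>.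
\<close>

lemma trace_valued_in_F_square:
  assumes g: "g \<in> mod_hom A T T" and tr: "g \<tau> \<in> trace A T1 T"
  shows "g \<in> F_square"
proof -
  have g': "linear_map A T T g" and gext: "on_T g = g"
    using g by (simp_all add: mod_hom_iff extensional_restrict)
  obtain m where m: "linear_map A T T m" "on_T m \<in> F_square" "m \<tau> = g \<tau>"
    using F_square_interpolate[OF tr] by blast
  let ?d = "\<lambda>x. g x \<ominus>\<^bsub>T\<^esub> m x"
  have d: "linear_map A T T ?d" by (rule linear_map_diff[OF T g' m(1)])
  have "?d \<tau> = \<zero>\<^bsub>T\<^esub>"
    using linear_map_closed[OF g' \<tau>_closed] m(3) by (simp add: T.M.minus_eq_zero_iff)
  then obtain u where u: "linear_map A sum_T T u"
    "\<And>m. m \<in> carrier M \<Longrightarrow> u (\<kappa> m) = ?d (\<zero>\<^bsub>T1\<^esub>, m)"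
    using M_factor_\<kappa>[OF T linear_map_comp[OF T_inr d]] unfolding \<tau>_def by blast
  have "on_T (\<lambda>x. ?d (fst x, \<zero>\<^bsub>M\<^esub>)) \<in> F_square"
    by (rule F_square_through_T1[OF T_fst linear_map_comp[OF T_inl d]])
  from F_square_add[OF m(2) F_square_add[OF this F_square_\<kappa>[OF u(1)]]]
  have "on_T (\<lambda>x. m x \<oplus>\<^bsub>T\<^esub> (?d (fst x, \<zero>\<^bsub>M\<^esub>) \<oplus>\<^bsub>T\<^esub> u (\<kappa> (snd x)))) \<in> F_square" .
  then have "on_T g \<in> F_square"
  proof (rule on_T_cong)
    fix x assume x: "x \<in> carrier T"
    then have "snd x \<in> carrier M" by (auto simp: T_eq)
    then have "?d (fst x, \<zero>\<^bsub>M\<^esub>) \<oplus>\<^bsub>T\<^esub> u (\<kappa> (snd x)) = ?d x"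
      using u(2) T_split[OF T d x] by simp
    moreover have "m x \<oplus>\<^bsub>T\<^esub> ?d x = g x"
      using linear_map_closed[OF g' x] linear_map_closed[OF m(1) x]
      by (simp add: a_minus_def T.M.a_lcomm T.M.r_neg)
    ultimately show "g x = m x \<oplus>\<^bsub>T\<^esub> (?d (fst x, \<zero>\<^bsub>M\<^esub>) \<oplus>\<^bsub>T\<^esub> u (\<kappa> (snd x)))" by (simp only:)
  qed
  then show ?thesis by (simp only: gext)
qed

lemma F_square_subset_F: "g \<in> F_square \<Longrightarrow> g \<in> F"
  unfolding F_square_def
proof (induction rule: ideal_prod.induct)
  case (prod i j)
  then show ?case by (rule F_mult[OF _ F_hom])
next
  case (sum s1 s2)
  show ?case by (rule F_add[OF sum.IH])
qed

lemma F_eq: "F = {g \<in> mod_hom A T T. g \<tau> \<in> trace A T1 T}"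
  and F_square_eq: "F_square = F"
  using F_hom F_trace[OF _ \<tau>_closed] trace_valued_in_F_square F_square_subset_F by blast+

end

section \<open>The isomorphism with the ring epimorphism\<close>

locale silting_epimorphism = silting_setup U A P Q \<sigma> T1 p
  for U :: "'u itself" and A :: "('a, 'm) ring_scheme"
    and P :: "('a, 'p) module" and Q :: "('a, 'q) module" and \<sigma> :: "'p \<Rightarrow> 'q"
    and T1 :: "('a, 't) module" and p :: "'q \<Rightarrow> 't" +
  fixes B :: "('b, 'n) ring_scheme" and f :: "'a \<Rightarrow> 'b"
  assumes small_B: "carrier B \<lesssim> (UNIV :: 'u set)"
    and epi: "ring_epimorphism TYPE('u) A B f"
    and image: "essential_image A B f = (Y_class A P Q \<sigma> T1 :: ('a, 'u) module set)"
begin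

sublocale B: ring B using epi by (simp add: ring_epimorphism_def)

lemma f_hom: "f \<in> ring_hom A B"
  using epi by (simp add: ring_epimorphism_def)

abbreviation (input) B\<^sub>A :: "('a, 'b) module" where "B\<^sub>A \<equiv> restrict_scalars f (regular_module B)"

lemma B_A: "right_module A B\<^sub>A"
  by (rule right_module_restrict_scalars[OF ring_A f_hom right_module_regular[OF B.ring_axioms]])

lemma Y_iff: "X \<in> Y_class A P Q \<sigma> T1 \<longleftrightarrow> right_module A X \<and> extends_along A P Q \<sigma> X \<and>
    hom_vanishes A T1 X"
  using mod_hom_eq_zero_iff[OF T1, of X] by (auto simp: Y_class_def mem_D_class_iff[OF P Q \<sigma>])

lemma hom_vanishes_iso:
  assumes X: "right_module A X" and Y: "right_module A Y"
    and i: "linear_map A X Y i" "bij_betw i (carrier X) (carrier Y)"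
    and zero: "hom_vanishes A T1 Y"
  shows "hom_vanishes A T1 X"
  unfolding hom_vanishes_def
proof (intro allI impI ballI)
  fix u t assume u: "linear_map A T1 X u" and t: "t \<in> carrier T1"
  interpret X: right_module A X by (rule X)
  have "i (u t) = i \<zero>\<^bsub>X\<^esub>"
    using hom_vanishesD[OF zero linear_map_comp[OF u i(1)] t] linear_map_zero[OF X Y i(1)] by simp
  then show "u t = \<zero>\<^bsub>X\<^esub>"
    using i(2) linear_map_closed[OF u t] by (auto simp: bij_betw_def dest: inj_onD)
qed

lemma B_A_in_Y: "extends_along A P Q \<sigma> B\<^sub>A" "hom_vanishes A T1 B\<^sub>A"
proof -
  have RB: "right_module B (regular_module B)" by (rule right_module_regular[OF B.ring_axioms])
  obtain N :: "('b, 'u) module" and i where N: "right_module B N"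
    and i: "linear_map B (regular_module B) N i" "bij_betw i (carrier (regular_module B)) (carrier N)"
    using small_copy[OF RB] small_B by (metis regular_module_simps(1))
  let ?X = "restrict_scalars f N"
  have X: "right_module A ?X" by (rule right_module_restrict_scalars[OF ring_A f_hom N])
  have "mod_isomorphic A ?X ?X"
    unfolding mod_isomorphic_iff[OF X] using linear_map_id bij_betw_id[unfolded id_def] by blast
  then have "?X \<in> essential_image A B f"
    unfolding essential_image_def Mod_class_def using X N by blast
  then have Y: "extends_along A P Q \<sigma> ?X" "hom_vanishes A T1 ?X"
    unfolding image Y_iff by blast+
  have iA: "linear_map A B\<^sub>A ?X i"
    using i(1) ring_hom_closed[OF f_hom] by (auto simp: linear_map_def)
  have ib: "bij_betw i (carrier B\<^sub>A) (carrier ?X)" using i(2) by simp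
  show "extends_along A P Q \<sigma> B\<^sub>A"
    by (rule extends_along_iso[OF X linear_map_inv_into[OF B_A iA ib] bij_betw_inv_into[OF ib] Y(1)])
  show "hom_vanishes A T1 B\<^sub>A" by (rule hom_vanishes_iso[OF B_A X iA ib Y(2)])
qed

lemma B_module_structure:
  assumes X: "right_module A X" "small U (carrier X)" and ext: "extends_along A P Q \<sigma> X"
    and zero: "hom_vanishes A T1 X"
  obtains N :: "('b, 'u) module" and \<theta> where "right_module B N"
    "linear_map A X (restrict_scalars f N) \<theta>" "bij_betw \<theta> (carrier X) (carrier N)"
proof -
  obtain Y :: "('a, 'u) module" and i where Y: "right_module A Y"
    and i: "linear_map A X Y i" "bij_betw i (carrier X) (carrier Y)"
    using small_copy[OF X] by blast
  have "extends_along A P Q \<sigma> Y" by (rule extends_along_iso[OF X(1) i ext])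
  moreover have "hom_vanishes A T1 Y"
    by (rule hom_vanishes_iso[OF Y X(1) linear_map_inv_into[OF X(1) i] bij_betw_inv_into[OF i(2)] zero])
  ultimately have "Y \<in> essential_image A B f" unfolding image Y_iff using Y by blast
  then obtain N :: "('b, 'u) module" where N: "right_module B N" "mod_isomorphic A Y (restrict_scalars f N)"
    unfolding essential_image_def Mod_class_def by blast
  then obtain j where j: "linear_map A Y (restrict_scalars f N) j"
    "bij_betw j (carrier Y) (carrier (restrict_scalars f N))"
    unfolding mod_isomorphic_iff[OF Y] by blast
  show ?thesis
    using that[OF N(1) linear_map_comp[OF i(1) j(1)]] bij_betw_trans[OF i(2) j(2)]
    by (simp add: o_def)
qed

text \<open>
The image \<open>N\<close> of \<open>\<eta>\<close> is the \<open>B\<close>-module \<open>T / trace T\<close>. The map \<open>b \<mapsto> \<eta> \<tau> \<cdot> b\<close> from \<open>B\<close> to \<open>N\<close>, after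
\<open>\<rho>\<close>, agrees with \<open>\<eta>\<close> at \<open>\<tau>\<close> and thus everywhere. So \<open>\<eta>\<close> vanishes on the kernel of \<open>\<rho>\<close>, which in
turn contains the trace because \<open>Hom(T\<^sub>1, B) = 0\<close>. The induced \<open>\<nu> : N \<rightarrow> B\<close> makes \<open>B \<rightarrow> N \<rightarrow> B\<close> an \<open>A\<close>-linear map fixing \<open>1\<close>, which is the identity by
\<open>ring_epimorphism_full\<close>.
\<close>

lemma T_to_B:
  "\<exists>\<rho>. linear_map A T B\<^sub>A \<rho> \<and> \<rho> \<tau> = \<one>\<^bsub>B\<^esub> \<and> \<rho> ` carrier T = carrier B \<and>
    (\<forall>x\<in>carrier T. \<rho> x = \<zero>\<^bsub>B\<^esub> \<longleftrightarrow> x \<in> trace A T1 T)"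
proof -
  have "\<one>\<^bsub>B\<^esub> \<in> carrier B\<^sub>A" by simp
  then obtain \<rho>' where \<rho>': "linear_map A M B\<^sub>A \<rho>'" "\<rho>' (\<phi> \<one>\<^bsub>A\<^esub>) = \<one>\<^bsub>B\<^esub>"
    using M_approximation[OF B_A B_A_in_Y(1)] by blast
  define \<rho> :: "'t \<times> ('a, 'p, 'q) bongartz \<Rightarrow> 'b"
    where "\<rho> = (\<lambda>x. \<rho>' (snd x))"
  have \<rho>: "linear_map A T B\<^sub>A \<rho>" unfolding \<rho>_def by (rule linear_map_comp[OF T_snd \<rho>'(1)])
  have \<rho>_\<tau>: "\<rho> \<tau> = \<one>\<^bsub>B\<^esub>" by (simp add: \<rho>_def \<tau>_def \<rho>'(2))
  let ?S = "trace A T1 T"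
  let ?R = "quotient_module T ?S" and ?\<pi> = "\<lambda>x. ?S +>\<^bsub>T\<^esub> x"
  note S = right_submodule_trace[OF T1 T]
  note R = quotient_module_right_module[OF T S] and \<pi> = quotient_module_proj[OF T S]
  note \<pi>_surj = quotient_module_surj[OF T S] and \<pi>_zero = quotient_module_eq_zero[OF T S]
  have small_R: "small U (carrier ?R)"
    using image_lepoll[of ?\<pi> "carrier T"] small_T lepoll_trans by (auto simp: \<pi>_surj)
  obtain N :: "('b, 'u) module" and \<theta> where N: "right_module B N"
    and \<theta>: "linear_map A ?R (restrict_scalars f N) \<theta>" "bij_betw \<theta> (carrier ?R) (carrier N)"
    by (rule B_module_structure[OF R small_R extends_quotient[OF T small_T R \<pi> \<pi>_surj extends_T]
          hom_T1_trace_quotient[OF T small_T]])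
  interpret N: right_module B N by (rule N)
  let ?N = "restrict_scalars f N"
  have NA: "right_module A ?N" by (rule right_module_restrict_scalars[OF ring_A f_hom N])
  define \<eta> :: "'t \<times> ('a, 'p, 'q) bongartz \<Rightarrow> 'u"
    where "\<eta> = (\<lambda>x. \<theta> (?\<pi> x))"
  have \<eta>: "linear_map A T ?N \<eta>" unfolding \<eta>_def by (rule linear_map_comp[OF \<pi> \<theta>(1)])
  have \<eta>_surj: "\<eta> ` carrier T = carrier N"
  proof -
    have "\<eta> ` carrier T = \<theta> ` ?\<pi> ` carrier T" by (simp add: \<eta>_def image_image)
    then show ?thesis using \<theta>(2) by (simp only: \<pi>_surj bij_betw_def)
  qed
  have \<eta>_zero: "\<eta> x = \<zero>\<^bsub>N\<^esub> \<longleftrightarrow> x \<in> ?S" if x: "x \<in> carrier T" for x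
  proof -
    interpret R: right_module A ?R by (rule R)
    have "\<theta> \<zero>\<^bsub>?R\<^esub> = \<zero>\<^bsub>N\<^esub>" using linear_map_zero[OF R NA \<theta>(1)] by simp
    then have "\<eta> x = \<zero>\<^bsub>N\<^esub> \<longleftrightarrow> ?\<pi> x = \<zero>\<^bsub>?R\<^esub>"
      using inj_on_eq_iff[OF bij_betw_imp_inj_on[OF \<theta>(2)] linear_map_closed[OF \<pi> x] R.M.zero_closed]
      by (simp only: \<eta>_def)
    then show ?thesis using \<pi>_zero[OF x] by simp
  qed
  have \<eta>_\<tau>: "\<eta> \<tau> \<in> carrier N" using linear_map_closed[OF \<eta> \<tau>_closed] by simp
  let ?\<mu> = "\<lambda>b. b \<odot>\<^bsub>N\<^esub> \<eta> \<tau>"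
  have \<mu>: "linear_map A B\<^sub>A ?N ?\<mu>"
    using \<eta>_\<tau> ring_hom_closed[OF f_hom] by (intro linear_mapI) (auto simp: N.smult_l_distr N.smult_assoc)
  have \<theta>': "bij_betw \<theta> (carrier ?R) (carrier ?N)" using \<theta>(2) by simp
  have N_zero: "hom_vanishes A T1 ?N"
    by (rule hom_vanishes_iso[OF NA R linear_map_inv_into[OF R \<theta>(1) \<theta>'] bij_betw_inv_into[OF \<theta>']
          hom_T1_trace_quotient[OF T small_T]])
  have \<mu>\<rho>: "?\<mu> (\<rho> x) = \<eta> x" if "x \<in> carrier T" for x
    by (rule linear_map_T_eqI[OF NA N_zero linear_map_comp[OF \<rho> \<mu>] \<eta> _ that])
      (simp_all add: \<rho>_\<tau> \<eta>_\<tau>)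
  have \<rho>_zero: "\<rho> x = \<zero>\<^bsub>B\<^esub> \<longleftrightarrow> x \<in> ?S" if x: "x \<in> carrier T" for x
  proof
    assume "\<rho> x = \<zero>\<^bsub>B\<^esub>"
    then show "x \<in> ?S" using \<mu>\<rho>[OF x] \<eta>_zero[OF x] \<eta>_\<tau> by (simp add: N.zero_smult)
  next
    assume "x \<in> ?S"
    then show "\<rho> x = \<zero>\<^bsub>B\<^esub>" using trace_vanishes[OF T B_A \<rho> B_A_in_Y(2)] by simp
  qed
  obtain \<nu> where \<nu>: "linear_map A ?N B\<^sub>A \<nu>" "\<And>x. x \<in> carrier T \<Longrightarrow> \<nu> (\<eta> x) = \<rho> x"
    by (rule linear_map_factor[OF T NA B_A \<eta> _ \<rho>]) (use \<eta>_surj \<eta>_zero \<rho>_zero in auto)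
  let ?e = "\<lambda>b. \<nu> (?\<mu> b)"
  have e: "linear_map A B\<^sub>A B\<^sub>A ?e" by (rule linear_map_comp[OF \<mu> \<nu>(1)])
  have e_id: "?e b = b" if b: "b \<in> carrier B" for b
  proof -
    have "?e (\<one>\<^bsub>B\<^esub> \<otimes>\<^bsub>B\<^esub> b) = ?e \<one>\<^bsub>B\<^esub> \<otimes>\<^bsub>B\<^esub> b"
    proof (rule ring_epimorphism_full[OF infinite_U small_B epi])
      fix x a assume "x \<in> carrier B" "a \<in> carrier A"
      then show "?e (x \<otimes>\<^bsub>B\<^esub> f a) = ?e x \<otimes>\<^bsub>B\<^esub> f a"
        using linear_map_smult[OF e, of a x] by simp
    qed (use b linear_map_closed[OF e] linear_map_add[OF e] in auto)
    moreover have "?e \<one>\<^bsub>B\<^esub> = \<one>\<^bsub>B\<^esub>" using \<nu>(2)[OF \<tau>_closed] \<rho>_\<tau> \<eta>_\<tau> by simp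
    ultimately show ?thesis using b by simp
  qed
  have "b \<in> \<rho> ` carrier T" if b: "b \<in> carrier B" for b
  proof -
    have "?\<mu> b \<in> \<eta> ` carrier T" using b \<eta>_\<tau> \<eta>_surj by simp
    then obtain x where x: "x \<in> carrier T" "?\<mu> b = \<eta> x" by blast
    then have "\<rho> x = b" using \<nu>(2)[OF x(1)] e_id[OF b] by simp
    then show ?thesis using x(1) by blast
  qed
  then have "\<rho> ` carrier T = carrier B" using linear_map_closed[OF \<rho>] by auto
  then show ?thesis using \<rho> \<rho>_\<tau> \<rho>_zero by (intro exI[of _ \<rho>]) simp
qed

text \<open>
The kernel of \<open>\<Theta> g = \<rho> (g \<tau>)\<close> consists of the \<open>g\<close> with \<open>g \<tau>\<close> in the trace, which is \<open>F\<close> by \<open>F_eq\<close>.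
\<close>

theorem End_ring_quotient:
  "ideal F (End_ring A T) \<and> B \<simeq> End_ring A T Quot F \<and> ideal_prod (End_ring A T) F F = F"
proof -
  obtain \<rho> where \<rho>: "linear_map A T B\<^sub>A \<rho>" "\<rho> \<tau> = \<one>\<^bsub>B\<^esub>"
    "\<And>x. x \<in> carrier T \<Longrightarrow> \<rho> x = \<zero>\<^bsub>B\<^esub> \<longleftrightarrow> x \<in> trace A T1 T" "\<rho> ` carrier T = carrier B"
    using T_to_B by blast
  let ?E = "End_ring A T"
  interpret E: ring ?E by (rule ring_End_ring[OF T])
  define \<Theta> where "\<Theta> g = \<rho> (g \<tau>)" for g
  have lin: "linear_map A T T g" if "g \<in> carrier ?E" for g using that by (simp add: mod_hom_iff)
  have \<rho>c: "\<rho> x \<in> carrier B" if "x \<in> carrier T" for x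
    using linear_map_closed[OF \<rho>(1) that] by simp
  have g\<tau>: "g \<tau> \<in> carrier T" if "g \<in> carrier ?E" for g
    by (rule linear_map_closed[OF lin[OF that] \<tau>_closed])
  have \<rho>g: "\<rho> (g x) = \<Theta> g \<otimes>\<^bsub>B\<^esub> \<rho> x" if g: "g \<in> carrier ?E" and x: "x \<in> carrier T" for g x
  proof (rule linear_map_T_eqI[OF B_A B_A_in_Y(2) linear_map_comp[OF lin[OF g] \<rho>(1)] _ _ x])
    have "linear_map A B\<^sub>A B\<^sub>A (\<lambda>b. \<Theta> g \<otimes>\<^bsub>B\<^esub> b)"
      using \<rho>c[OF g\<tau>[OF g]] ring_hom_closed[OF f_hom]
      by (intro linear_mapI) (auto simp: \<Theta>_def B.r_distr B.m_assoc)
    then show "linear_map A T B\<^sub>A (\<lambda>x. \<Theta> g \<otimes>\<^bsub>B\<^esub> \<rho> x)" by (rule linear_map_comp[OF \<rho>(1)])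
    show "\<rho> (g \<tau>) = \<Theta> g \<otimes>\<^bsub>B\<^esub> \<rho> \<tau>" using \<rho>c[OF g\<tau>[OF g]] \<rho>(2) by (simp add: \<Theta>_def)
  qed
  have hom: "\<Theta> \<in> ring_hom ?E B"
  proof (rule ring_hom_memI)
    fix g assume "g \<in> carrier ?E"
    then show "\<Theta> g \<in> carrier B" unfolding \<Theta>_def by (rule \<rho>c[OF g\<tau>])
  next
    fix g h assume gh: "g \<in> carrier ?E" "h \<in> carrier ?E"
    show "\<Theta> (g \<otimes>\<^bsub>?E\<^esub> h) = \<Theta> g \<otimes>\<^bsub>B\<^esub> \<Theta> h"
      using \<rho>g[OF gh(1) g\<tau>[OF gh(2)]] \<tau>_closed by (simp add: \<Theta>_def compose_def)
    show "\<Theta> (g \<oplus>\<^bsub>?E\<^esub> h) = \<Theta> g \<oplus>\<^bsub>B\<^esub> \<Theta> h"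
      using linear_map_add[OF \<rho>(1) g\<tau>[OF gh(1)] g\<tau>[OF gh(2)]] \<tau>_closed by (simp add: \<Theta>_def)
  next
    show "\<Theta> \<one>\<^bsub>?E\<^esub> = \<one>\<^bsub>B\<^esub>" using \<rho>(2) \<tau>_closed by (simp add: \<Theta>_def)
  qed
  interpret \<Theta>: ring_hom_ring ?E B \<Theta>
    by (rule ring_hom_ringI2[OF E.ring_axioms B.ring_axioms hom])
  have kernel: "a_kernel ?E B \<Theta> = F"
    unfolding F_eq a_kernel_def' using \<rho>(3)[OF g\<tau>] by (auto simp: \<Theta>_def)
  have surj: "\<Theta> ` carrier ?E = carrier B"
  proof (intro equalityI subsetI)
    fix b assume "b \<in> carrier B"
    then obtain x where x: "x \<in> carrier T" "b = \<rho> x" using \<rho>(4) by blast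
    obtain h where h: "linear_map A M T h" "h (\<phi> \<one>\<^bsub>A\<^esub>) = x"
      using M_approximation[OF T extends_T x(1)] by blast
    have "on_T (\<lambda>y. h (snd y)) \<in> carrier ?E"
      using restrict_in_mod_hom[OF T linear_map_comp[OF T_snd h(1)]] by simp
    moreover have "\<Theta> (on_T (\<lambda>y. h (snd y))) = b"
      using \<tau>_closed h(2) x(2) by (simp add: \<Theta>_def) (simp add: \<tau>_def)
    ultimately show "b \<in> \<Theta> ` carrier ?E" by blast
  qed (use \<Theta>.hom_closed in auto)
  have ideal: "ideal F ?E" using \<Theta>.kernel_is_ideal by (simp only: kernel)
  moreover have "?E Quot F \<simeq> B" using \<Theta>.FactRing_iso[OF surj] by (simp only: kernel)
  then have "B \<simeq> ?E Quot F" by (rule ring_iso_sym[OF ideal.quotient_is_ring[OF ideal]])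
  ultimately show ?thesis using F_square_eq by (simp add: F_square_def)
qed

end

lemma torsion_class_copower:
  fixes T :: "('a, 't) module" and J :: "'u set"
  assumes U: "infinite (UNIV :: 'u set)" and T: "right_module A T" and T_small: "carrier T \<lesssim> (UNIV :: 'u set)"
    and P: "right_module A P" and Q: "right_module A Q" and \<sigma>: "linear_map A P Q \<sigma>"
    and tors: "torsion_class A (D_class A P Q \<sigma> :: ('a, 'u) module set)"
    and ext: "extends_along A P Q \<sigma> T"
  shows "extends_along A P Q \<sigma> (copower J T)"
proof -
  have C: "right_module A (copower J T)" by (rule right_module_copower[OF T])
  obtain T' :: "('a, 'u) module" and i where T': "right_module A T'"
    and i: "linear_map A T T' i" "bij_betw i (carrier T) (carrier T')"
    using small_copy[OF T T_small] by blast
  obtain Y :: "('a, 'u) module" and j where Y: "right_module A Y"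
    and j: "linear_map A (copower J T) Y j" "bij_betw j (carrier (copower J T)) (carrier Y)"
    using small_copy[OF C lepoll_copower[OF U subset_imp_lepoll[OF subset_UNIV] T_small]] by blast
  note j' = linear_map_inv_into[OF C j]
  obtain k where k: "linear_map A (copower J T) (copower J T') k"
    "bij_betw k (carrier (copower J T)) (carrier (copower J T'))"
    by (rule copower_iso[OF T T' i bij_betw_id[unfolded id_def]])
  have "bij_betw (\<lambda>y. k (inv_into (carrier (copower J T)) j y)) (carrier Y) (carrier (copower J T'))"
    using bij_betw_trans[OF bij_betw_inv_into[OF j(2)] k(2)] by (simp add: o_def)
  then have iso: "mod_isomorphic A Y (copower J T')"
    unfolding mod_isomorphic_iff[OF Y] using linear_map_comp[OF j' k(1)] by blast
  have T'_D: "T' \<in> D_class A P Q \<sigma>"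
    unfolding mem_D_class_iff[OF P Q \<sigma>] using T' extends_along_iso[OF T i ext] by blast
  have Y_Mod: "Y \<in> Mod_class A" using Y by (simp add: Mod_class_def)
  from tors have "\<forall>(I :: 'u set) (X :: 'u \<Rightarrow> ('a, 'u) module). \<forall>Y \<in> Mod_class A. (\<forall>i\<in>I. X i \<in> D_class A P Q \<sigma>) \<and>
      mod_isomorphic A Y (coproduct I X) \<longrightarrow> (Y :: ('a, 'u) module) \<in> D_class A P Q \<sigma>"
    unfolding torsion_class_def by (elim conjE)
  from this[rule_format, of Y J "\<lambda>_. T'"] have "Y \<in> D_class A P Q \<sigma>"
    using Y_Mod T'_D iso by simp
  then have "extends_along A P Q \<sigma> Y" unfolding mem_D_class_iff[OF P Q \<sigma>] by blast
  then show ?thesis by (rule extends_along_iso[OF Y j' bij_betw_inv_into[OF j(2)]])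
qed

theorem theorem3p5:
  fixes A :: "('a, 'm) ring_scheme" and B :: "('b, 'n) ring_scheme" and f :: "'a \<Rightarrow> 'b"
    and P :: "('a, 'p) module" and Q :: "('a, 'q) module" and \<sigma> :: "'p \<Rightarrow> 'q"
    and T\<^sub>1 :: "('a, 't) module"
  assumes "infinite (UNIV :: 'u set)"
    and "carrier A \<lesssim> (UNIV :: 'u set)"
    and "carrier B \<lesssim> (UNIV :: 'u set)"
    and "carrier P \<lesssim> (UNIV :: 'u set)"
    and "carrier Q \<lesssim> (UNIV :: 'u set)"
    and "mod_hom A P (regular_module A) \<lesssim> (UNIV :: 'u set)"
    and "ring A"
    and "partial_silting TYPE('u) A P Q \<sigma> T\<^sub>1"
    and "associated_epimorphism TYPE('u) A P Q \<sigma> T\<^sub>1 B f"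
  shows "let T = bongartz_completion A P Q \<sigma> T\<^sub>1;
             E = End_ring A T;
             I = factoring_ideal TYPE('u) A T T\<^sub>1
         in ideal I E \<and> B \<simeq> E Quot I \<and> ideal_prod E I I = I"
proof -
  from assms(8) have pres: "projective_presentation TYPE('u) A P Q \<sigma> T\<^sub>1"
    and tors: "torsion_class A (D_class A P Q \<sigma> :: ('a, 'u) module set)"
    and T1_D: "T\<^sub>1 \<in> D_class A P Q \<sigma>"
    by (simp_all add: partial_silting_def)
  from pres have proj: "projective TYPE('u) A P" "projective TYPE('u) A Q"
    and T1: "right_module A T\<^sub>1" and \<sigma>: "linear_map A P Q \<sigma>"
    by (simp_all add: projective_presentation_def mod_hom_iff)
  have PQ: "right_module A P" "right_module A Q" using proj by (simp_all add: projective_def)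
  obtain p where p: "linear_map A Q T\<^sub>1 p" "p ` carrier Q = carrier T\<^sub>1"
    "\<sigma> ` carrier P = {q \<in> carrier Q. p q = \<zero>\<^bsub>T\<^sub>1\<^esub>}"
    using pres by (auto simp: projective_presentation_def mod_hom_iff)
  have T1_small: "carrier T\<^sub>1 \<lesssim> (UNIV :: 'u set)"
    using lepoll_trans[OF image_lepoll[of p "carrier Q"] assms(5)] by (simp add: p(2))
  have T1_ext: "extends_along A P Q \<sigma> T\<^sub>1" using T1_D by (simp add: mem_D_class_iff[OF PQ \<sigma>])
  interpret silting_epimorphism "TYPE('u)" A P Q \<sigma> T\<^sub>1 p B f
  proof (intro silting_epimorphism.intro silting_setup.intro silting_epimorphism_axioms.intro)
    show "extends_along A P Q \<sigma> (copower J T\<^sub>1)" for J :: "'u set"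
      by (rule torsion_class_copower[OF assms(1) T1 T1_small PQ \<sigma> tors T1_ext])
  qed (use assms(9) in \<open>simp_all add: associated_epimorphism_def assms(1-7) proj T1 \<sigma> p\<close>)
  show ?thesis
    using End_ring_quotient unfolding F_def T_def Let_def .
qed

end
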